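(* Let $k>2$ be an even integer and, for $\tau=u+iv\in\mathbb{H}$ and $z\in\mathbb{H}$, define \[ \Lambda_k(\tau,z):=\sum_{D>0} D^{k-\frac12}\,\omega_{k+1,D}(z)\,e^{2\pi i D\tau}, \] where $D$ runs over positive integers with $D\equiv 0,1\pmod 4$. Then for every fixed $z\in\mathbb{H}$, the function $\tau\mapsto\Lambda_k(\tau,z)$ is modular of weight $k+\frac12$ for $\Gamma_0(4)$, i.e. $\Lambda_k(\cdot,z)|_{k+\frac12}\gamma=\Lambda_k(\cdot,z)$ for all $\gamma\in\Gamma_0(4)$, and it lies in Kohnen's plus space.
   Context: $\mathbb{H}$ is the upper half-plane, $z=x+iy$. For a positive integer $D$, $\mathcal{Q}_D=\{aX^2+bXY+cY^2: a,b,c\in\mathbb{Z},\ b^2-4ac=D\}$; for $Q=[a,b,c]$, $Q_z:=\frac{1}{y}(a|z|^2+bx+c)$ and $Q(z,1)=az^2+bz+c$. Set $\omega_{k+1,D}(z):=\sum_{Q\in\mathcal{Q}_D}\frac{Q_z}{Q(z,1)^{k+1}}$ (absolutely convergent for $k>2$). $\Gamma_0(4)=\{\begin{pmatrix}a&b\\c&d\end{pmatrix}\in\mathrm{SL}_2(\mathbb{Z}): c\equiv0\pmod 4\}$. For $\kappa\in\mathbb{Z}+\frac12$ and $\gamma=\begin{pmatrix}a&b\\c&d\end{pmatrix}\in\Gamma_0(4)$, the slash operator is $(f|_\kappa\gamma)(\tau)=\left(\frac{c}{d}\right)\varepsilon_d^{2\kappa}(c\tau+d)^{-\kappa}f(\gamma\tau)$,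 where $\left(\frac{c}{d}\right)$ is the Kronecker symbol, $\varepsilon_d=1$ if $d\equiv1\pmod4$ and $\varepsilon_d=i$ if $d\equiv3\pmod4$, and the principal branch of the square root is used. A function of weight $\kappa\in\mathbb{Z}+\frac12$ is in Kohnen's plus space if its Fourier coefficients (about $i\infty$) are supported on indices $n$ with $(-1)^{\kappa-\frac12}n\equiv0,1\pmod4$. *)

theory Defs
  imports "HOL-Analysis.Analysis" "HOL-Number_Theory.Number_Theory"
begin

definition upper_half_plane :: "complex set" where
  "upper_half_plane = {z. Im z > 0}"


subsection \<open>Binary quadratic forms\<close>

text \<open>The triple \<open>(a, b, c)\<close> stands for the form \<open>a X\<^sup>2 + b X Y + c Y\<^sup>2\<close>.\<close>

definition quad_forms :: "int \<Rightarrow> (int \<times> int \<times> int) set" where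
  "quad_forms D = {(a, b, c). b\<^sup>2 - 4 * a * c = D}"

definition qf_eval :: "int \<times> int \<times> int \<Rightarrow> complex \<Rightarrow> complex" where
  "qf_eval Q z = (case Q of (a, b, c) \<Rightarrow> of_int a * z\<^sup>2 + of_int b * z + of_int c)"

definition qf_sub :: "int \<times> int \<times> int \<Rightarrow> complex \<Rightarrow> real" where
  "qf_sub Q z = (case Q of (a, b, c) \<Rightarrow>
     (of_int a * (cmod z)\<^sup>2 + of_int b * Re z + of_int c) / Im z)"

text \<open>The function \<open>\<omega>\<^sub>m\<^sub>,\<^sub>D\<close>, where the index \<open>m = k + 1\<close> is the exponent of \<open>Q(z, 1)\<close>.\<close>

definition omega :: "nat \<Rightarrow> int \<Rightarrow> complex \<Rightarrow> complex" where
  "omega m D z = (\<Sum>\<^sub>\<infinity>Q\<in>quad_forms D. of_real (qf_sub Q z) / qf_eval Q z ^ m)"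

definition Lambda :: "nat \<Rightarrow> complex \<Rightarrow> complex \<Rightarrow> complex" where
  "Lambda k \<tau> z =
     (\<Sum>\<^sub>\<infinity>D\<in>{D::int. D > 0 \<and> D mod 4 \<in> {0, 1}}.
        of_real (of_int D powr (real k - 1 / 2)) * omega (k + 1) D z *
        exp (2 * of_real pi * \<i> * of_int D * \<tau>))"


subsection \<open>Half-integral weight slash operator\<close>

definition Gamma0 :: "int \<Rightarrow> (int ^ 2 ^ 2) set" where
  "Gamma0 N = {\<gamma>. det \<gamma> = 1 \<and> N dvd \<gamma> $ 2 $ 1}"

definition moebius :: "int ^ 2 ^ 2 \<Rightarrow> complex \<Rightarrow> complex" where
  "moebius \<gamma> \<tau> = (of_int (\<gamma> $ 1 $ 1) * \<tau> + of_int (\<gamma> $ 1 $ 2)) /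
                 (of_int (\<gamma> $ 2 $ 1) * \<tau> + of_int (\<gamma> $ 2 $ 2))"

definition kronecker_prime :: "int \<Rightarrow> int \<Rightarrow> int" where
  "kronecker_prime a p =
     (if p = 2 then (if even a then 0 else if a mod 8 \<in> {1, 7} then 1 else -1)
      else Legendre a p)"

text \<open>The Kronecker symbol \<open>(a / n)\<close>; the sign factor is \<open>(a / -1)\<close>, which is \<open>-1\<close>
  for \<open>a < 0\<close> and \<open>1\<close> for \<open>a \<ge> 0\<close>, so in particular \<open>(0 / -1) = 1\<close>.\<close>

definition kronecker :: "int \<Rightarrow> int \<Rightarrow> int" where
  "kronecker a n =
     (if n = 0 then (if \<bar>a\<bar> = 1 then 1 else 0)
      else (if n < 0 \<and> a < 0 then -1 else 1) *
           (\<Prod>p\<in>prime_factors n. kronecker_prime a p ^ multiplicity p n))"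

definition eps :: "int \<Rightarrow> complex" where
  "eps d = (if d mod 4 = 1 then 1 else \<i>)"

text \<open>For complex arguments \<open>powr\<close> is defined by the principal logarithm, with imaginary part
  in \<open>(-\<pi>, \<pi>]\<close>; for half-integral \<open>\<kappa>\<close> this is the corresponding odd power of the principal
  square root.  The definitions below are meant for \<open>\<kappa>\<close> in \<open>\<int> + 1/2\<close> only, and \<open>eps d\<close> for odd
  \<open>d\<close>, which is automatic for the lower right entry of a matrix in \<open>Gamma0 4\<close>.\<close>

definition slash :: "real \<Rightarrow> int ^ 2 ^ 2 \<Rightarrow> (complex \<Rightarrow> complex) \<Rightarrow> complex \<Rightarrow> complex" where
  "slash \<kappa> \<gamma> f \<tau> =
     of_int (kronecker (\<gamma> $ 2 $ 1) (\<gamma> $ 2 $ 2)) *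
     eps (\<gamma> $ 2 $ 2) powr of_real (2 * \<kappa>) *
     (of_int (\<gamma> $ 2 $ 1) * \<tau> + of_int (\<gamma> $ 2 $ 2)) powr of_real (- \<kappa>) *
     f (moebius \<gamma> \<tau>)"

definition modular_Gamma0_4 :: "real \<Rightarrow> (complex \<Rightarrow> complex) \<Rightarrow> bool" where
  "modular_Gamma0_4 \<kappa> f \<longleftrightarrow>
     (\<forall>\<gamma>\<in>Gamma0 4. \<forall>\<tau>\<in>upper_half_plane. slash \<kappa> \<gamma> f \<tau> = f \<tau>)"

definition fourier_expansion :: "(complex \<Rightarrow> complex) \<Rightarrow> (int \<Rightarrow> complex) \<Rightarrow> bool" where
  "fourier_expansion f a \<longleftrightarrow>
     (\<forall>\<tau>\<in>upper_half_plane.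
        ((\<lambda>n. a n * exp (2 * of_real pi * \<i> * of_int n * \<tau>)) has_sum f \<tau>) UNIV)"

text \<open>For \<open>\<kappa>\<close> in \<open>\<int> + 1/2\<close> the conditional expression is \<open>(-1)\<close> to the power \<open>\<kappa> - 1/2\<close>,
  times \<open>n\<close>.  Only expansions with constant coefficients are considered, that is, \<open>q\<close>-series,
  with finitely or infinitely many terms of negative index allowed.\<close>

definition kohnen_plus_space :: "real \<Rightarrow> (complex \<Rightarrow> complex) set" where
  "kohnen_plus_space \<kappa> =
     {f. modular_Gamma0_4 \<kappa> f \<and>
         (\<exists>a. fourier_expansion f a \<and>
              (\<forall>n. a n \<noteq> 0 \<longrightarrow> (if even \<lfloor>\<kappa> - 1 / 2\<rfloor> then n else - n) mod 4 \<in> {0, 1}))}"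

end

theory Submission
  imports Defs
begin

text \<open>
  Put \<open>f\<^sub>\<tau>(Q) = max (disc Q) 0 ^ (k - 1/2) * Q\<^sub>z / Q(z,1) ^ (k + 1) * exp (2 \<pi> i \<tau> disc Q)\<close>, so that
  \<open>\<Lambda>\<close> is the sum of \<open>f\<^sub>\<tau>\<close> over the integral forms.  The polynomial part is homogeneous and
  annihilated by the wave operator \<open>\<box> = \<partial>\<^sub>b\<^sup>2 - \<partial>\<^sub>a \<partial>\<^sub>c\<close>.  Hence, along the one-parameter group
  \<open>W\<^sup>s \<tau> = \<tau> / (4 s \<tau> + 1)\<close>, the functions \<open>K\<^sub>s = (4 s \<tau> + 1) ^ (- k - 1/2) * f\<close> at \<open>W\<^sup>s \<tau>\<close> solve the
  Schroedinger-type equation \<open>\<partial>\<^sub>s K\<^sub>s = i / (2 \<pi>) * \<box> K\<^sub>s\<close>.  On the Fourier side, at an integral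
  frequency \<open>(p, q, r)\<close>, this flow is multiplication by \<open>exp (- 2 \<pi> i s (q\<^sup>2 - p r))\<close>, which is
  trivial at \<open>s = 1\<close>.  So the periodisations of \<open>K\<^sub>0\<close> and \<open>K\<^sub>1\<close> have the same Fourier coefficients and
  therefore agree, which is the transformation law under \<open>W\<close>.  Translations are clear from the
  \<open>q\<close>-series, and Euclid's algorithm together with reciprocity for the Jacobi symbol propagates the
  law from these two generators to \<open>\<Gamma>\<^sub>0(4)\<close> with the theta multiplier.
\<close>

section \<open>The Jacobi and Kronecker symbols\<close>

text \<open>The exponent \<open>k - 1/2\<close> is forced. Let D be the discriminant and P = Q_z /
  Q(z,1)^(k+1), homogeneous of degree -k. Where D > 0, the wave operator sends D^\<alpha> P to 4
  \<alpha> (\<alpha> + 1/2 - k) D^(\<alpha>-1) P, which vanishes for \<alpha> = k - 1/2; the weight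
  k + 1/2 is then what the factor exp (l D) contributes. The obstacle is regularity: the kernel is
  only finitely differentiable across the cone D = 0, its higher derivatives are singular at the
  origin, and close to the cone it decays only like |Q(z,1)|^(-k). So no Fourier transform is
  computed. The flow is tested against characters damped by Gaussians, integration by parts runs
  along lines that miss the origin, and the damping costs O(sqrt \<epsilon>). Of Poisson summation
  only one consequence is proved: a continuous function with a summable majorant whose Fourier
  integrals at integral frequencies all vanish has lattice sum 0. The bound 4 <= k is what the decay
  asks for, since |Q(z,1)|^(-k) has to be dominated by an inverse fourth power.\<close>

definition jacobi :: "int \<Rightarrow> int \<Rightarrow> int" where
  "jacobi a n = (\<Prod>p\<in>#prime_factorization n. Legendre a p)"

text \<open>On odd arguments this is (-1)^((m-1)/2 * (n-1)/2). It sees only residues modulo 4, so it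
  stays meaningful for negative arguments, as \<open>kronecker_reciprocal\<close> requires.\<close>

definition recip_sign :: "int \<Rightarrow> int \<Rightarrow> int" where
  "recip_sign m n = (if m mod 4 = 3 \<and> n mod 4 = 3 then -1 else 1)"

lemma Legendre_cases: "Legendre a p \<in> {-1, 0, 1}"
  by (auto simp: Legendre_def)

lemma Legendre_cong: "[a = b] (mod p) \<Longrightarrow> Legendre a p = Legendre b p"
  by (simp add: Legendre_def QuadRes_def cong_def)

text \<open>Two values in {-1, 0, 1} differ by at most 2, so a modulus above 2 that divides the
  difference forces equality. Euler's congruence thereby becomes an identity of symbols.\<close>

lemma Legendre_eqI:
  assumes "[x = y] (mod p)" "x \<in> {-1, 0, 1}" "y \<in> {-1, 0, 1}" "(p::int) > 2"
  shows "x = y"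
proof (rule ccontr)
  assume "x \<noteq> y"
  moreover have "p dvd x - y" using assms(1) by (simp add: cong_iff_dvd_diff)
  ultimately have "\<bar>p\<bar> \<le> \<bar>x - y\<bar>" by (intro dvd_imp_le_int) auto
  with assms show False by auto
qed

lemma euler_int:
  assumes "prime (p::int)" "p > 2"
  shows "[Legendre a p = a ^ nat ((p - 1) div 2)] (mod p)"
proof -
  have n: "int (nat p) = p" using assms by simp
  have "prime (nat p)" using assms(1) prime_int_nat_transfer by blast
  moreover have "2 < nat p" using assms by linarith
  ultimately have "[Legendre a (int (nat p)) = a ^ ((nat p - 1) div 2)] (mod int (nat p))"
    by (rule euler_criterion)
  moreover have "(nat p - 1) div 2 = nat ((p - 1) div 2)"
    using assms by linarith
  ultimately show ?thesis unfolding n by metis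
qed

lemma Legendre_mult:
  assumes "prime (p::int)" "p > 2"
  shows "Legendre (a * b) p = Legendre a p * Legendre b p"
proof (rule Legendre_eqI[of _ _ p])
  have "[Legendre a p * Legendre b p = a ^ nat ((p - 1) div 2) * b ^ nat ((p - 1) div 2)] (mod p)"
    by (intro cong_mult euler_int assms)
  then show "[Legendre (a * b) p = Legendre a p * Legendre b p] (mod p)"
    using euler_int[OF assms, of "a * b"]
    unfolding power_mult_distrib by (rule cong_trans[OF _ cong_sym, rotated])
  show "Legendre a p * Legendre b p \<in> {-1, 0, 1}"
    using Legendre_cases[of a p] Legendre_cases[of b p] by auto
qed (use assms Legendre_cases in auto)

lemma odd_prime_gt_2: "prime (p::int) \<Longrightarrow> odd p \<Longrightarrow> p > 2"
  using prime_ge_2_int[of p] by (cases "p = 2") auto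

lemma Legendre_minus_one:
  assumes "prime (p::int)" "odd p"
  shows "Legendre (-1) p = (if p mod 4 = 1 then 1 else -1)"
proof -
  have p: "p > 2" using odd_prime_gt_2 assms by auto
  have "Legendre (-1) p = (-1) ^ nat ((p - 1) div 2)"
    by (rule Legendre_eqI[OF euler_int[OF assms(1) p]])
       (use p Legendre_cases neg_one_even_power in \<open>auto simp: minus_one_power_iff\<close>)
  moreover have "even (nat ((p - 1) div 2)) \<longleftrightarrow> p mod 4 = 1"
  proof -
    have "even (nat ((p - 1) div 2)) \<longleftrightarrow> even ((p - 1) div 2)" using p by (simp add: even_nat_iff)
    also have "\<dots> \<longleftrightarrow> p mod 4 = 1" using assms(2) by presburger
    finally show ?thesis .
  qed
  ultimately show ?thesis by (simp add: minus_one_power_iff)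
qed

lemma Legendre_recip:
  assumes "prime (p::int)" "odd p" "prime (q::int)" "odd q"
  shows "Legendre p q = recip_sign p q * Legendre q p"
proof (cases "p = q")
  case True
  then show ?thesis by (simp add: Legendre_def cong_def)
next
  case False
  have gt: "p > 2" "q > 2" using odd_prime_gt_2 assms by auto
  have e: "even (nat ((p - 1) div 2 * ((q - 1) div 2))) \<longleftrightarrow> \<not> (p mod 4 = 3 \<and> q mod 4 = 3)"
  proof -
    have "even (nat ((p - 1) div 2 * ((q - 1) div 2))) \<longleftrightarrow> even ((p - 1) div 2 * ((q - 1) div 2))"
      using gt by (intro even_nat_iff) auto
    also have "\<dots> \<longleftrightarrow> even ((p - 1) div 2) \<or> even ((q - 1) div 2)" by simp
    also have "\<dots> \<longleftrightarrow> \<not> (p mod 4 = 3 \<and> q mod 4 = 3)" using assms(2,4) by presburger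
    finally show ?thesis .
  qed
  have "Legendre p q * Legendre q p = (-1) ^ nat ((p - 1) div 2 * ((q - 1) div 2))"
    using Quadratic_Reciprocity_int[of p q] False gt assms prime_int_nat_transfer by blast
  then have "Legendre p q * Legendre q p = recip_sign p q"
    using e by (simp add: minus_one_power_iff recip_sign_def)
  then show ?thesis
    using Legendre_cases[of p q] Legendre_cases[of q p] by (auto simp: recip_sign_def split: if_splits)
qed

lemma odd_prime_factor: "odd (n::int) \<Longrightarrow> p \<in># prime_factorization n \<Longrightarrow> prime p \<and> odd p"
  by (metis dvd_trans in_prime_factors_imp_dvd in_prime_factors_imp_prime)

section \<open>Jacobi symbol: multiplicativity, reciprocity and supplementary laws\<close>

lemma jacobi_one [simp]: "jacobi a 1 = 1"
  by (simp add: jacobi_def)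

lemma jacobi_prime [simp]: "prime p \<Longrightarrow> jacobi a p = Legendre a p"
  by (simp add: jacobi_def prime_factorization_prime)

lemma jacobi_mult_right:
  "m \<noteq> 0 \<Longrightarrow> n \<noteq> 0 \<Longrightarrow> jacobi a (m * n) = jacobi a m * jacobi a n"
  by (simp add: jacobi_def prime_factorization_mult)

lemma jacobi_mult_left:
  assumes "odd n"
  shows "jacobi (a * b) n = jacobi a n * jacobi b n"
  unfolding jacobi_def prod_mset.distrib[symmetric]
  by (intro arg_cong[of _ _ prod_mset] image_mset_cong Legendre_mult)
     (use odd_prime_factor[OF assms] odd_prime_gt_2 in blast)+

lemma jacobi_power_left: "odd n \<Longrightarrow> jacobi (a ^ e) n = jacobi a n ^ e"
proof (induction e)
  case 0
  have "Legendre 1 p = 1" if "p \<in># prime_factorization n" for p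
  proof -
    have "prime p" using that by auto
    then have "\<not> [1 = 0] (mod p)" by (auto simp: cong_iff_dvd_diff)
    moreover have "QuadRes p 1" unfolding QuadRes_def by (rule exI[of _ 1]) simp
    ultimately show ?thesis by (simp add: Legendre_def)
  qed
  then show ?case by (auto simp: jacobi_def intro!: prod_mset.neutral)
qed (simp add: jacobi_mult_left)

lemma jacobi_cong:
  assumes "[a = b] (mod n)"
  shows "jacobi a n = jacobi b n"
  unfolding jacobi_def
proof (intro arg_cong[of _ _ prod_mset] image_mset_cong Legendre_cong)
  fix p assume "p \<in># prime_factorization n"
  then show "[a = b] (mod p)" using assms cong_dvd_modulus in_prime_factors_imp_dvd by blast
qed

lemma odd_mod4: "odd (n::int) \<Longrightarrow> n mod 4 = 1 \<or> n mod 4 = 3"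
  by presburger

lemma odd_mult_mod4:
  assumes "odd (a::int)" "odd b"
  shows "(a * b) mod 4 = (if (a mod 4 = 3) = (b mod 4 = 3) then 1 else 3)"
proof -
  have "(a * b) mod 4 = (a mod 4) * (b mod 4) mod 4" by (simp add: mod_mult_eq)
  then show ?thesis
    using odd_mod4[OF assms(1)] odd_mod4[OF assms(2)]
    by (elim disjE) (simp_all del: mod_mult_eq mod_mult_left_eq mod_mult_right_eq)
qed

lemma jacobi_minus_one:
  "(n::int) > 0 \<Longrightarrow> odd n \<Longrightarrow> jacobi (-1) n = (if n mod 4 = 1 then 1 else -1)"
proof (induction n rule: prime_divisors_induct)
  case (unit x)
  then show ?case by simp
next
  case (factor p x)
  have "p > 0" using factor.hyps prime_gt_0_int by blast
  then have x: "x > 0" "odd x" "odd p" using factor.prems by (auto simp: zero_less_mult_iff)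
  show ?case
    using odd_mult_mod4[OF x(3,2)] factor.IH x Legendre_minus_one[OF factor.hyps x(3)] odd_mod4[of p] odd_mod4[of x] \<open>p > 0\<close>
    by (auto simp: jacobi_mult_right factor.hyps)
qed auto

lemma recip_sign_mult_left:
  assumes "odd a" "odd b" "odd c"
  shows "recip_sign (a * b) c = recip_sign a c * recip_sign b c"
  using odd_mult_mod4[OF assms(1,2)] odd_mod4[OF assms(1)] odd_mod4[OF assms(2)]
  by (auto simp: recip_sign_def split: if_splits)

lemma recip_sign_commute: "recip_sign a b = recip_sign b a"
  by (auto simp: recip_sign_def)

lemma jacobi_recip_prime:
  "(m::int) > 0 \<Longrightarrow> odd m \<Longrightarrow> prime q \<Longrightarrow> odd q \<Longrightarrow> jacobi m q = recip_sign m q * jacobi q m"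
proof (induction m rule: prime_divisors_induct)
  case (unit x)
  then show ?case using jacobi_power_left[of q 1 0] by (simp add: recip_sign_def)
next
  case (factor p x)
  have "p > 0" using factor.hyps prime_gt_0_int by blast
  then have x: "x > 0" "odd x" "odd p" using factor.prems by (auto simp: zero_less_mult_iff)
  have "jacobi (p * x) q = Legendre p q * jacobi x q"
    using factor.prems by (simp add: Legendre_mult odd_prime_gt_2)
  also have "\<dots> = recip_sign (p * x) q * (Legendre q p * jacobi q x)"
    using factor.IH x factor.prems Legendre_recip[OF factor.hyps x(3) factor.prems(3,4)]
    by (simp add: recip_sign_mult_left)
  also have "Legendre q p * jacobi q x = jacobi q (p * x)"
    using x \<open>p > 0\<close> factor.hyps by (simp add: jacobi_mult_right)
  finally show ?case .
qed auto

lemma jacobi_recip: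
  "(n::int) > 0 \<Longrightarrow> odd n \<Longrightarrow> m > 0 \<Longrightarrow> odd m \<Longrightarrow> jacobi m n = recip_sign m n * jacobi n m"
proof (induction n rule: prime_divisors_induct)
  case (unit x)
  then show ?case using jacobi_power_left[of m 1 0] by (simp add: recip_sign_def)
next
  case (factor p x)
  have "p > 0" using factor.hyps prime_gt_0_int by blast
  then have x: "x > 0" "odd x" "odd p" using factor.prems by (auto simp: zero_less_mult_iff)
  have "jacobi m (p * x) = jacobi m p * jacobi m x"
    using x \<open>p > 0\<close> by (simp add: jacobi_mult_right del: jacobi_prime)
  also have "\<dots> = recip_sign m (p * x) * (jacobi p m * jacobi x m)"
    using factor.IH x factor.prems jacobi_recip_prime[of m p] factor.hyps
    by (simp add: recip_sign_mult_left recip_sign_commute[of m])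
  also have "jacobi p m * jacobi x m = jacobi (p * x) m"
    using factor.prems by (simp add: jacobi_mult_left)
  finally show ?case .
qed auto

text \<open>On odd \<open>n\<close> this is the quadratic character modulo 8 given by (2 /
  n).\<close>

definition chi8 :: "int \<Rightarrow> int" where
  "chi8 n = (if n mod 8 \<in> {1, 7} then 1 else -1)"

text \<open>Descent from n to n - 2: (-1/n)(2/n) = (-2/n) = ((n-2)/n), which reciprocity turns into
  (n/(n-2)) = (2/(n-2)). Of two consecutive odd numbers one is 1 modulo 4, so this use of
  reciprocity has no sign.\<close>

lemma jacobi_two_aux: "jacobi 2 (2 * int m + 1) = chi8 (2 * int m + 1)"
proof (induction m)
  case 0
  then show ?case by (simp add: chi8_def)
next
  case (Suc m)
  define n :: int where "n = 2 * int (Suc m) + 1"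
  have n: "n > 0" "odd n" "n - 2 > 0" "odd (n - 2)" by (auto simp: n_def)
  have "jacobi (-1) n * jacobi 2 n = jacobi (-2) n"
    using jacobi_mult_left[OF n(2), of "-1" 2] by simp
  also have "\<dots> = jacobi (n - 2) n" by (rule jacobi_cong) (simp add: cong_iff_dvd_diff)
  also have "\<dots> = recip_sign (n - 2) n * jacobi n (n - 2)" using n by (intro jacobi_recip) auto
  also have "jacobi n (n - 2) = jacobi 2 (n - 2)" by (rule jacobi_cong) (simp add: cong_iff_dvd_diff)
  also have "\<dots> = chi8 (n - 2)" using Suc by (simp add: n_def algebra_simps)
  also have "recip_sign (n - 2) n = 1" unfolding recip_sign_def by presburger
  finally have "jacobi (-1) n * jacobi 2 n = chi8 (n - 2)" by simp
  then have "jacobi 2 n = jacobi (-1) n * chi8 (n - 2)"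
    using jacobi_minus_one[OF n(1,2)] by (auto split: if_splits)
  also have "\<dots> = chi8 n"
  proof -
    have *: "n mod 8 = 1 \<or> n mod 8 = 3 \<or> n mod 8 = 5 \<or> n mod 8 = 7" using n(2) by presburger
    have 1: "(n - 2) mod 8 = (n mod 8 - 2) mod 8" by (rule mod_diff_left_eq[symmetric])
    have 2: "n mod 4 = (n mod 8) mod 4" by (simp add: mod_mod_cancel)
    show ?thesis
      unfolding chi8_def jacobi_minus_one[OF n(1,2)] 1 2
      using * by (elim disjE) (simp_all del: mod_diff_left_eq mod_mod_cancel)
  qed
  finally show ?case by (simp add: n_def)
qed

lemma jacobi_two: "n > 0 \<Longrightarrow> odd n \<Longrightarrow> jacobi 2 n = chi8 n"
  using jacobi_two_aux[of "nat (n div 2)"] by (auto elim!: oddE)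

section \<open>Kronecker symbol with odd lower argument\<close>

lemma kronecker_odd:
  assumes "odd d"
  shows "kronecker c d = (if d < 0 \<and> c < 0 then -1 else 1) * jacobi c \<bar>d\<bar>"
proof -
  have "d \<noteq> 0" using assms by auto
  have "prime_factorization \<bar>d\<bar> = prime_factorization d"
    using prime_factorization_normalize[of d] by simp
  then have "jacobi c \<bar>d\<bar> = (\<Prod>p\<in>prime_factors d. Legendre c p ^ count (prime_factorization d) p)"
    by (simp add: jacobi_def image_prod_mset_multiplicity)
  also have "\<dots> = (\<Prod>p\<in>prime_factors d. kronecker_prime c p ^ multiplicity p d)"
  proof (rule prod.cong)
    fix p assume p: "p \<in> prime_factors d"
    then have "p \<noteq> 2" using odd_prime_factor[OF assms, of p] by auto
    moreover have "count (prime_factorization d) p = multiplicity p d"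
      using p by (intro count_prime_factorization_prime) auto
    ultimately show "Legendre c p ^ count (prime_factorization d) p
        = kronecker_prime c p ^ multiplicity p d"
      by (simp add: kronecker_prime_def)
  qed simp
  finally show ?thesis using \<open>d \<noteq> 0\<close> by (simp add: kronecker_def)
qed

text \<open>The right-hand side depends on \<open>d\<close> only through residue classes, with no condition on the sign
  of \<open>d\<close>: the sign convention \<open>(c / -1) = -1\<close> for \<open>c < 0\<close> is exactly what cancels the sign changes of
  the individual factors.\<close>

lemma kronecker_reciprocal:
  assumes "odd d" "odd n" "n > 0" "\<sigma> \<in> {1, -1}" "c = \<sigma> * 2 ^ e * n"
  shows "kronecker c d = (if \<sigma> = -1 \<and> d mod 4 = 3 then -1 else 1) * chi8 d ^ e
           * recip_sign n d * jacobi d n"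
proof -
  define m where "m = \<bar>d\<bar>"
  have m: "m > 0" "odd m" using assms by (auto simp: m_def)
  have c0: "c < 0 \<longleftrightarrow> \<sigma> = -1" using assms by (auto simp: mult_less_0_iff)
  have "(- d) mod 8 = 1 \<longleftrightarrow> d mod 8 = 7" "(- d) mod 8 = 7 \<longleftrightarrow> d mod 8 = 1"
    by (auto simp: zmod_zminus1_eq_if)
  then have chi: "chi8 m = chi8 d" by (auto simp: chi8_def m_def abs_if)
  have J: "jacobi c m = jacobi \<sigma> m * chi8 d ^ e * (recip_sign n m * jacobi m n)"
    using m assms jacobi_two[OF m] jacobi_recip[of m n] chi
    by (simp add: jacobi_mult_left jacobi_power_left)
  have s: "jacobi \<sigma> m * (if d < 0 \<and> c < 0 then -1 else 1)
      = (if \<sigma> = -1 \<and> d mod 4 = 3 then -1 else 1)"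
  proof (cases "\<sigma> = 1")
    case True
    then show ?thesis using jacobi_power_left[OF m(2), of 1 0] c0 by simp
  next
    case False
    then have "\<sigma> = -1" using assms by auto
    moreover have "d mod 4 = 1 \<or> d mod 4 = 3" using odd_mod4 assms by auto
    moreover have "(-d) mod 4 = 1 \<longleftrightarrow> d mod 4 = 3" by (auto simp: zmod_zminus1_eq_if)
    ultimately show ?thesis using c0 jacobi_minus_one[OF m] by (auto simp: m_def abs_if)
  qed
  have r: "recip_sign n m * jacobi m n = recip_sign n d * jacobi d n"
  proof (cases "d < 0")
    case False
    then show ?thesis by (simp add: m_def)
  next
    case True
    then have "m = -1 * d" by (simp add: m_def)
    then have "jacobi m n = jacobi (-1) n * jacobi d n" using assms jacobi_mult_left by metis
    moreover have "recip_sign n m * jacobi (-1) n = recip_sign n d"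
    proof -
      have "m mod 4 = 3 \<longleftrightarrow> d mod 4 = 1" using \<open>m = -1 * d\<close> by (auto simp: zmod_zminus1_eq_if)
      then show ?thesis
        using odd_mod4[OF assms(1)] odd_mod4[OF assms(2)] jacobi_minus_one[OF assms(3,2)]
        by (auto simp: recip_sign_def)
    qed
    ultimately show ?thesis by (simp add: mult.assoc[symmetric])
  qed
  show ?thesis
    unfolding kronecker_odd[OF assms(1)] m_def[symmetric] J
    using s r by (simp add: algebra_simps)
qed

text \<open>By \<open>kronecker_reciprocal\<close>, for fixed \<open>c\<close> the symbol depends on
  \<open>d\<close> through its class modulo 4, modulo the odd part of \<open>c\<close>, and modulo 8
  if \<open>c\<close> contains an odd power of 2. Adding a multiple of 4 that equals
  \<open>c\<close> changes none of these.\<close>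

lemma kronecker_add_left:
  assumes "odd d" "4 dvd c"
  shows "kronecker c (d + c) = kronecker c d"
proof (cases "c = 0")
  case False
  define e where "e = multiplicity 2 c"
  obtain r where r: "c = 2 ^ e * r" "\<not> 2 dvd r"
    using multiplicity_decompose'[of c 2] False by (auto simp: e_def)
  define \<sigma> n where "\<sigma> = sgn r" and "n = \<bar>r\<bar>"
  have "r \<noteq> 0" using r by auto
  then have n: "odd n" "n > 0" "\<sigma> \<in> {1, -1}" "c = \<sigma> * 2 ^ e * n"
    using r by (auto simp: \<sigma>_def n_def sgn_if)
  have e: "e \<ge> 2" unfolding e_def using assms False by (intro multiplicity_geI) auto
  have d: "odd (d + c)" using assms by auto
  have m4: "(d + c) mod 4 = d mod 4" using assms(2) by auto
  \<comment> \<open>The exponent 2 kills a character of order two; any larger exponent makes 8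
    divide \<open>c\<close>, so the class of \<open>d\<close> modulo 8 is kept.\<close>
  have chi: "chi8 (d + c) ^ e = chi8 d ^ e"
  proof (cases "e = 2")
    case True
    then show ?thesis by (simp add: chi8_def)
  next
    case False
    then have "2 ^ 3 dvd (2::int) ^ e" using e by (intro le_imp_power_dvd) auto
    then have "8 dvd c" using r by (auto intro: dvd_mult2)
    then have "(d + c) mod 8 = d mod 8" by auto
    then show ?thesis by (simp add: chi8_def)
  qed
  have "jacobi (d + c) n = jacobi d n"
    by (rule jacobi_cong) (simp add: cong_iff_dvd_diff n)
  then show ?thesis
    unfolding kronecker_reciprocal[OF assms(1) n] kronecker_reciprocal[OF d n]
    using chi m4 by (simp add: recip_sign_def)
qed simp

text \<open>The Jacobi part is periodic modulo \<open>d\<close>, so only the sign for two negative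
  arguments can change. The exceptional case is the one in which \<open>csqrt_mult_upper\<close>
  produces a sign.\<close>

lemma kronecker_add_mult:
  assumes "odd d"
  shows "kronecker (c + 4 * d) d =
           (if c \<ge> 0 \<and> d < 0 \<and> c + 4 * d < 0 then -1 else 1) * kronecker c d"
proof -
  have "jacobi (c + 4 * d) \<bar>d\<bar> = jacobi c \<bar>d\<bar>"
    by (rule jacobi_cong) (simp add: cong_iff_dvd_diff)
  then show ?thesis using kronecker_odd[OF assms] by auto
qed

section \<open>The theta multiplier on the group of level 4\<close>

text \<open>The reciprocal of Shimura's factor theta(\<gamma> \<tau>) / theta(\<tau>). Its
  \<open>m\<close>-th power is the multiplier of weight m/2.\<close>

definition theta_factor :: "int \<Rightarrow> int \<Rightarrow> complex \<Rightarrow> complex" where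
  "theta_factor c d \<tau> = of_int (kronecker c d) * eps d / csqrt (of_int c * \<tau> + of_int d)"

definition theta_invariant :: "nat \<Rightarrow> (complex \<Rightarrow> complex) \<Rightarrow> int \<Rightarrow> int \<Rightarrow> int \<Rightarrow> int \<Rightarrow> bool" where
  "theta_invariant m f a b c d \<longleftrightarrow> (\<forall>\<tau>. Im \<tau> > 0 \<longrightarrow> theta_factor c d \<tau> ^ m *
     f ((of_int a * \<tau> + of_int b) / (of_int c * \<tau> + of_int d)) = f \<tau>)"

section \<open>Branches of the principal square root\<close>

lemma Re_Im_csqrt: "2 * Re (csqrt z) * Im (csqrt z) = Im z"
proof -
  have "Im ((csqrt z)\<^sup>2) = 2 * Re (csqrt z) * Im (csqrt z)" by (simp only: Im_power2)
  then show ?thesis by simp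
qed

lemma csqrt_pos_Im:
  assumes "Im z > 0"
  shows "Re (csqrt z) > 0 \<and> Im (csqrt z) > 0"
proof -
  have "0 < Re (csqrt z) * Im (csqrt z)" using Re_Im_csqrt[of z] assms by linarith
  then show ?thesis using Re_csqrt[of z] by (metis not_less zero_less_mult_iff)
qed

lemma csqrt_neg_Im:
  assumes "Im z < 0"
  shows "Re (csqrt z) > 0 \<and> Im (csqrt z) < 0"
proof -
  have "Re (csqrt z) * Im (csqrt z) < 0" using Re_Im_csqrt[of z] assms by linarith
  then show ?thesis using Re_csqrt[of z] by (metis not_less mult_less_0_iff)
qed

text \<open>The product of the two roots squares to \<open>w\<close>, so it is the principal root up
  to a sign, which is read off from quadrants. For \<open>c < 0\<close> the two arguments have
  opposite signs and the product stays in the right half-plane. For \<open>c \<ge> 0\<close> the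
  product has positive imaginary part, and the sign of Im w, that is of \<open>c + 4 * d\<close>,
  tells whether its real part is negative.\<close>

lemma csqrt_mult_upper:
  fixes c d :: int
  assumes "Im t > 0" "Im s > 0" "(of_int c * s + of_int d) * t = w" "Im w = of_int (c + 4 * d) * v"
    "v > 0" "c \<noteq> 0 \<or> d \<noteq> 0"
  shows "csqrt w = (if c \<ge> 0 \<and> d < 0 \<and> c + 4 * d < 0 then -1 else 1) *
           (csqrt (of_int c * s + of_int d) * csqrt t)"
proof -
  define p q where "p = csqrt (of_int c * s + of_int d)" and "q = csqrt t"
  have sq: "(p * q)\<^sup>2 = w" using assms(3) by (simp add: p_def q_def power_mult_distrib del: csqrt.simps)
  have q: "Re q > 0" "Im q > 0" unfolding q_def using csqrt_pos_Im assms(1) by auto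
  have ImX: "Im (of_int c * s + of_int d) = of_int c * Im s" by simp
  have Imsq: "2 * Re (p * q) * Im (p * q) = of_int (c + 4 * d) * v"
    using assms(4) sq by (metis Im_power2)
  consider (A) "c \<ge> 0" "c + 4 * d \<ge> 0" | (B) "c < 0" | (C) "c \<ge> 0" "d < 0" "c + 4 * d < 0"
    by linarith
  then show ?thesis
  proof cases
    case A
    have p: "Re p > 0" "Im p \<ge> 0"
    proof -
      have "Re p > 0 \<and> Im p \<ge> 0"
      proof (cases "c = 0")
        case True
        then have "d > 0" using A assms(6) by auto
        then have "p = of_real (sqrt (of_int d))" using True unfolding p_def
          by (subst of_real_sqrt) auto
        then show ?thesis using \<open>d > 0\<close> by simp
      next
        case False
        then have "Im (of_int c * s + of_int d) > 0" using A assms(2) ImX by simp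
        then show ?thesis unfolding p_def using csqrt_pos_Im by (meson less_imp_le)
      qed
      then show "Re p > 0" "Im p \<ge> 0" by auto
    qed
    have im: "Im (p * q) > 0" using p q by (simp add: add_pos_nonneg)
    have "Re (p * q) * Im (p * q) \<ge> 0" using Imsq A assms(5)
      by (metis mult.assoc mult_nonneg_nonneg of_int_0_le_iff order_less_imp_le zero_le_mult_iff
          zero_less_numeral linorder_not_le)
    then have "Re (p * q) \<ge> 0" using im by (simp add: zero_le_mult_iff del: times_complex.sel)
    then have "csqrt w = p * q" using im by (intro csqrt_unique sq) linarith
    then show ?thesis using A by (simp add: p_def q_def del: csqrt.simps)
  next
    case B
    then have "Im (of_int c * s + of_int d) < 0" using assms(2) ImX by (simp add: mult_neg_pos)
    then have p: "Re p > 0" "Im p < 0" unfolding p_def using csqrt_neg_Im by blast+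
    have "Re (p * q) = Re p * Re q + (- Im p) * Im q" by simp
    also have "\<dots> > 0" using p q by (intro add_pos_pos mult_pos_pos) auto
    finally have "csqrt w = p * q" by (intro csqrt_unique sq) linarith
    then show ?thesis using B by (simp add: p_def q_def del: csqrt.simps)
  next
    case C
    have p: "Im p > 0" "Re p \<ge> 0"
    proof -
      have "Im p > 0"
      proof (cases "c = 0")
        case True
        have "p = csqrt (of_int d)" using True by (simp add: p_def del: csqrt.simps)
        also have "\<dots> = \<i> * sqrt \<bar>Re (of_int d)\<bar>" using C by (intro csqrt_of_real_nonpos) auto
        finally show ?thesis using C by simp
      next
        case False
        then have "Im (of_int c * s + of_int d) > 0" using C assms(2) ImX by simp
        then show ?thesis unfolding p_def using csqrt_pos_Im by blast
      qed
      then show "Im p > 0" .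
      show "Re p \<ge> 0" unfolding p_def by (rule Re_csqrt)
    qed
    have im: "Im (p * q) > 0" using p q by (simp add: add_nonneg_pos)
    have "of_int (c + 4 * d) * v < 0" using C assms(5) by (intro mult_neg_pos) auto
    then have "\<not> 0 \<le> 2 * Re (p * q) * Im (p * q)" unfolding Imsq by linarith
    then have "Re (p * q) < 0"
      using im by (metis mult_nonneg_nonneg linorder_not_le order_less_imp_le zero_le_numeral)
    moreover have "(- (p * q))\<^sup>2 = w" using sq by simp
    ultimately have "csqrt w = - (p * q)" by (intro csqrt_unique) auto
    then show ?thesis using C by (simp add: p_def q_def del: csqrt.simps)
  qed
qed

lemma Im_div_4:
  assumes "Im \<tau> > 0"
  shows "Im (\<tau> / (of_int n * \<tau> + 1)) > 0"
proof -
  have "Im (\<tau> / (of_int n * \<tau> + 1)) = Im \<tau> / (cmod (of_int n * \<tau> + 1))\<^sup>2"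
    by (simp add: Im_divide cmod_power2 algebra_simps)
  moreover have "of_int n * \<tau> + 1 \<noteq> 0"
    using assms by (auto simp: complex_eq_iff)
  ultimately show ?thesis using assms by (simp add: zero_less_divide_iff)
qed

lemma denom_nonzero:
  assumes "Im \<tau> > 0" "c \<noteq> 0 \<or> d \<noteq> 0"
  shows "of_int c * \<tau> + of_int d \<noteq> 0"
  using assms by (auto simp: complex_eq_iff)

lemma theta_factor_translate:
  assumes "odd d" "4 dvd c"
  shows "theta_factor c (d + c) \<tau> = theta_factor c d (\<tau> + 1)"
proof -
  have "eps (d + c) = eps d" using assms(2) unfolding eps_def by auto
  moreover have "of_int c * \<tau> + of_int (d + c) = of_int c * (\<tau> + 1) + (of_int d :: complex)"
    by (simp add: algebra_simps)
  ultimately show ?thesis unfolding theta_factor_def kronecker_add_left[OF assms] by metis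
qed

text \<open>Cocycle relation for right multiplication by (1 0; 4 1). The signs from
  \<open>kronecker_add_mult\<close> and \<open>csqrt_mult_upper\<close> occur in the same case and
  cancel.\<close>

lemma theta_factor_shear:
  assumes "odd d" "Im \<tau> > 0"
  shows "theta_factor (c + 4 * d) d \<tau> =
           theta_factor c d (\<tau> / (4 * \<tau> + 1)) / csqrt (4 * \<tau> + 1)"
proof -
  define s where "s = \<tau> / (4 * \<tau> + 1)"
  have s: "Im s > 0" using Im_div_4[of \<tau> 4] assms by (simp add: s_def)
  have t: "4 * \<tau> + 1 \<noteq> 0" using denom_nonzero[of \<tau> 4 1] assms by simp
  have w: "(of_int c * s + of_int d) * (4 * \<tau> + 1) = of_int (c + 4 * d) * \<tau> + of_int d"
    using t by (simp add: s_def field_simps)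
  have "d \<noteq> 0" using assms by auto
  have "csqrt (of_int (c + 4 * d) * \<tau> + of_int d) =
      (if c \<ge> 0 \<and> d < 0 \<and> c + 4 * d < 0 then -1 else 1) *
      (csqrt (of_int c * s + of_int d) * csqrt (4 * \<tau> + 1))"
    using assms \<open>d \<noteq> 0\<close> s
    by (intro csqrt_mult_upper[OF _ _ w, where v = "Im \<tau>"]) auto
  then show ?thesis
    unfolding theta_factor_def kronecker_add_mult[OF assms(1)] s_def[symmetric]
    by (simp del: csqrt.simps)
qed

context
  fixes m :: nat and f :: "complex \<Rightarrow> complex"
  assumes f_translate: "\<And>\<tau>. Im \<tau> > 0 \<Longrightarrow> f (\<tau> + 1) = f \<tau>"
    and f_shear: "\<And>\<tau>. Im \<tau> > 0 \<Longrightarrow> f (\<tau> / (4 * \<tau> + 1)) = csqrt (4 * \<tau> + 1) ^ m * f \<tau>"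
begin

text \<open>Right multiplication by (1 1; 0 1) amounts to evaluating the old equation at \<tau> + 1.
  An equivalence is stated because the descent uses both this matrix and its inverse.\<close>

lemma theta_invariant_translate:
  assumes "odd d" "4 dvd c"
  shows "theta_invariant m f a (b + a) c (d + c) \<longleftrightarrow> theta_invariant m f a b c d"
proof -
  let ?E = "\<lambda>b d \<tau>. theta_factor c d \<tau> ^ m *
     f ((of_int a * \<tau> + of_int b) / (of_int c * \<tau> + of_int d)) = f \<tau>"
  have *: "?E (b + a) (d + c) \<tau> \<longleftrightarrow> ?E b d (\<tau> + 1)" if "Im \<tau> > 0" for \<tau>
    using f_translate[OF that] theta_factor_translate[OF assms, of \<tau>]
    by (simp add: algebra_simps)
  show ?thesis unfolding theta_invariant_def
  proof safe
    fix \<tau> :: complex assume H: "\<forall>\<tau>. 0 < Im \<tau> \<longrightarrow> ?E (b + a) (d + c) \<tau>" "Im \<tau> > 0"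
    then have "?E (b + a) (d + c) (\<tau> - 1)" by simp
    then show "?E b d \<tau>" using *[of "\<tau> - 1"] H(2) by simp
  next
    fix \<tau> :: complex assume H: "\<forall>\<tau>. 0 < Im \<tau> \<longrightarrow> ?E b d \<tau>" "Im \<tau> > 0"
    then show "?E (b + a) (d + c) \<tau>" using *[of \<tau>] by simp
  qed
qed

text \<open>Right multiplication by (1 0; 4 1): the old equation at \<tau> / (4 \<tau> + 1), where
  the factor left over by \<open>theta_factor_shear\<close> is the one in \<open>f_shear\<close>.
  The inverse point \<tau> / (1 - 4 \<tau>) gives the other direction.\<close>

lemma theta_invariant_shear:
  assumes "odd d"
  shows "theta_invariant m f (a + 4 * b) b (c + 4 * d) d \<longleftrightarrow> theta_invariant m f a b c d"
proof -
  let ?E = "\<lambda>a c \<tau>. theta_factor c d \<tau> ^ m *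
     f ((of_int a * \<tau> + of_int b) / (of_int c * \<tau> + of_int d)) = f \<tau>"
  have *: "?E (a + 4 * b) (c + 4 * d) \<tau> \<longleftrightarrow> ?E a c (\<tau> / (4 * \<tau> + 1))" if \<tau>: "Im \<tau> > 0" for \<tau>
  proof -
    define s where "s = \<tau> / (4 * \<tau> + 1)"
    have t: "4 * \<tau> + 1 \<noteq> 0" using denom_nonzero[of \<tau> 4 1] \<tau> by simp
    have "(of_int a * s + of_int b) * (4 * \<tau> + 1) = of_int (a + 4 * b) * \<tau> + of_int b"
      "(of_int c * s + of_int d) * (4 * \<tau> + 1) = of_int (c + 4 * d) * \<tau> + of_int d"
      using t by (simp_all add: s_def field_simps)
    then have "(of_int (a + 4 * b) * \<tau> + of_int b) / (of_int (c + 4 * d) * \<tau> + of_int d)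
        = (of_int a * s + of_int b) / (of_int c * s + of_int d)"
      using t by (metis mult_divide_mult_cancel_right)
    moreover have "csqrt (4 * \<tau> + 1) \<noteq> 0" using t by simp
    ultimately show ?thesis
      unfolding s_def[symmetric] theta_factor_shear[OF assms \<tau>]
      using f_shear[OF \<tau>, folded s_def] by (simp add: power_divide field_simps del: csqrt.simps)
  qed
  show ?thesis unfolding theta_invariant_def
  proof safe
    fix \<tau> :: complex assume H: "\<forall>\<tau>. 0 < Im \<tau> \<longrightarrow> ?E (a + 4 * b) (c + 4 * d) \<tau>" "Im \<tau> > 0"
    define s where "s = \<tau> / (1 - 4 * \<tau>)"
    have s: "Im s > 0" using Im_div_4[of \<tau> "-4"] H(2) by (simp add: s_def)
    have "1 - 4 * \<tau> \<noteq> 0" using H(2) by (auto simp: complex_eq_iff)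
    then have "s / (4 * s + 1) = \<tau>" by (simp add: s_def field_simps)
    then show "?E a c \<tau>" using *[OF s] H(1) s by simp
  next
    fix \<tau> :: complex assume H: "\<forall>\<tau>. 0 < Im \<tau> \<longrightarrow> ?E a c \<tau>" "Im \<tau> > 0"
    have "Im (\<tau> / (4 * \<tau> + 1)) > 0" using Im_div_4[of \<tau> 4] H(2) by simp
    then have "?E a c (\<tau> / (4 * \<tau> + 1))" using H(1) by blast
    then show "?E (a + 4 * b) (c + 4 * d) \<tau>" using *[OF H(2)] by blast
  qed
qed

lemma f_translate_nat: "Im \<tau> > 0 \<Longrightarrow> f (\<tau> + of_nat n) = f \<tau>"
proof (induction n)
  case (Suc n)
  then show ?case using f_translate[of "\<tau> + of_nat n"] by (simp add: algebra_simps)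
qed simp

lemma f_translate_int:
  assumes "Im \<tau> > 0"
  shows "f (\<tau> + of_int n) = f \<tau>"
proof (cases "n \<ge> 0")
  case True
  then show ?thesis using f_translate_nat[of \<tau> "nat n"] assms by simp
next
  case False
  then show ?thesis using f_translate_nat[of "\<tau> + of_int n" "nat (- n)"] assms by simp
qed

text \<open>Euclid's algorithm on the lower row \<open>(c, d)\<close>.  A step with quotient \<open>\<plusminus>1\<close> always decreases
  \<open>\<bar>c\<bar> + \<bar>d\<bar>\<close>, as \<open>\<bar>c\<bar> \<noteq> 2 * \<bar>d\<bar>\<close> for \<open>4 dvd c\<close> and odd \<open>d\<close>.\<close>

lemma theta_invariant_Gamma0:
  "a * d - b * c = 1 \<Longrightarrow> 4 dvd c \<Longrightarrow> theta_invariant m f a b c d"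
proof (induction "nat (\<bar>c\<bar> + \<bar>d\<bar>)" arbitrary: a b c d rule: less_induct)
  case less
  have d: "odd d"
  proof
    assume "even d"
    then have "even (a * d - b * c)" using less.prems(2) by auto
    then show False using less.prems(1) by simp
  qed
  then have "d \<noteq> 0" by auto
  show ?case
  proof (cases "c = 0")
    case True
    then have "a * d = 1" using less.prems by simp
    then have "a = 1 \<and> d = 1 \<or> a = -1 \<and> d = -1" using zmult_eq_1_iff by blast
    then show ?thesis
    proof
      assume "a = 1 \<and> d = 1"
      then show ?thesis using True f_translate_int
        by (simp add: theta_invariant_def theta_factor_def kronecker_def eps_def)
    next
      \<comment> \<open>Minus the identity acts trivially up to a translation: (0 / -1) = 1, and
        \<open>eps (-1)\<close> = i cancels the principal root of -1.\<close>
      assume "a = -1 \<and> d = -1"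
      moreover have "csqrt (-1) = \<i>" by simp
      moreover have "kronecker 0 (-1) = 1" using kronecker_odd[of "-1" 0] by simp
      moreover have "eps (-1) = \<i>" by (simp add: eps_def)
      moreover have "- \<tau> + of_int b = - (\<tau> + of_int (- b))" for \<tau> :: complex by simp
      ultimately show ?thesis using True f_translate_int[of _ "- b"]
        by (simp add: theta_invariant_def theta_factor_def del: csqrt.simps)
    qed
  next
    case False
    have ne: "\<bar>c\<bar> \<noteq> 2 * \<bar>d\<bar>"
    proof
      assume "\<bar>c\<bar> = 2 * \<bar>d\<bar>"
      then have "4 dvd 2 * d" using less.prems(2) by (metis abs_dvd_iff dvd_abs_iff abs_mult abs_numeral)
      then have "2 * 2 dvd 2 * d" by simp
      then have "2 dvd d" by (simp only: dvd_mult_cancel_left) simp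
      then show False using d by simp
    qed
    consider "\<bar>c - 4 * d\<bar> < \<bar>c\<bar>" | "\<bar>c + 4 * d\<bar> < \<bar>c\<bar>" | "\<bar>d - c\<bar> < \<bar>d\<bar>" | "\<bar>d + c\<bar> < \<bar>d\<bar>"
      using False \<open>d \<noteq> 0\<close> ne by linarith
    then show ?thesis
    proof cases
      case 1
      then have "theta_invariant m f (a - 4 * b) b (c - 4 * d) d"
        using less.prems by (intro less.hyps) (auto simp: algebra_simps)
      then show ?thesis using theta_invariant_shear[OF d, of "a - 4 * b" b "c - 4 * d"] by simp
    next
      case 2
      then have "theta_invariant m f (a + 4 * b) b (c + 4 * d) d"
        using less.prems by (intro less.hyps) (auto simp: algebra_simps)
      then show ?thesis using theta_invariant_shear[OF d, of a b c] by simp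
    next
      case 3
      then have "theta_invariant m f a (b - a) c (d - c)"
        using less.prems by (intro less.hyps) (auto simp: algebra_simps)
      then show ?thesis
        using theta_invariant_translate[of "d - c" c a "b - a"] d less.prems(2) by auto
    next
      case 4
      then have "theta_invariant m f a (b + a) c (d + c)"
        using less.prems by (intro less.hyps) (auto simp: algebra_simps)
      then show ?thesis
        using theta_invariant_translate[of d c a b] d less.prems(2) by auto
    qed
  qed
qed

end

section \<open>The slash operator in terms of the theta multiplier\<close>

lemma powr_half_odd:
  assumes "w \<noteq> 0"
  shows "w powr of_real (- (real m / 2)) = 1 / csqrt w ^ m"
proof -
  have "w powr of_real (- (real m / 2)) = exp (- (of_nat m * (Ln w / 2)))"
    using assms by (simp add: powr_def algebra_simps)
  also have "\<dots> = 1 / csqrt w ^ m"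
    unfolding csqrt_exp_Ln[OF assms] exp_of_nat_mult[symmetric] by (simp add: exp_minus inverse_eq_divide)
  finally show ?thesis .
qed

lemma kronecker_cases:
  assumes "odd d"
  shows "kronecker c d \<in> {-1, 0, 1}"
proof -
  have "(\<Prod>p\<in>#M. Legendre c p) \<in> {-1, 0, 1}" for M
    by (induction M) (use Legendre_cases in \<open>fastforce+\<close>)
  then show ?thesis using kronecker_odd[OF assms, of c] unfolding jacobi_def by auto
qed

lemma slash_eq_theta_factor:
  assumes "\<gamma> \<in> Gamma0 4" "Im \<tau> > 0" "odd m"
  shows "slash (real m / 2) \<gamma> f \<tau> = theta_factor (\<gamma> $ 2 $ 1) (\<gamma> $ 2 $ 2) \<tau> ^ m * f (moebius \<gamma> \<tau>)"
proof -
  define a b c d where "a = \<gamma> $ 1 $ 1" "b = \<gamma> $ 1 $ 2" "c = \<gamma> $ 2 $ 1" "d = \<gamma> $ 2 $ 2"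
  have det: "a * d - b * c = 1" and "4 dvd c"
    using assms(1) by (simp_all add: Gamma0_def det_2 a_b_c_d_def)
  have d: "odd d"
  proof
    assume "even d"
    then have "even (a * d - b * c)" using \<open>4 dvd c\<close> by auto
    then show False using det by simp
  qed
  then have "d \<noteq> 0" by auto
  have "of_int c * \<tau> + of_int d \<noteq> 0" using denom_nonzero assms(2) \<open>d \<noteq> 0\<close> by blast
  note P = powr_half_odd[OF this, of m]
  have "eps d \<noteq> 0" by (simp add: eps_def)
  then have e: "eps d powr of_real (2 * (real m / 2)) = eps d ^ m"
    using powr_nat'[of "eps d" m] by simp
  \<comment> \<open>An odd power fixes each of -1, 0, 1, so the symbol can be absorbed into the
    \<open>m\<close>-th power.\<close>
  have k: "of_int (kronecker c d) = (of_int (kronecker c d) :: complex) ^ m"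
    using kronecker_cases[OF d, of c] assms(3) odd_pos[OF assms(3)] by (auto simp: minus_one_power_iff)
  show ?thesis
    unfolding slash_def theta_factor_def a_b_c_d_def(3,4)[symmetric] e P
    by (subst k) (simp add: power_mult_distrib power_divide)
qed

lemma slash_invariant_Gamma0_4:
  assumes "\<And>\<tau>. Im \<tau> > 0 \<Longrightarrow> f (\<tau> + 1) = f \<tau>"
    and "\<And>\<tau>. Im \<tau> > 0 \<Longrightarrow> f (\<tau> / (4 * \<tau> + 1)) = csqrt (4 * \<tau> + 1) ^ m * f \<tau>"
    and "odd m" "\<gamma> \<in> Gamma0 4" "Im \<tau> > 0"
  shows "slash (real m / 2) \<gamma> f \<tau> = f \<tau>"
proof -
  have "theta_invariant m f (\<gamma> $ 1 $ 1) (\<gamma> $ 1 $ 2) (\<gamma> $ 2 $ 1) (\<gamma> $ 2 $ 2)"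
    by (rule theta_invariant_Gamma0) (use assms in \<open>auto simp: Gamma0_def det_2\<close>)
  then show ?thesis
    using slash_eq_theta_factor[OF assms(4,5,3), of f] assms(5)
    by (simp add: theta_invariant_def moebius_def)
qed

section \<open>A weight on three-dimensional space\<close>

type_synonym vec3 = "real \<times> real \<times> real"

text \<open>The exponent \<open>4/3\<close> makes the product weight \<open>wt3\<close> summable and a majorant of the inverse fourth
  power.\<close>

definition wt :: "real \<Rightarrow> real" where
  "wt t = (1 + \<bar>t\<bar>) powr (- (4 / 3))"

definition wt3 :: "vec3 \<Rightarrow> real" where
  "wt3 = (\<lambda>(a, b, c). wt a * (wt b * wt c))"

definition lat :: "int \<times> int \<times> int \<Rightarrow> vec3" where
  "lat = (\<lambda>(a, b, c). (of_int a, of_int b, of_int c))"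

lemma wt_pos: "wt t > 0"
  by (simp add: wt_def add_pos_nonneg)

lemma wt3_pos: "wt3 Q > 0"
  by (cases Q) (simp add: wt3_def wt_pos)

lemma wt_measurable [measurable]: "wt \<in> borel_measurable borel"
  unfolding wt_def by measurable

lemma wt3_measurable [measurable]: "wt3 \<in> borel_measurable borel"
  unfolding wt3_def by (simp add: borel_prod[symmetric])

lemma integrable_wt: "integrable lborel wt"
proof -
  have "(\<lambda>x::real. x powr (- (4 / 3))) integrable_on {1..}"
    using has_integral_powr_to_inf[of "- (4/3)" 1] by (auto simp: has_integral_iff)
  then have "set_integrable lebesgue {1..} (\<lambda>x::real. x powr (- (4 / 3)))"
    by (intro nonnegative_absolutely_integrable_1) auto
  then have "set_integrable lborel {1..} (\<lambda>x::real. x powr (- (4 / 3)))"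
    unfolding set_integrable_def by (subst (asm) integrable_completion) auto
  then have I: "integrable lborel (\<lambda>x::real. indicator {1..} x * x powr (- (4 / 3)))"
    by (simp add: set_integrable_def)
  \<comment> \<open>The two affine images of the tail live on x >= 0 and x <= 0, and at every x one
    of them equals \<open>wt x\<close>.\<close>
  have "integrable lborel (\<lambda>x::real. indicator {1..} (1 + 1 * x) * (1 + 1 * x) powr (- (4 / 3)) +
      indicator {1..} (1 + (- 1) * x) * (1 + (-1) * x) powr (- (4 / 3)))"
    using lborel_integrable_real_affine[OF I, of 1 1] lborel_integrable_real_affine[OF I, of "-1" 1]
    by simp
  then show ?thesis
  proof (rule Bochner_Integration.integrable_bound)
    show "AE x in lborel. norm (wt x) \<le> norm (indicator {1..} (1 + 1 * x) * (1 + 1 * x) powr (- (4 / 3)) +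
      indicator {1..} (1 + (- 1) * x) * (1 + (-1) * x) powr (- (4 / 3)))"
      by (intro AE_I2) (auto simp: wt_def indicator_def abs_if)
  qed auto
qed

lemma integrable_lborel_times:
  fixes f :: "'a::euclidean_space \<Rightarrow> real" and g :: "'b::euclidean_space \<Rightarrow> real"
  assumes "integrable lborel f" "integrable lborel g"
  shows "integrable lborel (\<lambda>(x, y). f x * g y)"
  unfolding lborel_prod[symmetric]
proof (rule lborel_pair.Fubini_integrable)
  have [measurable]: "f \<in> borel_measurable lborel" "g \<in> borel_measurable lborel" using assms by auto
  show "(\<lambda>(x, y). f x * g y) \<in> borel_measurable (lborel \<Otimes>\<^sub>M lborel)" by measurable
  show "integrable lborel (\<lambda>x. \<integral>y. norm (case (x, y) of (x, y) \<Rightarrow> f x * g y) \<partial>lborel)"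
    using assms by (simp add: abs_mult integrable_abs)
  show "AE x in lborel. integrable lborel (\<lambda>y. case (x, y) of (x, y) \<Rightarrow> f x * g y)"
    using assms by simp
qed

lemma integrable_wt3: "integrable lborel wt3"
  unfolding wt3_def using integrable_lborel_times[OF integrable_wt integrable_lborel_times[OF integrable_wt integrable_wt]]
  by (simp add: case_prod_unfold)

lemma wt_summable_nat: "summable (\<lambda>n. wt (real n))"
proof -
  have "summable (\<lambda>n. real (n + 1) powr (- (4 / 3)))"
    using summable_real_powr_iff[of "- (4/3)"] summable_ignore_initial_segment[of _ 1] by force
  then show ?thesis by (simp add: wt_def add.commute)
qed

lemma wt_summable_int: "(\<lambda>n::int. wt (of_int n)) summable_on UNIV"
proof -
  have nat: "(\<lambda>n. wt (real n)) summable_on UNIV"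
    using wt_summable_nat wt_pos by (intro summable_nonneg_imp_summable_on) (auto intro: less_imp_le)
  have 1: "(\<lambda>n::int. wt (of_int n)) summable_on (range int)"
    using nat by (subst summable_on_reindex) (auto simp: o_def)
  have 2: "(\<lambda>n::int. wt (of_int n)) summable_on (range (\<lambda>n. - int n))"
    using nat by (subst summable_on_reindex) (auto simp: o_def inj_on_def wt_def)
  have "(UNIV :: int set) = range int \<union> range (\<lambda>n. - int n)"
    by (auto, metis int_cases2 range_eqI)
  then show ?thesis using summable_on_union[OF 1 2] by simp
qed

lemma summable_on_times:
  fixes f :: "'a \<Rightarrow> real" and g :: "'b \<Rightarrow> real"
  assumes "f summable_on UNIV" "g summable_on UNIV" "\<And>x. f x \<ge> 0" "\<And>y. g y \<ge> 0"
  shows "(\<lambda>(x, y). f x * g y) summable_on UNIV"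
proof -
  have "(\<lambda>(x, y). f x * g y) summable_on UNIV \<times> UNIV"
  proof (rule summable_on_SigmaI[where g = "\<lambda>x. f x * infsum g UNIV"])
    show "((\<lambda>y. case (x, y) of (x, y) \<Rightarrow> f x * g y) has_sum f x * infsum g UNIV) UNIV" for x
      using assms(2) by (auto intro!: has_sum_cmult_right has_sum_infsum)
    show "(\<lambda>x. f x * infsum g UNIV) summable_on UNIV"
      using assms(1) by (rule summable_on_cmult_left)
  qed (use assms in auto)
  then show ?thesis by simp
qed

lemma wt3_summable: "(\<lambda>n. wt3 (lat n)) summable_on UNIV"
proof -
  have "(\<lambda>(a, bc). wt (of_int a) * (case bc of (b, c) \<Rightarrow> wt (of_int b) * wt (of_int c)))
     summable_on (UNIV :: (int \<times> int \<times> int) set)"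
    by (intro summable_on_times wt_summable_int) (auto simp: wt_pos less_imp_le)
  then show ?thesis by (simp add: wt3_def lat_def case_prod_unfold)
qed

text \<open>Such a shift at most halves 1 + |s|, which costs 2 powr (4/3) <= 4. Three coordinates
  give the 64 of \<open>wt3_shift\<close>.\<close>

lemma wt_shift:
  assumes "\<bar>t\<bar> \<le> 1 / 2"
  shows "wt (t + s) \<le> 4 * wt s"
proof -
  have "(1 + \<bar>s\<bar>) / 2 \<le> 1 + \<bar>t + s\<bar>" using assms by (auto simp: abs_if split: if_splits)
  then have "wt (t + s) \<le> ((1 + \<bar>s\<bar>) / 2) powr (- (4 / 3))"
    unfolding wt_def by (intro powr_mono2') auto
  also have "\<dots> = wt s * 2 powr (4 / 3)"
    by (simp add: wt_def powr_divide powr_minus field_simps)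
  also have "(2::real) powr (4 / 3) \<le> 2 powr 2" by (intro powr_mono) auto
  finally show ?thesis using wt_pos[of s] by (simp add: mult.commute)
qed

lemma wt3_shift:
  assumes "\<bar>fst u\<bar> \<le> 1 / 2" "\<bar>fst (snd u)\<bar> \<le> 1 / 2" "\<bar>snd (snd u)\<bar> \<le> 1 / 2"
  shows "wt3 (u + s) \<le> 64 * wt3 s"
proof -
  obtain x y z a b c where *: "u = (x, y, z)" "s = (a, b, c)" by (metis prod_cases3)
  have "wt (x + a) \<le> 4 * wt a" "wt (y + b) \<le> 4 * wt b" "wt (z + c) \<le> 4 * wt c"
    using assms by (auto simp: * intro: wt_shift)
  then have "wt (x + a) * (wt (y + b) * wt (z + c)) \<le> (4 * wt a) * ((4 * wt b) * (4 * wt c))"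
    by (intro mult_mono) (auto simp: less_imp_le wt_pos)
  then show ?thesis by (simp add: wt3_def *)
qed

text \<open>Each of the three factors is at least \<open>S powr (- (4 / 3))\<close>, and the
  exponents add up to -4.\<close>

lemma power4_le_wt3: "1 / (1 + \<bar>a\<bar> + \<bar>b\<bar> + \<bar>c\<bar>) ^ 4 \<le> wt3 (a, b, c)"
proof -
  define S where "S = 1 + \<bar>a\<bar> + \<bar>b\<bar> + \<bar>c\<bar>"
  have S: "S > 0" by (simp add: S_def add_pos_nonneg)
  have *: "wt t \<ge> S powr (- (4 / 3))" if "\<bar>t\<bar> \<le> S - 1" for t
    unfolding wt_def using that by (intro powr_mono2') auto
  have "S powr (- (4 / 3)) * (S powr (- (4 / 3)) * S powr (- (4 / 3))) \<le> wt a * (wt b * wt c)"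
    by (intro mult_mono *) (auto simp: S_def less_imp_le wt_pos)
  also have "S powr (- (4 / 3)) * (S powr (- (4 / 3)) * S powr (- (4 / 3))) = S powr (- 4)"
    by (simp add: powr_add[symmetric])
  also have "\<dots> = 1 / S ^ 4" using S by (simp add: powr_minus powr_numeral inverse_eq_divide)
  finally show ?thesis by (simp add: wt3_def S_def)
qed

lemma lborel_integral_shift:
  fixes f :: "'a::euclidean_space \<Rightarrow> 'b::{banach, second_countable_topology}"
  assumes "f \<in> borel_measurable borel"
  shows "(\<integral>x. f (x + t) \<partial>lborel) = (\<integral>x. f x \<partial>lborel)"
proof -
  have "(\<integral>x. f x \<partial>lborel) = (\<integral>x. f x \<partial>distr lborel borel ((+) t))" by (simp add: lborel_distr_plus)
  also have "\<dots> = (\<integral>x. f (t + x) \<partial>lborel)" using assms by (subst integral_distr) auto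
  finally show ?thesis by (simp add: add.commute)
qed

section \<open>Vanishing of lattice sums\<close>

definition char3 :: "int \<times> int \<times> int \<Rightarrow> vec3 \<Rightarrow> complex" where
  "char3 = (\<lambda>(p, q, r) (a, b, c). cis (2 * pi * (of_int p * a + of_int q * b + of_int r * c)))"

text \<open>This is cos(pi t)^2: 1-periodic, with values in [0, 1], equal to 1 only at integers, and
  a trigonometric polynomial of degree one.\<close>

definition bump :: "real \<Rightarrow> real" where
  "bump t = (1 + cos (2 * pi * t)) / 2"

definition bump3 :: "vec3 \<Rightarrow> real" where
  "bump3 = (\<lambda>(a, b, c). bump a * bump b * bump c)"

lemma bump_bounds: "0 \<le> bump t" "bump t \<le> 1"
proof -
  have *: "-1 \<le> c \<Longrightarrow> 0 \<le> (1 + c) / 2" "c \<le> 1 \<Longrightarrow> (1 + c) / 2 \<le> 1" for c :: real by auto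
  show "0 \<le> bump t" "bump t \<le> 1" unfolding bump_def by (intro * cos_ge_minus_one cos_le_one)+
qed

lemma bump_add_int: "bump (t + of_int n) = bump t"
proof -
  have "cos (2 * pi * t + of_int n * (2 * pi)) = cos (2 * pi * t)"
    by (simp add: cos_add mult.commute[of _ "2 * pi"] cos_int_2pin sin_int_2pin)
  then show ?thesis by (simp add: bump_def algebra_simps)
qed

lemma bump_antimono: "\<bar>s\<bar> \<le> \<bar>t\<bar> \<Longrightarrow> \<bar>t\<bar> \<le> 1 / 2 \<Longrightarrow> bump t \<le> bump s"
proof -
  assume *: "\<bar>s\<bar> \<le> \<bar>t\<bar>" "\<bar>t\<bar> \<le> 1 / 2"
  then have "cos \<bar>2 * pi * t\<bar> \<le> cos \<bar>2 * pi * s\<bar>"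
    by (intro cos_monotone_0_pi_le) (auto simp: abs_mult mult_left_mono)
  then show ?thesis by (simp add: bump_def)
qed

lemma bump3_bounds: "0 \<le> bump3 u" "bump3 u \<le> 1"
  using bump_bounds by (cases u; auto simp: bump3_def intro!: mult_le_one mult_nonneg_nonneg)+

lemma bump3_add_lat: "bump3 (u + lat n) = bump3 u"
  by (cases u; cases n) (simp add: bump3_def lat_def bump_add_int)

lemma bump_measurable [measurable]: "bump \<in> borel_measurable borel"
  unfolding bump_def by measurable

lemma bump3_measurable [measurable]: "bump3 \<in> borel_measurable borel"
  unfolding bump3_def by (simp add: borel_prod[symmetric])

lemma char3_measurable [measurable]: "char3 n \<in> borel_measurable borel"
proof (intro borel_measurable_continuous_onI)
  obtain p q r where n: "n = (p, q, r)" by (metis prod_cases3)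
  show "continuous_on UNIV (char3 n)"
    unfolding n char3_def case_prod_unfold by (intro continuous_intros)
qed

lemma norm_char3 [simp]: "norm (char3 n Q) = 1"
  by (cases n; cases Q) (simp add: char3_def)

lemma bump_cis:
  "complex_of_real (bump t) * cis s =
     cis s / 2 + cis (s + 2 * pi * t) / 4 + cis (s - 2 * pi * t) / 4"
  by (simp add: bump_def complex_eq_iff cos_add cos_diff sin_add sin_diff field_simps)

lemma bump_char3:
  "complex_of_real (bump (fst Q)) * char3 (p, q, r) Q = 
     char3 (p, q, r) Q / 2 + char3 (p + 1, q, r) Q / 4 + char3 (p - 1, q, r) Q / 4"
  "complex_of_real (bump (fst (snd Q))) * char3 (p, q, r) Q =
     char3 (p, q, r) Q / 2 + char3 (p, q + 1, r) Q / 4 + char3 (p, q - 1, r) Q / 4"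
  "complex_of_real (bump (snd (snd Q))) * char3 (p, q, r) Q =
     char3 (p, q, r) Q / 2 + char3 (p, q, r + 1) Q / 4 + char3 (p, q, r - 1) Q / 4"
  by (cases Q; simp add: char3_def bump_cis algebra_simps)+

lemma integrable_mult_bounded:
  fixes f g :: "vec3 \<Rightarrow> complex"
  assumes "integrable lborel f" "g \<in> borel_measurable borel" "\<And>x. norm (g x) \<le> 1"
  shows "integrable lborel (\<lambda>x. f x * g x)"
proof (rule Bochner_Integration.integrable_bound[OF assms(1)])
  show "AE x in lborel. norm (f x * g x) \<le> norm (f x)"
    using assms(3) by (auto simp: norm_mult mult_left_le)
qed (use assms in measurable)

text \<open>Multiplying by \<open>bump\<close> in one coordinate replaces a character by a
  combination of three characters, so the vanishing of all Fourier integrals is inherited.\<close>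

lemma integral_bump_step:
  assumes f: "integrable lborel f" and z: "\<And>n. (\<integral>Q. f Q * char3 n Q \<partial>lborel) = 0"
    and "\<pi> = fst \<or> \<pi> = (\<lambda>Q. fst (snd Q)) \<or> \<pi> = (\<lambda>Q. snd (snd Q))"
  shows "(\<integral>Q. (f Q * of_real (bump (\<pi> Q))) * char3 n Q \<partial>lborel) = 0"
proof -
  have I: "integrable lborel (\<lambda>Q. f Q * char3 n Q)" for n
    using f by (rule integrable_mult_bounded) auto
  obtain p q r where n: "n = (p, q, r)" by (metis prod_cases3)
  have "\<exists>m1 m2. \<forall>Q. complex_of_real (bump (\<pi> Q)) * char3 n Q =
     char3 n Q / 2 + char3 m1 Q / 4 + char3 m2 Q / 4"
    using assms(3)
  proof (elim disjE)
    assume "\<pi> = fst"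
    then show ?thesis unfolding n using bump_char3(1) by blast
  next
    assume "\<pi> = (\<lambda>Q. fst (snd Q))"
    then show ?thesis unfolding n using bump_char3(2) by blast
  next
    assume "\<pi> = (\<lambda>Q. snd (snd Q))"
    then show ?thesis unfolding n using bump_char3(3) by blast
  qed
  then obtain m1 m2 where "\<And>Q. complex_of_real (bump (\<pi> Q)) * char3 n Q =
     char3 n Q / 2 + char3 m1 Q / 4 + char3 m2 Q / 4" by blast
  then have "(f Q * of_real (bump (\<pi> Q))) * char3 n Q
    = f Q * char3 n Q / 2 + f Q * char3 m1 Q / 4 + f Q * char3 m2 Q / 4" for Q
    by (simp add: mult.assoc) (simp add: algebra_simps)
  then show ?thesis using I z by simp
qed

lemma integral_bump3_power:
  assumes f: "integrable lborel f" and z: "\<And>n. (\<integral>Q. f Q * char3 n Q \<partial>lborel) = 0"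
  shows "integrable lborel (\<lambda>Q. f Q * of_real (bump3 Q) ^ N) \<and>
    (\<forall>n. (\<integral>Q. (f Q * of_real (bump3 Q) ^ N) * char3 n Q \<partial>lborel) = 0)"
proof (induction N)
  case 0
  then show ?case using assms by simp
next
  case (Suc N)
  define g where "g = (\<lambda>Q. f Q * complex_of_real (bump3 Q) ^ N)"
  have g: "integrable lborel g" "\<And>n. (\<integral>Q. g Q * char3 n Q \<partial>lborel) = 0" using Suc by (auto simp: g_def)
  have bm: "integrable lborel (\<lambda>Q. h Q * complex_of_real (bump (\<pi> Q)))"
    if "integrable lborel h" "\<pi> \<in> borel_measurable borel" for h and \<pi> :: "vec3 \<Rightarrow> real"
    using that(1) by (rule integrable_mult_bounded) (use that(2) bump_bounds in auto)
  have m: "(\<lambda>Q. fst Q) \<in> borel_measurable (borel :: vec3 measure)"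
    "(\<lambda>Q. fst (snd Q)) \<in> borel_measurable (borel :: vec3 measure)"
    "(\<lambda>Q. snd (snd Q)) \<in> borel_measurable (borel :: vec3 measure)"
    by (simp_all add: borel_prod[symmetric])
  define g1 where "g1 = (\<lambda>Q. g Q * complex_of_real (bump (fst Q)))"
  define g2 where "g2 = (\<lambda>Q. g1 Q * complex_of_real (bump (fst (snd Q))))"
  define g3 where "g3 = (\<lambda>Q. g2 Q * complex_of_real (bump (snd (snd Q))))"
  have 1: "integrable lborel g1" "\<And>n. (\<integral>Q. g1 Q * char3 n Q \<partial>lborel) = 0"
    unfolding g1_def using bm[OF g(1) m(1)] integral_bump_step[OF g] by auto
  have 2: "integrable lborel g2" "\<And>n. (\<integral>Q. g2 Q * char3 n Q \<partial>lborel) = 0"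
    unfolding g2_def using bm[OF 1(1) m(2)] integral_bump_step[OF 1, of "\<lambda>Q. fst (snd Q)"] by auto
  have 3: "integrable lborel g3" "\<And>n. (\<integral>Q. g3 Q * char3 n Q \<partial>lborel) = 0"
    unfolding g3_def using bm[OF 2(1) m(3)] integral_bump_step[OF 2, of "\<lambda>Q. snd (snd Q)"] by auto
  have "g3 = (\<lambda>Q. f Q * of_real (bump3 Q) ^ Suc N)"
    by (auto simp: g3_def g2_def g1_def g_def bump3_def case_prod_unfold)
  then show ?case using 3 by simp
qed

text \<open>Half-open sides make the integral translates disjoint and covering; centring puts the
  origin in the interior.\<close>

definition cube :: "vec3 set" where
  "cube = {-1/2..<1/2} \<times> {-1/2..<1/2} \<times> {-1/2..<1/2}"

lemma cube_measurable [measurable]: "cube \<in> sets borel"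
  unfolding cube_def by (simp add: borel_prod[symmetric])

lemma emeasure_cube_box:
  assumes "0 \<le> \<eta>"
  shows "emeasure lborel ({-\<eta>..<\<eta>} \<times> {-\<eta>..<\<eta>} \<times> {-\<eta>..<\<eta>}) = ennreal ((2 * \<eta>) ^ 3)"
proof -
  have "emeasure (lborel \<Otimes>\<^sub>M (lborel \<Otimes>\<^sub>M lborel)) ({-\<eta>..<\<eta>} \<times> {-\<eta>..<\<eta>} \<times> {-\<eta>..<\<eta>}) =
     emeasure lborel {-\<eta>..<\<eta>} * emeasure (lborel \<Otimes>\<^sub>M lborel) ({-\<eta>..<\<eta>} \<times> {-\<eta>..<\<eta>})"
    unfolding lborel_prod by (subst lborel_prod[symmetric], subst lborel.emeasure_pair_measure_Times) (auto simp: borel_prod[symmetric])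
  also have "emeasure (lborel \<Otimes>\<^sub>M lborel) ({-\<eta>..<\<eta>} \<times> {-\<eta>..<\<eta>}) =
      emeasure lborel {-\<eta>..<\<eta>} * emeasure lborel {-\<eta>..<\<eta>}"
    by (subst lborel.emeasure_pair_measure_Times) auto
  also have "emeasure lborel {-\<eta>..<\<eta>} = ennreal (2 * \<eta>)" using assms by simp
  also have "ennreal (2 * \<eta>) * (ennreal (2 * \<eta>) * ennreal (2 * \<eta>)) = ennreal ((2 * \<eta>) ^ 3)"
    using assms by (simp add: ennreal_mult[symmetric] power3_eq_cube mult.assoc)
  finally show ?thesis by (simp add: lborel_prod)
qed

text \<open>Laplace's method: the powers of \<open>bump3\<close>, which are trigonometric polynomials, concentrate at the
  origin of the cube.\<close>

lemma Laplace_cube: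
  fixes P :: "vec3 \<Rightarrow> complex"
  assumes P[measurable]: "P \<in> borel_measurable borel" and M: "\<And>u. u \<in> cube \<Longrightarrow> norm (P u) \<le> M"
    and cont: "continuous (at 0 within cube) P"
    and z: "\<And>N. (\<integral>u. indicator cube u * (P u * of_real (bump3 u) ^ N) \<partial>lborel) = 0"
  shows "P 0 = 0"
proof (rule ccontr)
  let ?h = "\<lambda>N u. indicator cube u * (P u * complex_of_real (bump3 u) ^ N)"
  assume "P 0 \<noteq> 0"
  define p where "p = P 0"
  define m where "m = (norm p)\<^sup>2 / 2"
  have m: "m > 0" using \<open>P 0 \<noteq> 0\<close> by (simp add: m_def p_def)
  have M0: "norm p \<le> M" unfolding p_def by (rule M) (simp add: cube_def zero_prod_def)
  have "continuous (at 0 within cube) (\<lambda>u. Re (cnj p * P u))"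
    by (intro continuous_Re continuous_mult continuous_const cont)
  moreover have "Re (cnj p * P 0) = (norm p)\<^sup>2"
    unfolding p_def[symmetric] cmod_power2 by (simp add: power2_eq_square)
  ultimately have "\<forall>\<^sub>F u in at 0 within cube. Re (cnj p * P u) > m"
    using m by (intro order_tendstoD(1)[of _ "(norm p)\<^sup>2"]) (auto simp: continuous_within m_def)
  then obtain d0 where d0: "d0 > 0" "\<And>u. u \<in> cube \<Longrightarrow> u \<noteq> 0 \<Longrightarrow> dist u 0 < d0 \<Longrightarrow> Re (cnj p * P u) > m"
    unfolding eventually_at by blast
  have pos0: "Re (cnj p * P u) \<ge> m" if "u \<in> cube" "norm u < d0" for u
    using d0(2)[of u] that \<open>Re (cnj p * P 0) = (norm p)\<^sup>2\<close> by (cases "u = 0") (auto simp: m_def)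
  \<comment> \<open>A point with three coordinates of size at most \<delta> has norm at most 3
    \<delta> < \<open>d0\<close>; the bound by 1/4 keeps \<delta> in the range where
    \<open>bump\<close> decreases.\<close>
  define \<delta> where "\<delta> = min (d0 / 3) (1 / 4) / 2"
  have \<delta>: "\<delta> > 0" "\<delta> < 1/2" "3 * \<delta> < d0" using d0(1) by (auto simp: \<delta>_def)
  have pos: "Re (cnj p * P (x, y, w)) \<ge> m"
    if "(x, y, w) \<in> cube" "\<bar>x\<bar> \<le> \<delta>" "\<bar>y\<bar> \<le> \<delta>" "\<bar>w\<bar> \<le> \<delta>" for x y w
  proof (rule pos0[OF that(1)])
    have "norm (x, y, w) \<le> norm x + (norm y + norm w)"
      using norm_Pair_le[of x "(y, w)"] norm_Pair_le[of y w] by simp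
    then show "norm (x, y, w) < d0" using that \<delta> by simp
  qed
  \<comment> \<open>Outside the \<delta>-box some coordinate factor of \<open>bump3\<close> is at
    most \<rho> and the others are at most 1.\<close>
  define \<rho> where "\<rho> = bump \<delta>"
  have \<rho>: "\<rho> < 1" "\<rho> > 0"
  proof -
    have "cos (2 * pi * \<delta>) < cos 0" using \<delta> by (intro cos_monotone_0_pi) auto
    then show "\<rho> < 1" by (simp add: \<rho>_def bump_def)
    have "cos pi < cos (2 * pi * \<delta>)" using \<delta> by (intro cos_monotone_0_pi) auto
    then show "\<rho> > 0" by (simp add: \<rho>_def bump_def)
  qed
  have "isCont (\<lambda>t. bump t ^ 3) 0" unfolding bump_def by (intro continuous_intros) auto
  then have "((\<lambda>t. bump t ^ 3) \<longlongrightarrow> 1) (at 0)" by (simp add: isCont_def bump_def)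
  then have "\<forall>\<^sub>F t in at 0. bump t ^ 3 > \<rho>" using \<rho> order_tendstoD(1) by blast
  then obtain e0 where e0: "e0 > 0" "\<And>t. t \<noteq> 0 \<Longrightarrow> dist t 0 < e0 \<Longrightarrow> bump t ^ 3 > \<rho>"
    unfolding eventually_at by auto
  \<comment> \<open>A smaller box, on which \<open>bump3\<close> is at least
    \<open>bump \<eta> ^ 3\<close>, strictly above \<rho>.\<close>
  define \<eta> where "\<eta> = min (e0 / 2) \<delta>"
  have \<eta>: "\<eta> > 0" "\<eta> \<le> \<delta>" "bump \<eta> ^ 3 > \<rho>" using e0 \<delta> by (auto simp: \<eta>_def intro!: e0(2))
  define \<sigma> where "\<sigma> = bump \<eta> ^ 3"
  define B :: "vec3 set" where "B = {-\<eta>..<\<eta>} \<times> {-\<eta>..<\<eta>} \<times> {-\<eta>..<\<eta>}"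
  have B[measurable]: "B \<in> sets borel" unfolding B_def by (simp add: borel_prod[symmetric])
  \<comment> \<open>Main term on the small box, error term of size \<rho>^N off the \<delta>-box; on
    the rest of the \<delta>-box the integrand has nonnegative real part and may be dropped.\<close>
  have pt: "m * \<sigma> ^ N * indicator B u - norm p * M * \<rho> ^ N * indicator cube u \<le>
      Re (cnj p * ?h N u)" for N u
  proof -
    obtain x y w where u: "u = (x, y, w)" by (metis prod_cases3)
    have R: "Re (cnj p * ?h N u) =
      indicator cube u * (Re (cnj p * P u) * bump3 u ^ N)"
    proof -
      have "cnj p * ?h N u =
        of_real (indicator cube u * bump3 u ^ N) * (cnj p * P u)"
        by (simp add: indicator_def)
      moreover have "Re (of_real r * v) = r * Re v" for r v by simp
      ultimately show ?thesis by (metis mult.assoc mult.commute)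
    qed
    consider (A) "u \<notin> cube" | (B) "u \<in> B" "u \<in> cube"
      | (C) "u \<in> cube" "u \<notin> B" "\<bar>x\<bar> \<le> \<delta>" "\<bar>y\<bar> \<le> \<delta>" "\<bar>w\<bar> \<le> \<delta>"
      | (D) "u \<in> cube" "u \<notin> B" "\<delta> < \<bar>x\<bar> \<or> \<delta> < \<bar>y\<bar> \<or> \<delta> < \<bar>w\<bar>" by force
    then show ?thesis
    proof cases
      case A
      then have "u \<notin> B" using \<eta> \<delta> by (auto simp: B_def cube_def u)
      then show ?thesis using A by (simp add: R)
    next
      case B
      then have xyw: "\<bar>x\<bar> \<le> \<eta>" "\<bar>y\<bar> \<le> \<eta>" "\<bar>w\<bar> \<le> \<eta>" by (auto simp: B_def u)
      have "bump \<eta> * bump \<eta> * bump \<eta> \<le> bump x * bump y * bump w"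
        using xyw \<eta> \<delta> by (intro mult_mono bump_antimono mult_nonneg_nonneg bump_bounds) auto
      then have "\<sigma> ^ N \<le> bump3 u ^ N" using \<rho> \<eta> by (intro power_mono) (auto simp: \<sigma>_def u bump3_def power3_eq_cube)
      moreover have "m \<le> Re (cnj p * P u)" unfolding u using B xyw \<eta> by (intro pos) (auto simp: u)
      ultimately have "m * \<sigma> ^ N \<le> Re (cnj p * P u) * bump3 u ^ N"
        using m bump_bounds[of \<eta>] by (intro mult_mono) (simp_all add: \<sigma>_def)
      moreover have "0 \<le> norm p * M * \<rho> ^ N" using M0 \<rho> by (intro mult_nonneg_nonneg) (auto intro: order_trans[OF norm_ge_zero])
      ultimately show ?thesis using B unfolding R by (simp del: times_complex.sel)
    next
      case C
      then have "m \<le> Re (cnj p * P u)" unfolding u by (intro pos) (auto simp: u)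
      then have "0 \<le> Re (cnj p * P u) * bump3 u ^ N" using m bump3_bounds by (intro mult_nonneg_nonneg) auto
      moreover have "0 \<le> norm p * M * \<rho> ^ N" using M0 \<rho> by (intro mult_nonneg_nonneg) (auto intro: order_trans[OF norm_ge_zero])
      ultimately show ?thesis using C unfolding R by (simp del: times_complex.sel)
    next
      case D
      have half: "\<bar>x\<bar> \<le> 1/2" "\<bar>y\<bar> \<le> 1/2" "\<bar>w\<bar> \<le> 1/2" using D(1) by (auto simp: cube_def u)
      have b1: "bump x * bump y * bump w \<le> bump x" "bump x * bump y * bump w \<le> bump y"
        "bump x * bump y * bump w \<le> bump w"
      proof -
        have *: "r * (s * t) \<le> r" if "0 \<le> r" "0 \<le> s" "s \<le> 1" "0 \<le> t" "t \<le> 1" for r s t :: real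
          using that by (intro mult_left_le mult_le_one) auto
        show "bump x * bump y * bump w \<le> bump x" "bump x * bump y * bump w \<le> bump y"
          "bump x * bump y * bump w \<le> bump w"
          using *[of "bump x" "bump y" "bump w"] *[of "bump y" "bump x" "bump w"] *[of "bump w" "bump x" "bump y"]
          by (simp_all add: bump_bounds mult_ac)
      qed
      have "bump3 u \<le> \<rho>"
        using D(3)
      proof (elim disjE)
        assume "\<delta> < \<bar>x\<bar>"
        then have "bump x \<le> \<rho>" unfolding \<rho>_def using \<delta> half by (intro bump_antimono) auto
        then show ?thesis using b1 by (simp add: bump3_def u)
      next
        assume "\<delta> < \<bar>y\<bar>"
        then have "bump y \<le> \<rho>" unfolding \<rho>_def using \<delta> half by (intro bump_antimono) auto
        then show ?thesis using b1 by (simp add: bump3_def u)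
      next
        assume "\<delta> < \<bar>w\<bar>"
        then have "bump w \<le> \<rho>" unfolding \<rho>_def using \<delta> half by (intro bump_antimono) auto
        then show ?thesis using b1 by (simp add: bump3_def u)
      qed
      then have 1: "bump3 u ^ N \<le> \<rho> ^ N" using bump3_bounds by (intro power_mono)
      have "\<bar>Re (cnj p * P u)\<bar> \<le> norm p * M"
        using abs_Re_le_cmod[of "cnj p * P u"] M[OF D(1)] mult_left_mono[OF M[OF D(1)], of "norm p"]
        by (simp add: norm_mult)
      then have "\<bar>Re (cnj p * P u) * bump3 u ^ N\<bar> \<le> (norm p * M) * \<rho> ^ N"
        unfolding abs_mult using 1 bump3_bounds by (intro mult_mono) auto
      then show ?thesis using D unfolding R by (simp del: times_complex.sel)
    qed
  qed
  have fin: "emeasure lborel cube = 1" "emeasure lborel B = ennreal ((2 * \<eta>) ^ 3)"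
    using emeasure_cube_box[of "1/2"] emeasure_cube_box[of \<eta>] \<eta> by (auto simp: cube_def B_def)
  have ineq: "m * \<sigma> ^ N * (2 * \<eta>) ^ 3 \<le> norm p * M * \<rho> ^ N" for N
  proof -
    have i1: "integrable lborel (\<lambda>u. ?h N u)"
    proof (rule Bochner_Integration.integrable_bound)
      show "integrable lborel (\<lambda>u. indicator cube u * M)"
        using fin by (intro integrable_mult_left integrable_real_indicator) auto
      show "AE u in lborel. norm (?h N u) \<le> norm (indicator cube u * M)"
      proof (intro AE_I2)
        fix u
        show "norm (?h N u) \<le> norm (indicator cube u * M)"
        proof (cases "u \<in> cube")
          case True
          have "norm (P u * of_real (bump3 u) ^ N) = norm (P u) * bump3 u ^ N"
            using bump3_bounds[of u] by (simp add: norm_mult norm_power)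
          also have "\<dots> \<le> norm (P u)" using bump3_bounds[of u] by (intro mult_left_le power_le_one) auto
          also have "\<dots> \<le> M" using M[OF True] .
          finally show ?thesis using True by simp
        qed simp
      qed
    qed measurable
    have i2: "integrable lborel (\<lambda>u. Re (cnj p * ?h N u))"
      by (intro integrable_Re integrable_mult_right i1)
    have i3: "integrable lborel (\<lambda>u. m * \<sigma> ^ N * indicator B u - norm p * M * \<rho> ^ N * indicator cube u)"
      using fin by (intro Bochner_Integration.integrable_diff integrable_mult_right integrable_real_indicator) auto
    have "(\<integral>u. m * \<sigma> ^ N * indicator B u - norm p * M * \<rho> ^ N * indicator cube u \<partial>lborel)
       \<le> (\<integral>u. Re (cnj p * ?h N u) \<partial>lborel)"
      by (intro integral_mono i2 i3 pt)
    also have "\<dots> = Re (\<integral>u. cnj p * ?h N u \<partial>lborel)"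
      by (intro integral_Re integrable_mult_right i1)
    also have "\<dots> = 0" using z[of N] by simp
    also have "(\<integral>u. m * \<sigma> ^ N * indicator B u - norm p * M * \<rho> ^ N * indicator cube u \<partial>lborel)
      = m * \<sigma> ^ N * measure lborel B - norm p * M * \<rho> ^ N * measure lborel cube"
      using fin by (subst Bochner_Integration.integral_diff) auto
    finally have "m * \<sigma> ^ N * measure lborel B - norm p * M * \<rho> ^ N * measure lborel cube \<le> 0" .
    moreover have "measure lborel B = (2 * \<eta>) ^ 3" "measure lborel cube = 1"
      using fin \<eta> by (simp_all add: measure_def)
    ultimately show ?thesis by simp
  qed
  \<comment> \<open>Dividing by \<sigma>^N leaves a fixed positive lower bound against a null
    sequence.\<close>
  have "(\<lambda>N. (norm p * M) * (\<rho> / \<sigma>) ^ N) \<longlonglongrightarrow> (norm p * M) * 0"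
    using \<rho> \<eta> by (intro tendsto_mult tendsto_const LIMSEQ_power_zero)
      (use bump_bounds(1)[of \<eta>] in \<open>simp add: \<sigma>_def divide_less_eq abs_of_pos\<close>)
  moreover have "m * (2 * \<eta>) ^ 3 \<le> (norm p * M) * (\<rho> / \<sigma>) ^ N" for N
  proof -
    have "0 < \<sigma>" using \<rho> \<eta> unfolding \<sigma>_def by linarith
    then have "0 < \<sigma> ^ N" by simp
    then have "m * (2 * \<eta>) ^ 3 \<le> norm p * M * \<rho> ^ N / \<sigma> ^ N"
      using ineq[of N] by (simp add: pos_le_divide_eq mult_ac)
    then show ?thesis by (simp add: power_divide)
  qed
  ultimately have "m * (2 * \<eta>) ^ 3 \<le> 0" by (simp add: LIMSEQ_le_const)
  then show False using m \<eta> by (simp add: mult_le_0_iff)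
qed

lemma cube_cover: "\<exists>n. Q - lat n \<in> cube"
proof -
  obtain a b c where Q: "Q = (a, b, c)" by (metis prod_cases3)
  have *: "t - of_int \<lfloor>t + 1/2\<rfloor> \<in> {-1/2..<1/2}" for t :: real
  proof -
    have "of_int \<lfloor>t + 1/2\<rfloor> \<le> t + 1/2" "t + 1/2 < of_int \<lfloor>t + 1/2\<rfloor> + 1"
      by linarith+
    then show ?thesis unfolding atLeastLessThan_iff by linarith
  qed
  show ?thesis
    by (rule exI[of _ "(\<lfloor>a + 1/2\<rfloor>, \<lfloor>b + 1/2\<rfloor>, \<lfloor>c + 1/2\<rfloor>)"])
       (use * in \<open>simp add: cube_def lat_def Q\<close>)
qed

lemma cube_disjoint:
  assumes "Q - lat m \<in> cube" "Q - lat n \<in> cube"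
  shows "m = n"
proof -
  have *: "i = j" if "t - of_int i \<in> {-1/2..<1/2}" "t - of_int j \<in> {-1/2..<1/2}" for t :: real and i j
    using that unfolding atLeastLessThan_iff by linarith
  show ?thesis using assms
    by (cases m; cases n; cases Q) (use * in \<open>auto simp: cube_def lat_def\<close>)
qed

text \<open>The periodisation \<open>P\<close> of \<open>F\<close> on the cube is continuous, and
  its value at the origin is the lattice sum. Integrating \<open>P\<close> against powers of
  \<open>bump3\<close> unfolds to integrals of \<open>F\<close> against trigonometric polynomials,
  which vanish, so \<open>Laplace_cube\<close> gives \<open>P 0 = 0\<close>.\<close>

lemma lattice_sum_zero:
  fixes F :: "vec3 \<Rightarrow> complex"
  assumes cont: "continuous_on UNIV F" and bound: "\<And>Q. norm (F Q) \<le> C * wt3 Q"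
    and z: "\<And>n. (\<integral>Q. F Q * char3 n Q \<partial>lborel) = 0"
  shows "((\<lambda>n. F (lat n)) has_sum 0) UNIV"
proof -
  have [measurable]: "F \<in> borel_measurable borel" using cont by (rule borel_measurable_continuous_onI)
  have F: "integrable lborel F"
    by (rule Bochner_Integration.integrable_bound[OF integrable_mult_right[OF integrable_wt3, of C]])
       (measurable, use bound in \<open>intro AE_I2, metis real_norm_def abs_ge_self order_trans\<close>)
  have C: "C \<ge> 0" using bound[of 0] wt3_pos[of 0] by (smt (verit) norm_ge_zero zero_le_mult_iff)
  \<comment> \<open>An enumeration of the lattice makes the Weierstrass test and the exchange of
    series and integral applicable.\<close>
  define e :: "nat \<Rightarrow> int \<times> int \<times> int" where "e = from_nat_into UNIV"
  have "infinite (UNIV :: (int \<times> int \<times> int) set)" by (simp add: finite_prod)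
  then have e: "bij e" unfolding e_def by (intro bij_betw_from_nat_into) auto
  have sum_wt: "summable (\<lambda>i. wt3 (lat (e i)))"
  proof -
    have "(\<lambda>i. wt3 (lat (e i))) summable_on UNIV"
      using wt3_summable summable_on_reindex_bij_betw[OF e, of "\<lambda>n. wt3 (lat n)"] by simp
    then show ?thesis by (rule summable_on_imp_summable)
  qed
  define A where "A i = {Q. Q - lat (e i) \<in> cube}" for i
  have A[measurable]: "A i \<in> sets borel" for i unfolding A_def by measurable
  have disj: "A i \<inter> A j = {}" if "i \<noteq> j" for i j
  proof -
    have "e i \<noteq> e j" using that e by (simp add: bij_def inj_eq)
    then show ?thesis using cube_disjoint by (fastforce simp: A_def)
  qed
  have cover: "(\<Union>i. A i) = UNIV"
  proof (rule UNIV_eq_I[symmetric])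
    fix Q obtain n where "Q - lat n \<in> cube" using cube_cover by blast
    moreover obtain i where "n = e i" using e by (metis bij_pointE)
    ultimately show "Q \<in> (\<Union>i. A i)" by (auto simp: A_def)
  qed
  define M where "M i = 64 * C * wt3 (lat (e i))" for i
  have M: "summable M" unfolding M_def using sum_wt by (rule summable_mult)
  have le: "norm (F (u + lat (e i))) \<le> M i" if "u \<in> cube" for u i
  proof -
    have "wt3 (u + lat (e i)) \<le> 64 * wt3 (lat (e i))"
      by (rule wt3_shift) (use that in \<open>auto simp: cube_def\<close>)
    then have "C * wt3 (u + lat (e i)) \<le> C * (64 * wt3 (lat (e i)))" using C by (rule mult_left_mono)
    then show ?thesis using bound[of "u + lat (e i)"] by (simp add: M_def)
  qed
  define P where "P u = (\<Sum>i. indicator cube u * F (u + lat (e i)))" for u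
  have le': "norm (indicator cube u * F (u + lat (e i))) \<le> M i" for u i
  proof (cases "u \<in> cube")
    case False
    then show ?thesis using wt3_pos[of "lat (e i)"] C by (simp add: M_def)
  qed (use le in simp)
  have sF: "summable (\<lambda>i. indicator cube u * F (u + lat (e i)))" for u
    by (rule summable_comparison_test'[OF M le'])
  have [measurable]: "P \<in> borel_measurable borel" unfolding P_def by measurable
  have P_bound: "norm (P u) \<le> suminf M" for u
    unfolding P_def by (rule order_trans[OF summable_norm suminf_le[OF le' _ M]])
      (rule summable_comparison_test'[OF M], simp add: le')+
  have P_cont: "continuous (at 0 within cube) P"
  proof -
    have ul: "uniform_limit cube (\<lambda>n u. \<Sum>i<n. indicator cube u * F (u + lat (e i))) P sequentially"
      unfolding P_def by (rule Weierstrass_m_test[OF le' M])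
    have "continuous_on cube (\<lambda>u. \<Sum>i<n. indicator cube u * F (u + lat (e i)))" for n
    proof -
      have "continuous_on cube (\<lambda>u. \<Sum>i<n. F (u + lat (e i)))"
        by (intro continuous_intros continuous_on_compose2[OF cont]) auto
      then show ?thesis by (rule continuous_on_eq) auto
    qed
    then have "\<forall>\<^sub>F n in sequentially. continuous_on cube (\<lambda>u. \<Sum>i<n. indicator cube u * F (u + lat (e i)))"
      by (intro always_eventually allI)
    then have "continuous_on cube P"
      by (rule uniform_limit_theorem[OF _ ul trivial_limit_sequentially])
    then show ?thesis by (rule continuous_on_imp_continuous_within) (auto simp: cube_def zero_prod_def)
  qed
  have P_zero: "(\<integral>u. indicator cube u * (P u * of_real (bump3 u) ^ N) \<partial>lborel) = 0" for N
  proof -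
    let ?h = "\<lambda>i u. indicator cube u * F (u + lat (e i)) * complex_of_real (bump3 u) ^ N"
    define H where "H Q = F Q * of_real (bump3 Q) ^ N" for Q
    have H: "integrable lborel H" "(\<integral>Q. H Q \<partial>lborel) = 0"
    proof -
      have "char3 (0, 0, 0) = (\<lambda>_. 1)" by (auto simp: char3_def)
      moreover have "(\<integral>Q. F Q * of_real (bump3 Q) ^ N * char3 (0, 0, 0) Q \<partial>lborel) = 0"
        using integral_bump3_power[OF F z, of N] by blast
      ultimately show "(\<integral>Q. H Q \<partial>lborel) = 0" by (simp add: H_def)
      show "integrable lborel H"
        using integral_bump3_power[OF F z, of N] by (simp add: H_def[abs_def])
    qed
    \<comment> \<open>Unfolding: the integral over space is cut into translates of the cube, and
      each piece is moved back; \<open>bump3\<close> is periodic and passes through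
      unchanged.\<close>
    have "0 = (LINT Q:(\<Union>i. A i)|lborel. H Q)"
      unfolding cover using H(2) by (simp add: set_lebesgue_integral_def)
    also have "\<dots> = (\<Sum>i. LINT Q:(A i)|lborel. H Q)"
      by (rule lebesgue_integral_countable_add) (use disj cover H in \<open>auto simp: set_integrable_def\<close>)
    also have "\<dots> = (\<Sum>i. \<integral>u. ?h i u \<partial>lborel)"
    proof (rule suminf_cong)
      fix i
      have "(LINT Q:(A i)|lborel. H Q) = (\<integral>Q. indicator (A i) (Q + lat (e i)) *\<^sub>R H (Q + lat (e i)) \<partial>lborel)"
        unfolding set_lebesgue_integral_def
        by (rule lborel_integral_shift[symmetric]) (unfold H_def, measurable)
      also have "\<dots> = (\<integral>u. ?h i u \<partial>lborel)"
        by (rule Bochner_Integration.integral_cong) (auto simp: H_def bump3_add_lat A_def indicator_def)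
      finally show "(LINT Q:(A i)|lborel. H Q) =
          (\<integral>u. ?h i u \<partial>lborel)" .
    qed
    also have "\<dots> = (\<integral>u. (\<Sum>i. ?h i u) \<partial>lborel)"
    proof (rule integral_suminf[symmetric])
      have nle: "norm (?h i u) \<le> indicator cube u * M i" for u i
      proof (cases "u \<in> cube")
        case True
        have "norm (F (u + lat (e i)) * of_real (bump3 u) ^ N) = norm (F (u + lat (e i))) * bump3 u ^ N"
          using bump3_bounds[of u] by (simp add: norm_mult norm_power)
        also have "\<dots> \<le> norm (F (u + lat (e i)))" using bump3_bounds[of u] by (intro mult_left_le power_le_one) auto
        also have "\<dots> \<le> M i" using le[OF True] .
        finally show ?thesis using True by simp
      qed simp
      have fin: "emeasure lborel cube = 1" using emeasure_cube_box[of "1/2"] by (simp add: cube_def)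
      have iM: "integrable lborel (\<lambda>u. indicator cube u * M i)" for i
        using fin by (intro integrable_mult_left integrable_real_indicator) auto
      show int: "integrable lborel (\<lambda>u. ?h i u)" for i
        by (rule Bochner_Integration.integrable_bound[OF iM[of i]])
           (measurable, use nle in \<open>intro AE_I2, metis real_norm_def abs_ge_self order_trans\<close>)
      show "AE u in lborel. summable (\<lambda>i. norm (?h i u))"
      proof (intro AE_I2 summable_comparison_test'[OF M])
        fix u i
        show "norm (norm (?h i u)) \<le> M i"
        proof -
          have "0 \<le> M i" using wt3_pos[of "lat (e i)"] C by (simp add: M_def)
          then have "indicator cube u * M i \<le> M i" by (cases "u \<in> cube") auto
          then show ?thesis unfolding real_norm_def abs_norm_cancel using nle[of u i] by (rule order_trans[rotated])
        qed
      qed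
      show "summable (\<lambda>i. \<integral>u. norm (?h i u) \<partial>lborel)"
      proof (rule summable_comparison_test'[OF M])
        fix i
        have "(\<integral>u. norm (?h i u) \<partial>lborel)
            \<le> (\<integral>u. indicator cube u * M i \<partial>lborel)"
          by (intro integral_mono integrable_norm int iM nle)
        also have "\<dots> = M i" using fin by (simp add: measure_def)
        finally show "norm (\<integral>u. norm (?h i u) \<partial>lborel) \<le> M i"
          by simp
      qed
    qed
    also have "\<dots> = (\<integral>u. indicator cube u * (P u * of_real (bump3 u) ^ N) \<partial>lborel)"
    proof (rule Bochner_Integration.integral_cong)
      fix u
      have "(\<Sum>i. ?h i u) = P u * of_real (bump3 u) ^ N"
        unfolding P_def by (rule suminf_mult2[OF sF, symmetric])
      also have "\<dots> = indicator cube u * (P u * of_real (bump3 u) ^ N)"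
        by (simp add: P_def indicator_def)
      finally show "(\<Sum>i. ?h i u) =
        indicator cube u * (P u * of_real (bump3 u) ^ N)" .
    qed simp
    finally show ?thesis by simp
  qed
  have "P 0 = 0" by (rule Laplace_cube[OF _ P_bound P_cont P_zero]) measurable
  moreover have "(0 :: vec3) \<in> cube" by (simp add: cube_def zero_prod_def)
  ultimately have "(\<Sum>i. F (lat (e i))) = 0" by (simp add: P_def)
  moreover have "norm (F (lat (e i))) \<le> M i" for i using le[OF \<open>0 \<in> cube\<close>] by simp
  then have s: "summable (\<lambda>i. norm (F (lat (e i))))"
    by (intro summable_comparison_test'[OF M]) simp
  ultimately have "(\<lambda>i. F (lat (e i))) sums 0" using summable_norm_cancel[OF s] by (simp add: sums_iff)
  then have "((\<lambda>i. F (lat (e i))) has_sum 0) UNIV" by (intro norm_summable_imp_has_sum s)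
  then show ?thesis using has_sum_reindex_bij_betw[OF e, of "\<lambda>n. F (lat n)"] by simp
qed

section \<open>Integration by parts and Gaussian test functions\<close>

lemma tendsto_wt:
  "(wt \<longlongrightarrow> 0) at_top" "(wt \<longlongrightarrow> 0) at_bot"
proof -
  have 1: "((\<lambda>t::real. (1 + t) powr (- (4 / 3))) \<longlongrightarrow> 0) at_top"
    by (intro tendsto_neg_powr filterlim_tendsto_add_at_top[OF tendsto_const] filterlim_ident) auto
  then show top: "(wt \<longlongrightarrow> 0) at_top"
    by (rule Lim_transform_eventually) (use eventually_ge_at_top[of 0] in \<open>eventually_elim, simp add: wt_def\<close>)
  then show "(wt \<longlongrightarrow> 0) at_bot"
  proof -
    have "(\<lambda>t. wt (- t)) = wt" by (simp add: wt_def fun_eq_iff)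
    then show ?thesis using top by (simp add: filterlim_at_bot_mirror)
  qed
qed

text \<open>The fundamental theorem on [-n, n] gives boundary terms that tend to 0 with
  \<open>wt\<close>; dominated convergence reaches the whole line.\<close>

lemma integral_deriv_eq_0:
  fixes h h' :: "real \<Rightarrow> complex"
  assumes deriv: "\<And>t. (h has_vector_derivative h' t) (at t)"
    and bound: "\<And>t. norm (h t) \<le> C * wt t" "\<And>t. norm (h' t) \<le> C * wt t"
    and [measurable]: "h' \<in> borel_measurable borel"
  shows "(\<integral>t. h' t \<partial>lborel) = 0"
proof -
  have int: "integrable lborel h'"
    by (rule Bochner_Integration.integrable_bound[OF integrable_mult_right[OF integrable_wt, of C]])
       (measurable, use bound(2) in \<open>intro AE_I2, metis real_norm_def abs_ge_self order_trans\<close>)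
  have eq: "(\<integral>t. indicator {- real n..real n} t *\<^sub>R h' t \<partial>lborel) = h (real n) - h (- real n)" for n
  proof -
    have "set_integrable lborel {- real n..real n} h'"
      unfolding set_integrable_def using int by (intro integrable_mult_indicator) auto
    then have "(LINT t:{- real n..real n}|lborel. h' t) = integral {- real n..real n} h'"
      by (rule set_borel_integral_eq_integral)
    also have "\<dots> = h (real n) - h (- real n)"
      by (intro integral_unique fundamental_theorem_of_calculus)
         (auto intro: has_vector_derivative_at_within deriv)
    finally show ?thesis by (simp add: set_lebesgue_integral_def)
  qed
  have "(\<lambda>n. \<integral>t. indicator {- real n..real n} t *\<^sub>R h' t \<partial>lborel) \<longlonglongrightarrow> (\<integral>t. h' t \<partial>lborel)"
  proof (rule integral_dominated_convergence[where w = "\<lambda>t. norm (h' t)"])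
    show "AE t in lborel. (\<lambda>n. indicator {- real n..real n} t *\<^sub>R h' t) \<longlonglongrightarrow> h' t"
    proof (intro AE_I2 tendsto_eventually)
      fix t
      obtain n0 where "\<bar>t\<bar> \<le> real n0" using real_arch_simple by blast
      then show "\<forall>\<^sub>F n in sequentially. indicator {- real n..real n} t *\<^sub>R h' t = h' t"
        by (intro eventually_sequentiallyI[of n0]) (auto simp: indicator_def)
    qed
    show "AE t in lborel. norm (indicator {- real n..real n} t *\<^sub>R h' t) \<le> norm (h' t)" for n
      by (auto simp: indicator_def)
  qed (use int in auto)
  moreover have "(\<lambda>n. h (real n) - h (- real n)) \<longlonglongrightarrow> 0 - 0"
  proof (intro tendsto_diff)
    have *: "(\<lambda>n. C * wt (f n)) \<longlonglongrightarrow> 0" if "(\<lambda>n. wt (f n)) \<longlonglongrightarrow> 0" for f :: "nat \<Rightarrow> real"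
      using tendsto_mult_right_zero[OF that] .
    show "(\<lambda>n. h (real n)) \<longlonglongrightarrow> 0"
      by (rule tendsto_norm_zero_cancel, rule tendsto_sandwich[OF _ _ tendsto_const *[of real]])
         (use bound(1) in \<open>auto intro!: filterlim_compose[OF tendsto_wt(1) filterlim_real_sequentially]\<close>)
    show "(\<lambda>n. h (- real n)) \<longlonglongrightarrow> 0"
      by (rule tendsto_norm_zero_cancel, rule tendsto_sandwich[OF _ _ tendsto_const *[of "\<lambda>n. - real n"]])
         (use bound(1) in \<open>auto intro!: filterlim_compose[OF tendsto_wt(2)]
            filterlim_compose[OF filterlim_uminus_at_bot_at_top filterlim_real_sequentially]\<close>)
  qed
  ultimately show ?thesis using LIMSEQ_unique by (simp add: eq)
qed

section \<open>Integration by parts along almost every line parallel to an axis\<close>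

context
  fixes H H' :: "vec3 \<Rightarrow> complex" and C :: real
  assumes meas [measurable]: "H' \<in> borel_measurable borel"
    and bound: "\<And>Q. norm (H Q) \<le> C * wt3 Q" "\<And>Q. norm (H' Q) \<le> C * wt3 Q"
begin

lemma meas_prod: "H' \<in> borel_measurable (lborel \<Otimes>\<^sub>M (lborel \<Otimes>\<^sub>M lborel))"
  using meas by (simp add: lborel_prod)

lemma H'_integrable: "integrable (lborel \<Otimes>\<^sub>M (lborel \<Otimes>\<^sub>M lborel)) H'"
  unfolding lborel_prod
  by (rule Bochner_Integration.integrable_bound[OF integrable_mult_right[OF integrable_wt3, of C]])
     (measurable, use bound(2) in \<open>intro AE_I2, metis real_norm_def abs_ge_self order_trans\<close>)

lemma wt_perm:
  "C * wt3 (a, b, c) = (C * wt a * wt b) * wt c" "C * wt3 (a, b, c) = (C * wt a * wt c) * wt b"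
  "C * wt3 (a, b, c) = (C * wt b * wt c) * wt a"
  by (simp_all add: wt3_def)

lemma AE_lborel_neq: "AE t in lborel. t \<noteq> (0::real)"
  using AE_lborel_singleton[of "0::real"] by simp

text \<open>A line in direction a with b \<noteq> 0 misses the origin, where derivatives of the
  kernel may fail to exist; the omitted lines form a null set. In the two companion lemmas the
  condition a \<noteq> 0 serves the same purpose.\<close>

lemma integral_fst_deriv_eq_0:
  assumes "\<And>a b c. b \<noteq> 0 \<Longrightarrow> ((\<lambda>t. H (t, b, c)) has_vector_derivative H' (a, b, c)) (at a)"
  shows "(\<integral>Q. H' Q \<partial>lborel) = 0"
proof -
  note [measurable] = meas_prod
  have inner: "(\<integral>a. H' (a, b, c) \<partial>lborel) = 0" if "b \<noteq> 0" for b c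
    by (rule integral_deriv_eq_0[where h = "\<lambda>t. H (t, b, c)" and C = "C * wt b * wt c"])
       (use assms[OF that] bound[of "(_, b, c)"] in \<open>auto simp: wt_perm(3)[symmetric]\<close>)
  have "(\<integral>Q. H' Q \<partial>lborel) = (\<integral>bc. (\<integral>a. H' (a, bc) \<partial>lborel) \<partial>(lborel \<Otimes>\<^sub>M lborel))"
    using lborel_pair.integral_snd[of "\<lambda>a bc. H' (a, bc)"] H'_integrable by (simp add: lborel_prod)
  also have "\<dots> = 0"
  proof (rule integral_eq_zero_AE)
    have "AE bc in lborel \<Otimes>\<^sub>M lborel. fst bc \<noteq> (0::real)"
    proof (rule lborel_pair.AE_pair_measure)
      show "AE b in lborel. AE c in lborel. fst (b, c) \<noteq> (0::real)"
        using AE_lborel_neq by eventually_elim simp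
    qed measurable
    then show "AE bc in lborel \<Otimes>\<^sub>M lborel. (\<integral>a. H' (a, bc) \<partial>lborel) = 0"
      by eventually_elim (use inner in auto)
  qed
  finally show ?thesis .
qed

lemma integral_snd_eq_0:
  assumes "\<And>a. a \<noteq> 0 \<Longrightarrow> (\<integral>bc. H' (a, bc) \<partial>(lborel \<Otimes>\<^sub>M lborel)) = 0"
  shows "(\<integral>Q. H' Q \<partial>lborel) = 0"
proof -
  note [measurable] = meas_prod
  have "(\<integral>Q. H' Q \<partial>lborel) = (\<integral>a. (\<integral>bc. H' (a, bc) \<partial>(lborel \<Otimes>\<^sub>M lborel)) \<partial>lborel)"
    using lborel_pair.integral_fst[of "\<lambda>a bc. H' (a, bc)"] H'_integrable by (simp add: lborel_prod)
  also have "\<dots> = 0"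
  proof (rule integral_eq_zero_AE)
    show "AE a in lborel. (\<integral>bc. H' (a, bc) \<partial>(lborel \<Otimes>\<^sub>M lborel)) = 0"
      using AE_lborel_neq by eventually_elim (rule assms)
  qed
  finally show ?thesis .
qed

lemma H'_integrable_snd: "integrable (lborel \<Otimes>\<^sub>M lborel) (\<lambda>(b, c). H' (a, b, c))"
proof -
  note [measurable] = meas_prod
  have "integrable lborel (\<lambda>(b, c). (C * wt a * wt b) * wt c)"
    by (intro integrable_lborel_times integrable_mult_right integrable_wt)
  then show ?thesis unfolding lborel_prod
  proof (rule Bochner_Integration.integrable_bound)
    show "AE x in lborel. norm (case x of (b, c) \<Rightarrow> H' (a, b, c)) \<le> norm (case x of (b, c) \<Rightarrow> C * wt a * wt b * wt c)"
      using bound(2)[of "(a, _, _)"] unfolding wt_perm(1)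
      by (auto intro!: AE_I2 intro: order_trans[OF _ abs_ge_self])
  qed (simp add: lborel_prod[symmetric])
qed

lemma integral_snd_fst_deriv_eq_0:
  assumes "\<And>a b c. a \<noteq> 0 \<Longrightarrow> ((\<lambda>t. H (a, t, c)) has_vector_derivative H' (a, b, c)) (at b)"
  shows "(\<integral>Q. H' Q \<partial>lborel) = 0"
proof (rule integral_snd_eq_0)
  note [measurable] = meas_prod
  fix a :: real assume a: "a \<noteq> 0"
  have "(\<integral>b. H' (a, b, c) \<partial>lborel) = 0" for c
    by (rule integral_deriv_eq_0[where h = "\<lambda>t. H (a, t, c)" and C = "C * wt a * wt c"])
       (use assms[OF a] bound[of "(a, _, c)"] in \<open>auto simp: wt_perm(2)[symmetric]\<close>)
  then show "(\<integral>bc. H' (a, bc) \<partial>(lborel \<Otimes>\<^sub>M lborel)) = 0"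
    using lborel_pair.integral_snd[of "\<lambda>b c. H' (a, b, c)"] H'_integrable_snd[of a] by (simp add: case_prod_unfold)
qed

lemma integral_snd_snd_deriv_eq_0:
  assumes "\<And>a b c. a \<noteq> 0 \<Longrightarrow> ((\<lambda>t. H (a, b, t)) has_vector_derivative H' (a, b, c)) (at c)"
  shows "(\<integral>Q. H' Q \<partial>lborel) = 0"
proof (rule integral_snd_eq_0)
  note [measurable] = meas_prod
  fix a :: real assume a: "a \<noteq> 0"
  have "(\<integral>c. H' (a, b, c) \<partial>lborel) = 0" for b
    by (rule integral_deriv_eq_0[where h = "\<lambda>t. H (a, b, t)" and C = "C * wt a * wt b"])
       (use assms[OF a] bound[of "(a, b, _)"] in \<open>auto simp: wt_perm(1)[symmetric]\<close>)
  then show "(\<integral>bc. H' (a, bc) \<partial>(lborel \<Otimes>\<^sub>M lborel)) = 0"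
    using lborel_pair.integral_fst[of "\<lambda>b c. H' (a, b, c)"] H'_integrable_snd[of a] by (simp add: case_prod_unfold)
qed

end

section \<open>Rapidly decreasing functions of one variable\<close>

definition rapid :: "(real \<Rightarrow> complex) \<Rightarrow> bool" where
  "rapid g \<longleftrightarrow> (\<forall>N. \<exists>C. \<forall>t. norm (g t) * (1 + \<bar>t\<bar>) ^ N \<le> C)"

lemma rapidI_mult:
  assumes "rapid g" "\<And>t. norm (f t) \<le> D * (1 + \<bar>t\<bar>) ^ m"
  shows "rapid (\<lambda>t. f t * g t)"
  unfolding rapid_def
proof
  fix N
  obtain C where C: "\<And>t. norm (g t) * (1 + \<bar>t\<bar>) ^ (m + N) \<le> C" using assms(1) unfolding rapid_def by meson
  have D: "D \<ge> 0" using assms(2)[of 0] by (simp add: order_trans[OF norm_ge_zero])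
  have "norm (f t * g t) * (1 + \<bar>t\<bar>) ^ N \<le> D * C" for t
  proof -
    have "norm (f t * g t) * (1 + \<bar>t\<bar>) ^ N \<le> (D * (1 + \<bar>t\<bar>) ^ m) * norm (g t) * (1 + \<bar>t\<bar>) ^ N"
      unfolding norm_mult by (intro mult_right_mono assms(2)) auto
    also have "\<dots> = D * (norm (g t) * (1 + \<bar>t\<bar>) ^ (m + N))" by (simp add: power_add mult_ac)
    also have "\<dots> \<le> D * C" using C D by (intro mult_left_mono)
    finally show ?thesis .
  qed
  then show "\<exists>C. \<forall>t. norm (f t * g t) * (1 + \<bar>t\<bar>) ^ N \<le> C" by blast
qed

lemma exp_ge_power: "(x::real) \<ge> 0 \<Longrightarrow> x ^ n / fact n \<le> exp x"
proof -
  assume x: "x \<ge> 0"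
  have "(\<Sum>i\<in>{n}. x ^ i /\<^sub>R fact i) \<le> (\<Sum>i. x ^ i /\<^sub>R fact i)"
    using summable_exp_generic[of x] x by (intro sum_le_suminf) auto
  then show ?thesis by (simp add: exp_def divide_inverse mult.commute)
qed

lemma rapid_Gaussian:
  assumes "\<epsilon> > 0"
  shows "rapid (\<lambda>t. cis (s * t) * of_real (exp (- \<epsilon> * t\<^sup>2)))"
  unfolding rapid_def
proof
  fix N :: nat
  \<comment> \<open>For |t| <= 1 the power is at most 2^N. For |t| > 1 one has 1 + |t| <= 2 t^2, and
    the N-th term of the exponential series gives 2^N N! / \<epsilon>^N.\<close>
  define C where "C = 2 ^ N * (1 + fact N / \<epsilon> ^ N)"
  have "exp (- \<epsilon> * t\<^sup>2) * (1 + \<bar>t\<bar>) ^ N \<le> C" for t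
  proof (cases "\<bar>t\<bar> \<le> 1")
    case True
    then have "(1 + \<bar>t\<bar>) ^ N \<le> 2 ^ N" by (intro power_mono) auto
    then have "exp (- \<epsilon> * t\<^sup>2) * (1 + \<bar>t\<bar>) ^ N \<le> 1 * 2 ^ N" using assms by (intro mult_mono) auto
    also have "\<dots> \<le> C" using assms by (simp add: C_def)
    finally show ?thesis .
  next
    case False
    then have "1 * \<bar>t\<bar> \<le> \<bar>t\<bar> * \<bar>t\<bar>" by (intro mult_right_mono) auto
    then have "1 + \<bar>t\<bar> \<le> 2 * \<bar>t\<bar>\<^sup>2" unfolding power2_eq_square using False by linarith
    then have "(1 + \<bar>t\<bar>) ^ N \<le> (2 * \<bar>t\<bar>\<^sup>2) ^ N" by (intro power_mono) auto
    also have "\<dots> = 2 ^ N * fact N / \<epsilon> ^ N * ((\<epsilon> * t\<^sup>2) ^ N / fact N)"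
      using assms by (simp add: power_mult_distrib power_mult[symmetric])
    also have "\<dots> \<le> 2 ^ N * fact N / \<epsilon> ^ N * exp (\<epsilon> * t\<^sup>2)"
      using assms by (intro mult_left_mono exp_ge_power) auto
    finally have "exp (- \<epsilon> * t\<^sup>2) * (1 + \<bar>t\<bar>) ^ N \<le> 2 ^ N * fact N / \<epsilon> ^ N"
      by (simp add: exp_minus field_simps)
    also have "\<dots> \<le> C" by (simp add: C_def distrib_left)
    finally show ?thesis .
  qed
  then have "\<forall>t. norm (cis (s * t) * of_real (exp (- \<epsilon> * t\<^sup>2))) * (1 + \<bar>t\<bar>) ^ N \<le> C"
    by (simp add: norm_mult)
  then show "\<exists>C. \<forall>t. norm (cis (s * t) * of_real (exp (- \<epsilon> * t\<^sup>2))) * (1 + \<bar>t\<bar>) ^ N \<le> C" by blast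
qed

lemma rapid_bound:
  assumes "rapid g"
  shows "\<exists>C\<ge>0. \<forall>t. norm (g t) * (1 + \<bar>t\<bar>) ^ N \<le> C * wt t"
proof -
  \<comment> \<open>Two spare powers of 1 + |t| cover the exponent 4/3 of \<open>wt\<close>.\<close>
  obtain C where C: "\<And>t. norm (g t) * (1 + \<bar>t\<bar>) ^ (N + 2) \<le> C" using assms unfolding rapid_def by meson
  have C0: "C \<ge> 0" using C[of 0] by (simp add: order_trans[OF norm_ge_zero])
  have "norm (g t) * (1 + \<bar>t\<bar>) ^ N \<le> C * wt t" for t
  proof -
    have p: "1 + \<bar>t\<bar> > 0" by (simp add: add_pos_nonneg)
    have "norm (g t) * (1 + \<bar>t\<bar>) ^ N = norm (g t) * (1 + \<bar>t\<bar>) ^ (N + 2) * (1 + \<bar>t\<bar>) powr (-2)"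
    proof -
      define u where "u = 1 + \<bar>t\<bar>"
      have "u powr (-2) = 1 / u ^ 2" using p by (simp add: u_def powr_minus powr_numeral inverse_eq_divide)
      then show ?thesis unfolding u_def[symmetric] using p by (simp add: u_def[symmetric] power_add power2_eq_square)
    qed
    also have "\<dots> \<le> C * (1 + \<bar>t\<bar>) powr (-2)" by (intro mult_right_mono C) auto
    also have "\<dots> \<le> C * wt t" unfolding wt_def using C0 by (intro mult_left_mono powr_mono) auto
    finally show ?thesis .
  qed
  then show ?thesis using C0 by blast
qed

lemma poly_rapid_bound:
  fixes F :: "vec3 \<Rightarrow> complex"
  assumes "\<And>a b c. norm (F (a, b, c)) \<le> C * ((1 + \<bar>a\<bar>) * (1 + \<bar>b\<bar>) * (1 + \<bar>c\<bar>)) ^ N"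
    and "rapid g1" "rapid g2" "rapid g3"
  shows "\<exists>C'. \<forall>a b c. norm (F (a, b, c) * (g1 a * g2 b * g3 c)) \<le> C' * wt3 (a, b, c)"
proof -
  obtain C1 C2 C3 where C: "C1 \<ge> 0" "C2 \<ge> 0" "C3 \<ge> 0"
    "\<And>t. norm (g1 t) * (1 + \<bar>t\<bar>) ^ N \<le> C1 * wt t"
    "\<And>t. norm (g2 t) * (1 + \<bar>t\<bar>) ^ N \<le> C2 * wt t"
    "\<And>t. norm (g3 t) * (1 + \<bar>t\<bar>) ^ N \<le> C3 * wt t"
    using rapid_bound assms(2-4) by metis
  have C0: "C \<ge> 0" using assms(1)[of 0 0 0] by (simp add: order_trans[OF norm_ge_zero])
  have "norm (F (a, b, c) * (g1 a * g2 b * g3 c)) \<le> (C * C1 * C2 * C3) * wt3 (a, b, c)" for a b c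
  proof -
    have "norm (F (a, b, c) * (g1 a * g2 b * g3 c)) \<le>
        C * ((1 + \<bar>a\<bar>) * (1 + \<bar>b\<bar>) * (1 + \<bar>c\<bar>)) ^ N * (norm (g1 a) * norm (g2 b) * norm (g3 c))"
      unfolding norm_mult by (intro mult_right_mono assms(1)) auto
    also have "\<dots> = C * ((norm (g1 a) * (1 + \<bar>a\<bar>) ^ N) *
        ((norm (g2 b) * (1 + \<bar>b\<bar>) ^ N) * (norm (g3 c) * (1 + \<bar>c\<bar>) ^ N)))"
      by (simp add: power_mult_distrib mult_ac)
    also have "\<dots> \<le> C * ((C1 * wt a) * ((C2 * wt b) * (C3 * wt c)))"
      by (intro mult_left_mono mult_mono C C0 mult_nonneg_nonneg) (auto simp: less_imp_le wt_pos)
    also have "\<dots> = (C * C1 * C2 * C3) * wt3 (a, b, c)" by (simp add: wt3_def mult_ac)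
    finally show ?thesis .
  qed
  then show ?thesis by blast
qed

text \<open>The difference-quotient form is what dominated convergence along sequences can
  use.\<close>

lemma has_vector_derivative_quotient_iff:
  fixes f :: "real \<Rightarrow> complex"
  shows "(f has_vector_derivative D) (at s within S) \<longleftrightarrow>
    ((\<lambda>y. (f y - f s) / of_real (y - s)) \<longlongrightarrow> D) (at s within S)"
proof -
  have "(f has_vector_derivative D) (at s within S) \<longleftrightarrow>
      ((\<lambda>y. (1 / norm (y - s)) *\<^sub>R (f y - (f s + (y - s) *\<^sub>R D))) \<longlongrightarrow> 0) (at s within S)"
    unfolding has_vector_derivative_def has_derivative_within
    using bounded_linear_scaleR_left[of D] by blast
  also have "\<dots> \<longleftrightarrow> ((\<lambda>y. norm ((1 / norm (y - s)) *\<^sub>R (f y - (f s + (y - s) *\<^sub>R D)))) \<longlongrightarrow> 0) (at s within S)"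
    by (rule tendsto_norm_zero_iff[symmetric])
  also have "\<dots> \<longleftrightarrow> ((\<lambda>y. norm ((f y - f s) / of_real (y - s) - D)) \<longlongrightarrow> 0) (at s within S)"
  proof (rule tendsto_cong)
    have "norm ((1 / norm (y - s)) *\<^sub>R (f y - (f s + (y - s) *\<^sub>R D))) = norm ((f y - f s) / of_real (y - s) - D)" if "y \<noteq> s" for y
    proof -
      have ne: "complex_of_real (y - s) \<noteq> 0" using that by simp
      have "(f y - f s) / of_real (y - s) - D = (f y - (f s + of_real (y - s) * D)) / of_real (y - s)"
        using ne by (simp add: diff_divide_distrib add_divide_distrib del: of_real_diff)
      then show ?thesis by (simp add: norm_divide scaleR_conv_of_real del: of_real_diff)
    qed
    then show "\<forall>\<^sub>F y in at s within S. norm ((1 / norm (y - s)) *\<^sub>R (f y - (f s + (y - s) *\<^sub>R D))) = norm ((f y - f s) / of_real (y - s) - D)"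
      unfolding eventually_at_filter by (intro always_eventually) blast
  qed
  also have "\<dots> \<longleftrightarrow> ((\<lambda>y. (f y - f s) / of_real (y - s) - D) \<longlongrightarrow> 0) (at s within S)"
    by (rule tendsto_norm_zero_iff)
  also have "\<dots> \<longleftrightarrow> ((\<lambda>y. (f y - f s) / of_real (y - s)) \<longlongrightarrow> D) (at s within S)"
    by (rule Lim_null[symmetric])
  finally show ?thesis .
qed

lemma vector_derivative_bound:
  fixes f :: "real \<Rightarrow> complex"
  assumes "convex S" "\<And>x. x \<in> S \<Longrightarrow> (f has_vector_derivative f' x) (at x within S)"
    and "\<And>x. x \<in> S \<Longrightarrow> norm (f' x) \<le> B" "x \<in> S" "y \<in> S"
  shows "norm (f x - f y) \<le> B * norm (x - y)"
proof (rule differentiable_bound[OF assms(1) _ _ assms(4,5)])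
  show "(f has_derivative (\<lambda>h. h *\<^sub>R f' x)) (at x within S)" if "x \<in> S" for x
    using assms(2)[OF that] by (simp add: has_vector_derivative_def)
  show "onorm (\<lambda>h. h *\<^sub>R f' x) \<le> B" if "x \<in> S" for x
    using assms(3)[OF that] by (intro onorm_le) (simp, metis abs_ge_zero mult.commute mult_left_mono)
qed

text \<open>Convexity of \<open>S\<close> lets the mean value inequality turn the bound on
  \<open>F'\<close> into a majorant of all difference quotients. Derivatives within \<open>S\<close>
  include the end points of an interval.\<close>

lemma has_vector_derivative_lebesgue_integral:
  fixes F F' :: "real \<Rightarrow> 'a \<Rightarrow> complex"
  assumes S: "convex S" and int: "\<And>s. s \<in> S \<Longrightarrow> integrable \<mu> (F s)"
    and deriv: "\<And>s Q. s \<in> S \<Longrightarrow> ((\<lambda>s. F s Q) has_vector_derivative F' s Q) (at s within S)"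
    and bound: "\<And>s Q. s \<in> S \<Longrightarrow> norm (F' s Q) \<le> w Q" and w: "integrable \<mu> w" and s: "s \<in> S"
    and meas: "F' s \<in> borel_measurable \<mu>"
  shows "((\<lambda>s. \<integral>Q. F s Q \<partial>\<mu>) has_vector_derivative (\<integral>Q. F' s Q \<partial>\<mu>)) (at s within S)"
  unfolding has_vector_derivative_quotient_iff tendsto_at_iff_sequentially
proof (intro allI impI)
  fix Y :: "nat \<Rightarrow> real" assume Y: "\<forall>i. Y i \<in> S - {s}" "Y \<longlonglongrightarrow> s"
  have eq: "((\<integral>Q. F (Y n) Q \<partial>\<mu>) - (\<integral>Q. F s Q \<partial>\<mu>)) / of_real (Y n - s) = (\<integral>Q. (F (Y n) Q - F s Q) / of_real (Y n - s) \<partial>\<mu>)" for n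
    using Y s int by simp
  have "(\<lambda>n. \<integral>Q. (F (Y n) Q - F s Q) / of_real (Y n - s) \<partial>\<mu>) \<longlonglongrightarrow> (\<integral>Q. F' s Q \<partial>\<mu>)"
  proof (rule integral_dominated_convergence[where w = w])
    show "(\<lambda>Q. (F (Y n) Q - F s Q) / of_real (Y n - s)) \<in> borel_measurable \<mu>" for n
      using int[of "Y n"] int[OF s] Y by (intro borel_measurable_divide borel_measurable_diff borel_measurable_const) auto
    show "AE Q in \<mu>. (\<lambda>n. (F (Y n) Q - F s Q) / of_real (Y n - s)) \<longlonglongrightarrow> F' s Q"
      using deriv[OF s] Y unfolding has_vector_derivative_quotient_iff tendsto_at_iff_sequentially
      by (auto simp: o_def)
    show "AE Q in \<mu>. norm ((F (Y n) Q - F s Q) / of_real (Y n - s)) \<le> w Q" for n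
    proof (intro AE_I2)
      fix Q
      have "norm (F (Y n) Q - F s Q) \<le> w Q * norm (Y n - s)"
        by (rule vector_derivative_bound[OF S deriv bound]) (use Y s in auto)
      then show "norm ((F (Y n) Q - F s Q) / of_real (Y n - s)) \<le> w Q"
        using Y by (auto simp: norm_divide divide_le_eq simp del: of_real_diff)
    qed
  qed (use w meas in auto)
  then show "((\<lambda>y. ((\<integral>Q. F y Q \<partial>\<mu>) - (\<integral>Q. F s Q \<partial>\<mu>)) / of_real (y - s)) \<circ> Y) \<longlonglongrightarrow> (\<integral>Q. F' s Q \<partial>\<mu>)"
    by (simp add: o_def eq del: of_real_diff)
qed

section \<open>Characters damped by Gaussians\<close>

definition gauss :: "real \<Rightarrow> int \<Rightarrow> real \<Rightarrow> complex" where
  "gauss \<epsilon> n t = cis (2 * pi * of_int n * t) * of_real (exp (- \<epsilon> * t\<^sup>2))"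

definition gauss_log_deriv :: "real \<Rightarrow> int \<Rightarrow> real \<Rightarrow> complex" where
  "gauss_log_deriv \<epsilon> n t = 2 * of_real pi * \<i> * of_int n - 2 * of_real \<epsilon> * of_real t"

lemma gauss_alt: "gauss \<epsilon> n t = exp (2 * of_real pi * \<i> * of_int n * of_real t - of_real \<epsilon> * (of_real t)\<^sup>2)"
  by (simp add: gauss_def exp_diff cis_conv_exp exp_of_real[symmetric] exp_minus divide_inverse mult_ac)

lemma gauss_deriv: "(gauss \<epsilon> n has_vector_derivative gauss_log_deriv \<epsilon> n t * gauss \<epsilon> n t) (at t)"
proof -
  have "((\<lambda>t::complex. exp (2 * of_real pi * \<i> * of_int n * t - of_real \<epsilon> * t\<^sup>2)) has_field_derivative
     (2 * of_real pi * \<i> * of_int n - 2 * of_real \<epsilon> * t) * exp (2 * of_real pi * \<i> * of_int n * t - of_real \<epsilon> * t\<^sup>2)) (at t)" for t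
    by (auto intro!: derivative_eq_intros simp: algebra_simps)
  from has_vector_derivative_real_field[OF this, of t] show ?thesis
    by (simp add: gauss_alt[abs_def] gauss_log_deriv_def)
qed

lemma gauss_deriv2:
  "((\<lambda>t. gauss_log_deriv \<epsilon> n t * gauss \<epsilon> n t) has_vector_derivative
     ((gauss_log_deriv \<epsilon> n t)\<^sup>2 - 2 * of_real \<epsilon>) * gauss \<epsilon> n t) (at t)"
proof -
  have "(gauss_log_deriv \<epsilon> n has_vector_derivative (- 2 * of_real \<epsilon>)) (at t)"
    unfolding gauss_log_deriv_def by (auto intro!: derivative_eq_intros)
  from has_vector_derivative_mult[OF this gauss_deriv] show ?thesis
    by (rule has_vector_derivative_eq_rhs) (simp add: power2_eq_square algebra_simps)
qed

lemma norm_gauss: "norm (gauss \<epsilon> n t) = exp (- \<epsilon> * t\<^sup>2)"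
  by (simp add: gauss_def norm_mult)

lemma norm_gauss_log_deriv:
  "norm (gauss_log_deriv \<epsilon> n t) \<le> (2 * pi * \<bar>of_int n\<bar> + 2 * \<bar>\<epsilon>\<bar>) * (1 + \<bar>t\<bar>)"
proof -
  have "norm (gauss_log_deriv \<epsilon> n t) \<le> 2 * pi * \<bar>of_int n\<bar> + 2 * \<bar>\<epsilon>\<bar> * \<bar>t\<bar>"
    unfolding gauss_log_deriv_def by (rule order_trans[OF norm_triangle_ineq4]) (simp add: norm_mult)
  also have "\<dots> \<le> (2 * pi * \<bar>of_int n\<bar> + 2 * \<bar>\<epsilon>\<bar>) * (1 + \<bar>t\<bar>)"
    by (simp add: algebra_simps)
  finally show ?thesis .
qed

lemma gauss_continuous:
  "continuous_on UNIV (gauss \<epsilon> n)" "continuous_on UNIV (gauss_log_deriv \<epsilon> n)"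
  unfolding gauss_def[abs_def] gauss_log_deriv_def[abs_def] by (intro continuous_intros)+

lemma rapid_gauss:
  assumes "\<epsilon> > 0"
  shows "rapid (gauss \<epsilon> n)" "rapid (\<lambda>t. gauss_log_deriv \<epsilon> n t * gauss \<epsilon> n t)"
    "rapid (\<lambda>t. ((gauss_log_deriv \<epsilon> n t)\<^sup>2 - 2 * of_real \<epsilon>) * gauss \<epsilon> n t)"
proof -
  show 1: "rapid (gauss \<epsilon> n)"
    using rapid_Gaussian[OF assms, of "2 * pi * of_int n"] by (simp add: gauss_def[abs_def])
  define D where "D = 2 * pi * \<bar>of_int n\<bar> + 2 * \<bar>\<epsilon>\<bar>"
  have D: "norm (gauss_log_deriv \<epsilon> n t) \<le> D * (1 + \<bar>t\<bar>)" for t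
    unfolding D_def by (rule norm_gauss_log_deriv)
  show "rapid (\<lambda>t. gauss_log_deriv \<epsilon> n t * gauss \<epsilon> n t)"
    by (rule rapidI_mult[OF 1, of _ D 1]) (use D in simp)
  have "norm ((gauss_log_deriv \<epsilon> n t)\<^sup>2 - 2 * of_real \<epsilon>) \<le> (D\<^sup>2 + 2 * \<epsilon>) * (1 + \<bar>t\<bar>)\<^sup>2" for t
  proof -
    have "norm ((gauss_log_deriv \<epsilon> n t)\<^sup>2 - 2 * of_real \<epsilon>) \<le> (norm (gauss_log_deriv \<epsilon> n t))\<^sup>2 + 2 * \<epsilon>"
      by (rule order_trans[OF norm_triangle_ineq4]) (use assms in \<open>simp add: norm_power norm_mult\<close>)
    also have "\<dots> \<le> (D * (1 + \<bar>t\<bar>))\<^sup>2 + 2 * \<epsilon> * (1 + \<bar>t\<bar>)\<^sup>2"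
      using assms one_le_power[of "1 + \<bar>t\<bar>" 2] by (intro add_mono power_mono D) auto
    finally show ?thesis by (simp add: power_mult_distrib distrib_right)
  qed
  then show "rapid (\<lambda>t. ((gauss_log_deriv \<epsilon> n t)\<^sup>2 - 2 * of_real \<epsilon>) * gauss \<epsilon> n t)"
    by (rule rapidI_mult[OF 1])
qed

text \<open>In the scaled variable u = sqrt \<epsilon> |t| these are u <= exp (u^2) and u^2 <= exp
  (u^2). The first moment therefore leaves the factor sqrt \<epsilon> by which the effect of the
  damping disappears.\<close>

lemma gauss_moments:
  assumes "\<epsilon> > 0"
  shows "\<epsilon> * \<bar>t\<bar> * exp (- \<epsilon> * t\<^sup>2) \<le> sqrt \<epsilon>" "\<epsilon> * t\<^sup>2 * exp (- \<epsilon> * t\<^sup>2) \<le> 1"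
proof -
  have e: "x \<le> exp x" for x :: real using exp_ge_add_one_self[of x] by linarith
  show 2: "\<epsilon> * t\<^sup>2 * exp (- \<epsilon> * t\<^sup>2) \<le> 1"
    using e[of "\<epsilon> * t\<^sup>2"] by (simp add: exp_minus field_simps)
  define u where "u = sqrt \<epsilon> * \<bar>t\<bar>"
  have u: "u\<^sup>2 = \<epsilon> * t\<^sup>2" using assms by (simp add: u_def power_mult_distrib)
  have "u \<le> exp (u\<^sup>2)"
  proof (cases "u \<le> 1")
    case True
    also have "1 \<le> exp (u\<^sup>2)" by simp
    finally show ?thesis .
  next
    case False
    then have "u \<le> u\<^sup>2" by (simp add: power2_eq_square)
    then show ?thesis using e[of "u\<^sup>2"] by linarith
  qed
  then have "u * exp (- \<epsilon> * t\<^sup>2) \<le> 1" using u by (simp add: exp_minus field_simps)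
  then have "sqrt \<epsilon> * (u * exp (- \<epsilon> * t\<^sup>2)) \<le> sqrt \<epsilon> * 1" using assms by (intro mult_left_mono) auto
  moreover have "sqrt \<epsilon> * u = \<epsilon> * \<bar>t\<bar>" using assms by (simp add: u_def flip: mult.assoc)
  ultimately show "\<epsilon> * \<bar>t\<bar> * exp (- \<epsilon> * t\<^sup>2) \<le> sqrt \<epsilon>" by (simp add: mult.assoc[symmetric])
qed

text \<open>The wave operator applied to the regularised character \<open>gauss \<epsilon> p \<otimes> gauss \<epsilon> q \<otimes> gauss \<epsilon> r\<close>, with the
  contribution of the character itself removed.\<close>

lemma gauss_box_bound:
  assumes \<epsilon>: "\<epsilon> > 0" "\<epsilon> \<le> 1"
  defines "u \<equiv> gauss_log_deriv \<epsilon>"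
  shows "norm ((((u q b)\<^sup>2 - 2 * of_real \<epsilon>) - u p a * u r c + 4 * of_real pi ^ 2 * of_int (q\<^sup>2 - p * r))
      * (gauss \<epsilon> p a * gauss \<epsilon> q b * gauss \<epsilon> r c))
    \<le> (8 * pi * \<bar>of_int q\<bar> + 4 * pi * \<bar>of_int p\<bar> + 4 * pi * \<bar>of_int r\<bar> + 10) * sqrt \<epsilon>"
proof -
  define E where "E t = exp (- \<epsilon> * t\<^sup>2)" for t
  have E: "0 \<le> E t" "E t \<le> 1" for t using \<epsilon> by (auto simp: E_def)
  have m1: "\<epsilon> * \<bar>t\<bar> * E t \<le> sqrt \<epsilon>" and m2: "\<epsilon> * t\<^sup>2 * E t \<le> 1" for t
    unfolding E_def using gauss_moments[OF \<epsilon>(1)] by auto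
  have se: "\<epsilon> \<le> sqrt \<epsilon>"
    using \<epsilon> real_sqrt_le_mono[of \<epsilon> 1] mult_left_mono[of "sqrt \<epsilon>" 1 "sqrt \<epsilon>"] by simp
  \<comment> \<open>The products of the frequencies alone cancel against the last summand on the
    left; every surviving term carries a factor \<epsilon>.\<close>
  have eq: "((u q b)\<^sup>2 - 2 * of_real \<epsilon>) - u p a * u r c + 4 * of_real pi ^ 2 * of_int (q\<^sup>2 - p * r)
    = - (8 * of_real pi * \<i> * of_int q * of_real \<epsilon> * of_real b) + 4 * of_real \<epsilon> ^ 2 * of_real b ^ 2 - 2 * of_real \<epsilon>
      + 4 * of_real pi * \<i> * of_int p * of_real \<epsilon> * of_real c + 4 * of_real pi * \<i> * of_int r * of_real \<epsilon> * of_real a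
      - 4 * of_real \<epsilon> ^ 2 * of_real a * of_real c" (is "_ = ?R")
    unfolding u_def gauss_log_deriv_def by (simp add: power2_eq_square algebra_simps)
  have "norm ?R \<le> norm (8 * of_real pi * \<i> * of_int q * of_real \<epsilon> * of_real b :: complex)
      + norm (4 * of_real \<epsilon> ^ 2 * of_real b ^ 2 :: complex) + norm (2 * of_real \<epsilon> :: complex)
      + norm (4 * of_real pi * \<i> * of_int p * of_real \<epsilon> * of_real c :: complex)
      + norm (4 * of_real pi * \<i> * of_int r * of_real \<epsilon> * of_real a :: complex)
      + norm (4 * of_real \<epsilon> ^ 2 * of_real a * of_real c :: complex)"
    by (intro order_trans[OF norm_triangle_ineq4] order_trans[OF norm_triangle_ineq] add_mono order_refl) simp
  also have "\<dots> = 8 * pi * \<bar>of_int q\<bar> * (\<epsilon> * \<bar>b\<bar>) + 4 * \<epsilon> * (\<epsilon> * b\<^sup>2) + 2 * \<epsilon> + 4 * pi * \<bar>of_int p\<bar> * (\<epsilon> * \<bar>c\<bar>)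
     + 4 * pi * \<bar>of_int r\<bar> * (\<epsilon> * \<bar>a\<bar>) + 4 * (\<epsilon> * \<bar>a\<bar>) * (\<epsilon> * \<bar>c\<bar>)"
    using \<epsilon> by (simp add: norm_mult norm_power power2_eq_square)
  finally have nR: "norm ?R \<le> \<dots>" .
  have "norm (?R * (gauss \<epsilon> p a * gauss \<epsilon> q b * gauss \<epsilon> r c)) = norm ?R * (E a * E b * E c)"
    by (simp add: norm_mult norm_gauss E_def del: norm_of_real)
  also have "\<dots> \<le> (8 * pi * \<bar>of_int q\<bar> * (\<epsilon> * \<bar>b\<bar>) + 4 * \<epsilon> * (\<epsilon> * b\<^sup>2) + 2 * \<epsilon> + 4 * pi * \<bar>of_int p\<bar> * (\<epsilon> * \<bar>c\<bar>)
     + 4 * pi * \<bar>of_int r\<bar> * (\<epsilon> * \<bar>a\<bar>) + 4 * (\<epsilon> * \<bar>a\<bar>) * (\<epsilon> * \<bar>c\<bar>)) * (E a * E b * E c)"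
    by (intro mult_right_mono nR mult_nonneg_nonneg E)
  also have "\<dots> = 8 * pi * \<bar>of_int q\<bar> * (\<epsilon> * \<bar>b\<bar> * E b * (E a * E c)) + 4 * \<epsilon> * (\<epsilon> * b\<^sup>2 * E b * (E a * E c))
     + 2 * \<epsilon> * (E a * E b * E c) + 4 * pi * \<bar>of_int p\<bar> * (\<epsilon> * \<bar>c\<bar> * E c * (E a * E b))
     + 4 * pi * \<bar>of_int r\<bar> * (\<epsilon> * \<bar>a\<bar> * E a * (E b * E c)) + 4 * ((\<epsilon> * \<bar>a\<bar> * E a) * (\<epsilon> * \<bar>c\<bar> * E c) * E b)"
    by (simp add: algebra_simps)
  also have "\<dots> \<le> 8 * pi * \<bar>of_int q\<bar> * (sqrt \<epsilon> * (1 * 1)) + 4 * \<epsilon> * (1 * (1 * 1))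
     + 2 * \<epsilon> * (1 * 1 * 1) + 4 * pi * \<bar>of_int p\<bar> * (sqrt \<epsilon> * (1 * 1))
     + 4 * pi * \<bar>of_int r\<bar> * (sqrt \<epsilon> * (1 * 1)) + 4 * (sqrt \<epsilon> * sqrt \<epsilon> * 1)"
    using \<epsilon>(1) E by (intro add_mono mult_left_mono mult_mono m1 m2 E mult_nonneg_nonneg) auto
  \<comment> \<open>The terms without a frequency have coefficients 4 + 2 + 4 = 10.\<close>
  also have "\<dots> = (8 * pi * \<bar>of_int q\<bar> + 4 * pi * \<bar>of_int p\<bar> + 4 * pi * \<bar>of_int r\<bar>) * sqrt \<epsilon> + 10 * \<epsilon>"
    using \<epsilon> by (simp add: algebra_simps)
  also have "\<dots> \<le> (8 * pi * \<bar>of_int q\<bar> + 4 * pi * \<bar>of_int p\<bar> + 4 * pi * \<bar>of_int r\<bar> + 10) * sqrt \<epsilon>"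
    using se by (simp add: distrib_right)
  finally show ?thesis unfolding eq .
qed

section \<open>The kernel and its wave equation\<close>

text \<open>The cut-off is explicit because \<open>powr\<close> is nonzero at negative bases. The
  value 0 at 0 holds for every exponent, so \<open>pos_powr_minus_one\<close> needs no side
  condition.\<close>

definition pos_powr :: "real \<Rightarrow> real \<Rightarrow> real" where
  "pos_powr \<beta> t = (if t > 0 then t powr \<beta> else 0)"

lemma pos_powr_measurable [measurable]: "pos_powr \<beta> \<in> borel_measurable borel"
  unfolding pos_powr_def by measurable

lemma pos_powr_eq_0 [simp]: "t \<le> 0 \<Longrightarrow> pos_powr \<beta> t = 0"
  by (simp add: pos_powr_def)

lemma pos_powr_nonneg [simp]: "pos_powr \<beta> t \<ge> 0"
  by (simp add: pos_powr_def)

lemma pos_powr_minus_one: "t * pos_powr (\<beta> - 1) t = pos_powr \<beta> t"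
  by (simp add: pos_powr_def powr_diff)

lemma continuous_on_pos_powr:
  assumes "\<beta> > 0"
  shows "continuous_on UNIV (pos_powr \<beta>)"
proof -
  have "continuous_on UNIV (\<lambda>t::real. max t 0 powr \<beta>)"
    using assms by (intro continuous_on_powr' continuous_intros) auto
  moreover have "(\<lambda>t. max t 0 powr \<beta>) = pos_powr \<beta>" by (auto simp: pos_powr_def max_def)
  ultimately show ?thesis by (simp only:)
qed

text \<open>At 0 the difference quotient is \<open>pos_powr (\<beta> - 1)\<close> itself, which is
  continuous and vanishes there as soon as \<beta> > 1.\<close>

lemma pos_powr_has_derivative:
  assumes "\<beta> > 1"
  shows "(pos_powr \<beta> has_real_derivative \<beta> * pos_powr (\<beta> - 1) t) (at t)"
proof -
  consider "t > 0" | "t < 0" | "t = 0" by linarith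
  then show ?thesis
  proof cases
    case 1
    have "((\<lambda>t. t powr \<beta>) has_real_derivative \<beta> * t powr (\<beta> - 1)) (at t)"
      using 1 by (rule has_real_derivative_powr)
    then have "(pos_powr \<beta> has_real_derivative \<beta> * t powr (\<beta> - 1)) (at t)"
      by (rule has_field_derivative_transform_within_open[where S = "{0<..}"])
         (use 1 in \<open>auto simp: pos_powr_def\<close>)
    then show ?thesis using 1 by (simp add: pos_powr_def)
  next
    case 2
    have "((\<lambda>t. 0) has_real_derivative 0) (at t)" by simp
    then have "(pos_powr \<beta> has_real_derivative 0) (at t)"
      by (rule has_field_derivative_transform_within_open[where S = "{..<0}"])
         (use 2 in \<open>auto simp: pos_powr_def\<close>)
    then show ?thesis using 2 by simp
  next
    case 3
    have "isCont (pos_powr (\<beta> - 1)) 0"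
      using continuous_on_pos_powr[of "\<beta> - 1"] assms by (simp add: continuous_on_eq_continuous_at)
    then have "((\<lambda>h. pos_powr (\<beta> - 1) h) \<longlongrightarrow> pos_powr (\<beta> - 1) 0) (at 0)"
      unfolding isCont_def .
    moreover have "\<forall>\<^sub>F h in at 0. pos_powr (\<beta> - 1) h = (pos_powr \<beta> (0 + h) - pos_powr \<beta> 0) / h"
      by (auto simp: eventually_at_filter pos_powr_def powr_diff)
    ultimately have "((\<lambda>h. (pos_powr \<beta> (0 + h) - pos_powr \<beta> 0) / h) \<longlongrightarrow> 0) (at 0)"
      using tendsto_cong by force
    then show ?thesis using 3 by (simp add: DERIV_def)
  qed
qed

text \<open>Where \<open>d t < 0\<close> the function is locally zero, so zeros of \<open>m\<close>
  are harmless there and \<open>m t \<noteq> 0\<close> is asked for only when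
  \<open>d t \<ge> 0\<close>. The derivative is again a combination of functions
  \<open>F\<close>.\<close>

lemma product_line_deriv:
  fixes d :: "real \<Rightarrow> real" and m :: "real \<Rightarrow> complex" and l :: complex
  assumes "\<beta> > 1" and d: "(d has_real_derivative d') (at t)"
    and m: "(m has_vector_derivative m') (at t)" and nz: "d t \<ge> 0 \<Longrightarrow> m t \<noteq> 0"
  defines "F \<equiv> \<lambda>\<beta> n t. of_real (pos_powr \<beta> (d t)) * inverse (m t ^ n) * exp (l * of_real (d t))"
  shows "(F \<beta> n has_vector_derivative
     of_real (\<beta> * d') * F (\<beta> - 1) n t - of_nat n * m' * F \<beta> (Suc n) t + l * of_real d' * F \<beta> n t) (at t)"
proof (cases "d t < 0")
  case True
  have "isCont d t" using d by (rule DERIV_isCont)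
  then have "(d \<longlongrightarrow> d t) (nhds t)" by (simp add: isCont_def tendsto_at_iff_tendsto_nhds)
  then have "\<forall>\<^sub>F s in nhds t. d s < 0" using True by (rule order_tendstoD(2))
  then obtain S where S: "open S" "t \<in> S" "\<And>s. s \<in> S \<Longrightarrow> d s < 0"
    unfolding eventually_nhds by blast
  have "((\<lambda>s. 0) has_vector_derivative 0) (at t)" by simp
  then have "(F \<beta> n has_vector_derivative 0) (at t)"
    by (rule has_vector_derivative_transform_within_open[OF _ S(1,2)]) (use S(3) in \<open>simp add: F_def less_imp_le\<close>)
  then show ?thesis using True by (simp add: F_def)
next
  case False
  then have nz: "m t \<noteq> 0" using nz by simp
  have 1: "((\<lambda>t. of_real (pos_powr \<beta> (d t)) :: complex) has_vector_derivative
      of_real (\<beta> * pos_powr (\<beta> - 1) (d t) * d')) (at t)"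
    by (intro has_vector_derivative_of_real DERIV_chain2[OF pos_powr_has_derivative[OF assms(1)] d])
  have 2: "((\<lambda>t. inverse (m t ^ n)) has_vector_derivative (m' * (- of_nat n * inverse (m t ^ Suc n)))) (at t)"
  proof -
    have "((\<lambda>w. inverse (w ^ n)) has_field_derivative (- of_nat n * inverse (m t ^ Suc n))) (at (m t))"
    proof -
      have "((\<lambda>w. inverse (w ^ n)) has_field_derivative
          - (inverse (m t ^ n) * (of_nat n * (1 * m t ^ (n - Suc 0))) * inverse (m t ^ n))) (at (m t))"
        by (rule DERIV_inverse'[OF DERIV_power[OF DERIV_ident]]) (use nz in simp)
      moreover have "- (inverse (m t ^ n) * (of_nat n * (1 * m t ^ (n - Suc 0))) * inverse (m t ^ n))
          = - of_nat n * inverse (m t ^ Suc n)"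
        by (cases n) (use nz in \<open>simp_all add: field_simps\<close>)
      ultimately show ?thesis by metis
    qed
    from field_vector_diff_chain_at[OF m this] show ?thesis by (simp add: o_def)
  qed
  have 3: "((\<lambda>t. exp (l * of_real (d t))) has_vector_derivative (l * of_real d' * exp (l * of_real (d t)))) (at t)"
  proof -
    have "((\<lambda>t. l * of_real (d t)) has_vector_derivative l * of_real d') (at t)"
      using d by (intro has_vector_derivative_mult_right has_vector_derivative_of_real)
    from field_vector_diff_chain_at[OF this DERIV_exp] show ?thesis by (simp add: o_def)
  qed
  show ?thesis unfolding F_def
    by (rule has_vector_derivative_eq_rhs[OF has_vector_derivative_mult[OF has_vector_derivative_mult[OF 1 2] 3]])
       (simp add: algebra_simps)
qed

definition disc :: "vec3 \<Rightarrow> real" where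
  "disc = (\<lambda>(a, b, c). b\<^sup>2 - 4 * a * c)"

locale form_kernel =
  fixes z :: complex and k :: nat
  assumes Im_z: "Im z > 0" and k_ge: "k \<ge> 4"
begin

definition \<alpha> :: real where "\<alpha> = real k - 1 / 2"

definition M :: "vec3 \<Rightarrow> complex" where
  "M = (\<lambda>(a, b, c). of_real a * z\<^sup>2 + of_real b * z + of_real c)"

text \<open>This is Im z times Q_z; dropping the division rescales all sums by the constant
  \<open>Im z\<close>, which reappears in \<open>K_lat\<close>.\<close>

definition L :: "vec3 \<Rightarrow> real" where
  "L = (\<lambda>(a, b, c). a * (cmod z)\<^sup>2 + b * Re z + c)"

text \<open>A family closed under partial differentiation up to polynomial coefficients: a
  derivative lowers \<beta>, raises \<open>n\<close>, or brings down \<open>l\<close>.\<close>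

definition T :: "complex \<Rightarrow> real \<Rightarrow> nat \<Rightarrow> vec3 \<Rightarrow> complex" where
  "T l \<beta> n Q = of_real (pos_powr \<beta> (disc Q)) * inverse (M Q ^ n) * exp (l * of_real (disc Q))"

definition K :: "complex \<Rightarrow> vec3 \<Rightarrow> complex" where
  "K l Q = of_real (L Q) * T l \<alpha> (Suc k) Q"

lemma disc_continuous: "continuous_on UNIV disc"
  unfolding disc_def case_prod_unfold by (intro continuous_intros)

lemma M_continuous: "continuous_on UNIV M"
  unfolding M_def case_prod_unfold by (intro continuous_intros)

lemma L_continuous: "continuous_on UNIV L"
  unfolding L_def case_prod_unfold by (intro continuous_intros)

lemmas disc_measurable = borel_measurable_continuous_onI[OF disc_continuous]
lemmas M_measurable = borel_measurable_continuous_onI[OF M_continuous]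
lemmas L_measurable = borel_measurable_continuous_onI[OF L_continuous]

lemma T_measurable [measurable]: "T l \<beta> n \<in> borel_measurable borel"
proof -
  have "(\<lambda>Q. complex_of_real (pos_powr \<beta> (disc Q))) \<in> borel_measurable borel"
    by (rule borel_measurable_continuous_on[where f = complex_of_real])
       (intro continuous_intros measurable_compose[OF disc_measurable pos_powr_measurable])+
  moreover have "(\<lambda>Q. inverse (M Q ^ n)) \<in> borel_measurable borel"
    by (intro borel_measurable_inverse borel_measurable_power M_measurable)
  moreover have "(\<lambda>Q. exp (l * of_real (disc Q))) \<in> borel_measurable borel"
    by (intro borel_measurable_continuous_onI continuous_intros disc_continuous)
  ultimately show ?thesis unfolding T_def[abs_def] by (intro borel_measurable_times)
qed

text \<open>The identity behind all size estimates: on nonnegative discriminants it bounds both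
  \<open>L\<close> and \<open>disc\<close> by \<open>M\<close>.\<close>

lemma norm_M: "(cmod (M Q))\<^sup>2 = (Im z)\<^sup>2 * disc Q + (L Q)\<^sup>2"
proof -
  obtain a b c where Q: "Q = (a, b, c)" by (metis prod_cases3)
  show ?thesis
    unfolding Q M_def L_def disc_def cmod_power2
    by (simp add: power2_eq_square) (simp add: algebra_simps)
qed

lemma L_le_M: "disc Q \<ge> 0 \<Longrightarrow> \<bar>L Q\<bar> \<le> cmod (M Q)"
  using norm_M[of Q] by (intro abs_le_square_iff[THEN iffD2, of "L Q" "cmod (M Q)", simplified]) simp

lemma disc_le_M: "disc Q \<le> (cmod (M Q))\<^sup>2 / (Im z)\<^sup>2"
  using norm_M[of Q] Im_z by (simp add: field_simps)

text \<open>The sum of 1 and the three separate constants that \<open>coeff_bounds\<close> finds for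
  a, b and c.\<close>

definition Cz :: real where
  "Cz = 1 + 1 / (Im z)\<^sup>2 + (1 / Im z + 2 * \<bar>Re z\<bar> / (Im z)\<^sup>2)
     + (1 + (cmod z)\<^sup>2 / (Im z)\<^sup>2 + (1 / Im z + 2 * \<bar>Re z\<bar> / (Im z)\<^sup>2) * \<bar>Re z\<bar>)"

text \<open>The form can be recovered from its values: with x = Re z and y = Im z, L - Re M = 2 a
  y^2 bounds a, Im M = (2 a x + b) y then bounds b, and \<open>L\<close> bounds c.\<close>

lemma coeff_bounds:
  assumes "disc (a, b, c) \<ge> 0"
  defines "N \<equiv> cmod (M (a, b, c))"
  shows "\<bar>a\<bar> \<le> Cz * N" "\<bar>b\<bar> \<le> Cz * N" "\<bar>c\<bar> \<le> Cz * N"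
proof -
  define x y where "x = Re z" and "y = Im z"
  have y: "y > 0" using Im_z by (simp add: y_def)
  have N: "N \<ge> 0" by (simp add: N_def)
  have l: "\<bar>L (a, b, c)\<bar> \<le> N" unfolding N_def using L_le_M[OF assms(1)] .
  have z2: "(cmod z)\<^sup>2 = x\<^sup>2 + y\<^sup>2" by (simp add: cmod_power2 x_def y_def)
  have re: "\<bar>a * (x\<^sup>2 - y\<^sup>2) + b * x + c\<bar> \<le> N"
    using abs_Re_le_cmod[of "M (a, b, c)"] unfolding N_def
    by (simp add: M_def x_def y_def power2_eq_square)
  have im: "\<bar>(2 * a * x + b) * y\<bar> \<le> N"
    using abs_Im_le_cmod[of "M (a, b, c)"] unfolding N_def
    by (simp add: M_def x_def y_def power2_eq_square algebra_simps)
  have "\<bar>2 * (a * y\<^sup>2)\<bar> \<le> 2 * N"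
    using l re unfolding L_def z2 by (simp add: algebra_simps x_def[symmetric])
  then have a: "\<bar>a\<bar> \<le> N / y\<^sup>2" using y by (simp add: abs_mult field_simps)
  have "\<bar>2 * a * x + b\<bar> * y \<le> N" using im y by (simp only: abs_mult abs_of_pos)
  then have "\<bar>2 * a * x + b\<bar> \<le> N / y" using y by (simp add: pos_le_divide_eq)
  moreover have "\<bar>2 * a * x\<bar> \<le> 2 * \<bar>x\<bar> * (N / y\<^sup>2)"
    using mult_left_mono[OF a, of "2 * \<bar>x\<bar>"] by (simp add: abs_mult mult_ac)
  ultimately have b: "\<bar>b\<bar> \<le> N / y + 2 * \<bar>x\<bar> * (N / y\<^sup>2)" by linarith
  have "\<bar>a * (cmod z)\<^sup>2\<bar> \<le> N / y\<^sup>2 * (cmod z)\<^sup>2"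
    using mult_right_mono[OF a, of "(cmod z)\<^sup>2"] by (simp add: abs_mult)
  moreover have "\<bar>b * x\<bar> \<le> (N / y + 2 * \<bar>x\<bar> * (N / y\<^sup>2)) * \<bar>x\<bar>"
    using mult_right_mono[OF b, of "\<bar>x\<bar>"] by (simp add: abs_mult)
  ultimately have c: "\<bar>c\<bar> \<le> N + N / y\<^sup>2 * (cmod z)\<^sup>2 + (N / y + 2 * \<bar>x\<bar> * (N / y\<^sup>2)) * \<bar>x\<bar>"
    using l unfolding L_def x_def[symmetric] by (simp add: x_def[symmetric] abs_le_iff)
  have nn: "0 \<le> 1 / y\<^sup>2" "0 \<le> 1 / y + 2 * \<bar>x\<bar> / y\<^sup>2"
    "0 \<le> 1 + (cmod z)\<^sup>2 / y\<^sup>2 + (1 / y + 2 * \<bar>x\<bar> / y\<^sup>2) * \<bar>x\<bar>"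
    using y by simp_all
  have Cz: "Cz = 1 + 1 / y\<^sup>2 + (1 / y + 2 * \<bar>x\<bar> / y\<^sup>2)
     + (1 + (cmod z)\<^sup>2 / y\<^sup>2 + (1 / y + 2 * \<bar>x\<bar> / y\<^sup>2) * \<bar>x\<bar>)"
    by (simp add: Cz_def x_def y_def)
  have "1 / y\<^sup>2 \<le> Cz" "1 / y + 2 * \<bar>x\<bar> / y\<^sup>2 \<le> Cz"
    "1 + (cmod z)\<^sup>2 / y\<^sup>2 + (1 / y + 2 * \<bar>x\<bar> / y\<^sup>2) * \<bar>x\<bar> \<le> Cz"
    unfolding Cz using nn by linarith+
  from this[THEN mult_right_mono, OF N]
  show "\<bar>a\<bar> \<le> Cz * N" "\<bar>b\<bar> \<le> Cz * N" "\<bar>c\<bar> \<le> Cz * N"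
    using a b c by (simp_all add: algebra_simps)
qed

lemma Cz_pos: "Cz > 0"
  using Im_z unfolding Cz_def by (intro add_pos_nonneg) (auto intro!: add_nonneg_nonneg mult_nonneg_nonneg)

lemma M_nonzero: "disc Q \<ge> 0 \<Longrightarrow> Q \<noteq> 0 \<Longrightarrow> M Q \<noteq> 0"
  using coeff_bounds by (cases Q) (fastforce simp: zero_prod_def)

text \<open>The functions \<open>T l \<beta> n\<close> are singular at the origin when \<open>2 * \<beta> < n\<close>; the grading records that all
  products of them with coefficients that occur in the second derivatives of \<open>K\<close> stay bounded there.\<close>

definition graded :: "real \<Rightarrow> (vec3 \<Rightarrow> complex) \<Rightarrow> bool" where
  "graded e F \<longleftrightarrow> (\<exists>C N. \<forall>Q. disc Q > 0 \<longrightarrow> norm (F Q) \<le> C * (cmod (M Q) powr e * (1 + cmod (M Q)) ^ N))"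

lemma gradedI: "(\<And>Q. disc Q > 0 \<Longrightarrow> norm (F Q) \<le> C * (cmod (M Q) powr e * (1 + cmod (M Q)) ^ N)) \<Longrightarrow> graded e F"
  unfolding graded_def by blast

lemma gradedE:
  assumes "graded e F"
  obtains C N where "C \<ge> 0"
    "\<And>Q. disc Q > 0 \<Longrightarrow> norm (F Q) \<le> C * (cmod (M Q) powr e * (1 + cmod (M Q)) ^ N)"
proof -
  obtain C N where C: "\<And>Q. disc Q > 0 \<Longrightarrow> norm (F Q) \<le> C * (cmod (M Q) powr e * (1 + cmod (M Q)) ^ N)"
    using assms unfolding graded_def by blast
  have "norm (F Q) \<le> \<bar>C\<bar> * (cmod (M Q) powr e * (1 + cmod (M Q)) ^ N)" if "disc Q > 0" for Q
    by (rule order_trans[OF C[OF that]]) (intro mult_right_mono, auto)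
  then show ?thesis using that[of "\<bar>C\<bar>" N] by simp
qed

lemma M_pos: "disc Q > 0 \<Longrightarrow> cmod (M Q) > 0"
  using M_nonzero[of Q] by (cases "Q = 0") (auto simp: disc_def zero_prod_def)

lemma graded_const: "graded 0 (\<lambda>_. c)"
  by (rule gradedI[where C = "norm c" and N = 0]) (use M_pos in auto)

lemma graded_coeffs:
  "graded 1 (\<lambda>Q. of_real (fst Q))" "graded 1 (\<lambda>Q. of_real (fst (snd Q)))"
  "graded 1 (\<lambda>Q. of_real (snd (snd Q)))" "graded 1 (\<lambda>Q. of_real (L Q))"
proof -
  show "graded 1 (\<lambda>Q. of_real (fst Q))" "graded 1 (\<lambda>Q. of_real (fst (snd Q)))"
    "graded 1 (\<lambda>Q. of_real (snd (snd Q)))"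
    by (rule gradedI[where C = Cz and N = 0], use coeff_bounds M_pos in \<open>auto simp: less_imp_le\<close>)+
  show "graded 1 (\<lambda>Q. of_real (L Q))"
    by (rule gradedI[where C = 1 and N = 0]) (use L_le_M M_pos in \<open>auto simp: less_imp_le\<close>)
qed

text \<open>By \<open>disc_le_M\<close> the discriminant has order 2 in |M|, the inverse power has
  order -n, and the exponential is at most 1.\<close>

lemma graded_T:
  assumes "Re l \<le> 0" "\<beta> \<ge> 0"
  shows "graded (2 * \<beta> - real n) (T l \<beta> n)"
proof (rule gradedI[where C = "1 / (Im z) powr (2 * \<beta>)" and N = 0])
  fix Q assume D: "disc Q > 0"
  have M: "cmod (M Q) > 0" using M_pos[OF D] .
  have "disc Q powr \<beta> \<le> ((cmod (M Q))\<^sup>2 / (Im z)\<^sup>2) powr \<beta>"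
    using D disc_le_M assms by (intro powr_mono2) auto
  also have "\<dots> = cmod (M Q) powr (2 * \<beta>) / (Im z) powr (2 * \<beta>)"
    using M Im_z by (simp add: powr_divide powr_powr[symmetric] powr_numeral)
  finally have 1: "disc Q powr \<beta> \<le> cmod (M Q) powr (2 * \<beta>) / (Im z) powr (2 * \<beta>)" .
  have 2: "norm (exp (l * of_real (disc Q))) \<le> 1"
    using D assms(1) by (simp add: norm_exp_eq_Re mult_nonpos_nonneg)
  have "norm (T l \<beta> n Q) = disc Q powr \<beta> * inverse (cmod (M Q) ^ n) * norm (exp (l * of_real (disc Q)))"
    using D by (simp add: T_def norm_mult norm_inverse norm_power pos_powr_def)
  also have "\<dots> \<le> (cmod (M Q) powr (2 * \<beta>) / (Im z) powr (2 * \<beta>)) * inverse (cmod (M Q) ^ n) * 1"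
    by (intro mult_mono 1 2) auto
  also have "\<dots> = 1 / (Im z) powr (2 * \<beta>) * (cmod (M Q) powr (2 * \<beta> - real n) * (1 + cmod (M Q)) ^ 0)"
    using M by (simp add: powr_diff powr_realpow field_simps)
  finally show "norm (T l \<beta> n Q) \<le> 1 / (Im z) powr (2 * \<beta>) * (cmod (M Q) powr (2 * \<beta> - real n) * (1 + cmod (M Q)) ^ 0)" .
qed

lemma graded_mult:
  assumes "graded e F" "graded f G"
  shows "graded (e + f) (\<lambda>Q. F Q * G Q)"
proof -
  obtain C N where F: "C \<ge> 0" "\<And>Q. disc Q > 0 \<Longrightarrow> norm (F Q) \<le> C * (cmod (M Q) powr e * (1 + cmod (M Q)) ^ N)"
    using assms(1) by (rule gradedE) blast
  obtain D m where G: "D \<ge> 0" "\<And>Q. disc Q > 0 \<Longrightarrow> norm (G Q) \<le> D * (cmod (M Q) powr f * (1 + cmod (M Q)) ^ m)"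
    using assms(2) by (rule gradedE) blast
  show ?thesis
  proof (rule gradedI[where C = "C * D" and N = "N + m"])
    fix Q assume "disc Q > 0"
    then have "norm (F Q * G Q) \<le> (C * (cmod (M Q) powr e * (1 + cmod (M Q)) ^ N)) * (D * (cmod (M Q) powr f * (1 + cmod (M Q)) ^ m))"
      unfolding norm_mult using F G by (intro mult_mono) auto
    then show "norm (F Q * G Q) \<le> C * D * (cmod (M Q) powr (e + f) * (1 + cmod (M Q)) ^ (N + m))"
      by (simp add: powr_add power_add mult_ac)
  qed
qed

lemma graded_add:
  assumes "graded e F" "graded e G"
  shows "graded e (\<lambda>Q. F Q + G Q)"
proof -
  obtain C N where F: "C \<ge> 0" "\<And>Q. disc Q > 0 \<Longrightarrow> norm (F Q) \<le> C * (cmod (M Q) powr e * (1 + cmod (M Q)) ^ N)"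
    using assms(1) by (rule gradedE) blast
  obtain D m where G: "D \<ge> 0" "\<And>Q. disc Q > 0 \<Longrightarrow> norm (G Q) \<le> D * (cmod (M Q) powr e * (1 + cmod (M Q)) ^ m)"
    using assms(2) by (rule gradedE) blast
  show ?thesis
  proof (rule gradedI[where C = "C + D" and N = "N + m"])
    fix Q assume D: "disc Q > 0"
    have *: "(1 + cmod (M Q)) ^ N \<le> (1 + cmod (M Q)) ^ (N + m)" "(1 + cmod (M Q)) ^ m \<le> (1 + cmod (M Q)) ^ (N + m)"
      by (intro power_increasing; simp)+
    have "norm (F Q + G Q) \<le> norm (F Q) + norm (G Q)" by (rule norm_triangle_ineq)
    also have "norm (F Q) \<le> C * (cmod (M Q) powr e * (1 + cmod (M Q)) ^ (N + m))"
      by (rule order_trans[OF F(2)[OF D]]) (intro mult_left_mono * F(1), auto)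
    also have "norm (G Q) \<le> D * (cmod (M Q) powr e * (1 + cmod (M Q)) ^ (N + m))"
      by (rule order_trans[OF G(2)[OF D]]) (intro mult_left_mono * G(1), auto)
    finally show "norm (F Q + G Q) \<le> (C + D) * (cmod (M Q) powr e * (1 + cmod (M Q)) ^ (N + m))"
      by (simp add: distrib_right)
  qed
qed

lemma graded_weaken:
  assumes "graded e F" "f \<le> e"
  shows "graded f F"
proof -
  obtain C N where F: "C \<ge> 0" "\<And>Q. disc Q > 0 \<Longrightarrow> norm (F Q) \<le> C * (cmod (M Q) powr e * (1 + cmod (M Q)) ^ N)"
    using assms(1) by (rule gradedE) blast
  define m where "m = nat \<lceil>e - f\<rceil>"
  show ?thesis
  proof (rule gradedI[where C = C and N = "m + N"])
    fix Q assume D: "disc Q > 0"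
    have "cmod (M Q) powr e = cmod (M Q) powr f * cmod (M Q) powr (e - f)" by (simp add: powr_add[symmetric])
    also have "cmod (M Q) powr (e - f) \<le> (1 + cmod (M Q)) powr (e - f)"
      using assms(2) by (intro powr_mono2) auto
    also have "\<dots> \<le> (1 + cmod (M Q)) powr real m" by (intro powr_mono) (auto simp: m_def, linarith)
    also have "\<dots> = (1 + cmod (M Q)) ^ m" by (simp add: powr_realpow add_pos_nonneg)
    finally have "cmod (M Q) powr e \<le> cmod (M Q) powr f * (1 + cmod (M Q)) ^ m" by (simp add: mult_left_mono)
    then have "C * (cmod (M Q) powr e * (1 + cmod (M Q)) ^ N) \<le> C * ((cmod (M Q) powr f * (1 + cmod (M Q)) ^ m) * (1 + cmod (M Q)) ^ N)"
      by (intro mult_left_mono mult_right_mono F(1)) auto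
    then show "norm (F Q) \<le> C * (cmod (M Q) powr f * (1 + cmod (M Q)) ^ (m + N))"
      using F(2)[OF D] by (simp add: power_add mult_ac)
  qed
qed

lemma graded_diff:
  assumes "graded e F" "graded e G"
  shows "graded e (\<lambda>Q. F Q - G Q)"
proof -
  have "graded (0 + e) (\<lambda>Q. (-1) * G Q)" by (intro graded_mult graded_const assms)
  then have "graded e (\<lambda>Q. F Q + (-1) * G Q)" using assms(1) by (intro graded_add) auto
  then show ?thesis by simp
qed

lemma graded_poly_bound:
  assumes "graded e F" "e \<ge> 0" "\<And>Q. disc Q \<le> 0 \<Longrightarrow> F Q = 0"
  shows "\<exists>C N. \<forall>a b c. norm (F (a, b, c)) \<le> C * ((1 + \<bar>a\<bar>) * (1 + \<bar>b\<bar>) * (1 + \<bar>c\<bar>)) ^ N"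
proof -
  obtain C N where F: "C \<ge> 0" "\<And>Q. disc Q > 0 \<Longrightarrow> norm (F Q) \<le> C * (cmod (M Q) powr 0 * (1 + cmod (M Q)) ^ N)"
    using graded_weaken[OF assms(1,2)] by (rule gradedE) blast
  define B where "B = 1 + (cmod z)\<^sup>2 + cmod z + 1"
  have "norm (F (a, b, c)) \<le> C * B ^ N * ((1 + \<bar>a\<bar>) * (1 + \<bar>b\<bar>) * (1 + \<bar>c\<bar>)) ^ N" for a b c
  proof (cases "disc (a, b, c) > 0")
    case True
    define P where "P = (1 + \<bar>a\<bar>) * (1 + \<bar>b\<bar>) * (1 + \<bar>c\<bar>)"
    have "P = 1 + \<bar>a\<bar> + \<bar>b\<bar> + \<bar>c\<bar> + (\<bar>a\<bar> * \<bar>b\<bar> + \<bar>a\<bar> * \<bar>c\<bar> + \<bar>b\<bar> * \<bar>c\<bar> + \<bar>a\<bar> * \<bar>b\<bar> * \<bar>c\<bar>)"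
      by (simp add: P_def algebra_simps)
    moreover have "0 \<le> \<bar>a\<bar> * \<bar>b\<bar> + \<bar>a\<bar> * \<bar>c\<bar> + \<bar>b\<bar> * \<bar>c\<bar> + \<bar>a\<bar> * \<bar>b\<bar> * \<bar>c\<bar>" by simp
    ultimately have P: "1 \<le> P" "\<bar>a\<bar> \<le> P" "\<bar>b\<bar> \<le> P" "\<bar>c\<bar> \<le> P" by linarith+
    have "cmod (M (a, b, c)) \<le> cmod (of_real a * z\<^sup>2) + cmod (of_real b * z) + cmod (of_real c)"
      unfolding M_def prod.case by (intro order_trans[OF norm_triangle_ineq] add_right_mono norm_triangle_ineq)
    also have "\<dots> = \<bar>a\<bar> * (cmod z)\<^sup>2 + \<bar>b\<bar> * cmod z + \<bar>c\<bar>" by (simp add: norm_mult norm_power)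
    also have "\<dots> \<le> P * (cmod z)\<^sup>2 + P * cmod z + P" by (intro add_mono mult_right_mono P) auto
    finally have "1 + cmod (M (a, b, c)) \<le> B * P" using P(1) by (simp add: B_def algebra_simps)
    then have "(1 + cmod (M (a, b, c))) ^ N \<le> (B * P) ^ N" by (intro power_mono) auto
    then have "C * (1 * (1 + cmod (M (a, b, c))) ^ N) \<le> C * B ^ N * P ^ N"
      using F(1) by (simp add: power_mult_distrib mult_left_mono mult.assoc)
    then show ?thesis using F(2)[OF True] M_pos[OF True] by (simp add: P_def)
  next
    case False
    moreover have "0 \<le> B" by (simp add: B_def)
    ultimately show ?thesis using F(1) assms(3)[of "(a, b, c)"] by simp
  qed
  then show ?thesis by blast
qed

end

context form_kernel
begin

lemma T_deriv:
  assumes "\<beta> > 1" "a \<noteq> 0 \<or> b \<noteq> 0"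
  shows
    "((\<lambda>t. T l \<beta> n (t, b, c)) has_vector_derivative
        of_real (\<beta> * (- 4 * c)) * T l (\<beta> - 1) n (a, b, c) - of_nat n * z\<^sup>2 * T l \<beta> (Suc n) (a, b, c)
        + l * of_real (- 4 * c) * T l \<beta> n (a, b, c)) (at a)" (is ?A)
    "((\<lambda>t. T l \<beta> n (a, t, c)) has_vector_derivative
        of_real (\<beta> * (2 * b)) * T l (\<beta> - 1) n (a, b, c) - of_nat n * z * T l \<beta> (Suc n) (a, b, c)
        + l * of_real (2 * b) * T l \<beta> n (a, b, c)) (at b)" (is ?B)
    "((\<lambda>t. T l \<beta> n (a, b, t)) has_vector_derivative
        of_real (\<beta> * (- 4 * a)) * T l (\<beta> - 1) n (a, b, c) - of_nat n * 1 * T l \<beta> (Suc n) (a, b, c)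
        + l * of_real (- 4 * a) * T l \<beta> n (a, b, c)) (at c)" (is ?C)
proof -
  have nz: "disc (a, b, c) \<ge> 0 \<Longrightarrow> M (a, b, c) \<noteq> 0"
    using M_nonzero[of "(a, b, c)"] assms(2) by (auto simp: zero_prod_def)
  note rule = product_line_deriv[OF assms(1), where n = n and l = l]
  show ?A unfolding T_def
    by (rule rule[where d = "\<lambda>t. disc (t, b, c)" and m = "\<lambda>t. M (t, b, c)"])
       (use nz in \<open>auto simp: disc_def M_def intro!: derivative_eq_intros\<close>)
  show ?B unfolding T_def
    by (rule rule[where d = "\<lambda>t. disc (a, t, c)" and m = "\<lambda>t. M (a, t, c)"])
       (use nz in \<open>auto simp: disc_def M_def intro!: derivative_eq_intros\<close>)
  show ?C unfolding T_def
    by (rule rule[where d = "\<lambda>t. disc (a, b, t)" and m = "\<lambda>t. M (a, b, t)"])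
       (use nz in \<open>auto simp: disc_def M_def intro!: derivative_eq_intros\<close>)
qed

text \<open>These relations express every \<open>T\<close> occurring in a second derivative through
  a single one. Where \<open>M Q\<close> vanishes, both sides of the second vanish because of the
  cut-off.\<close>

lemma T_rec: "of_real (disc Q) * T l (\<beta> - 1) n Q = T l \<beta> n Q" "M Q * T l \<beta> (Suc n) Q = T l \<beta> n Q"
proof -
  show "of_real (disc Q) * T l (\<beta> - 1) n Q = T l \<beta> n Q"
    unfolding T_def pos_powr_minus_one[of "disc Q" \<beta>, symmetric] by simp
  show "M Q * T l \<beta> (Suc n) Q = T l \<beta> n Q"
    using M_pos[of Q] by (cases "disc Q > 0") (auto simp: T_def)
qed

lemma T_zero [simp]: "disc Q \<le> 0 \<Longrightarrow> T l \<beta> n Q = 0"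
  by (simp add: T_def)

section \<open>Explicit first and second derivatives of the kernel\<close>

abbreviation "n1 \<equiv> Suc k"
abbreviation "A Q \<equiv> complex_of_real (fst Q)"
abbreviation "B Q \<equiv> complex_of_real (fst (snd Q))"
abbreviation "C Q \<equiv> complex_of_real (snd (snd Q))"
abbreviation "X \<equiv> complex_of_real (Re z)"
abbreviation "R \<equiv> complex_of_real ((cmod z)\<^sup>2)"
abbreviation "\<alpha>' \<equiv> complex_of_real \<alpha>"
abbreviation "LL Q \<equiv> complex_of_real (L Q)"

text \<open>This and the next three definitions are the partial derivatives of \<open>K\<close> in
  b, in c, twice in b, and in c then a. They are expanded into summands constant * coefficients *
  \<open>T\<close>, so that the rules for \<open>graded\<close> apply term by term.\<close>

definition Kb :: "complex \<Rightarrow> vec3 \<Rightarrow> complex" where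
  "Kb l Q = X * T l \<alpha> n1 Q + (2 * \<alpha>') * ((B Q * LL Q) * T l (\<alpha> - 1) n1 Q)
     - (of_nat n1 * z) * (LL Q * T l \<alpha> (Suc n1) Q) + (2 * l) * ((B Q * LL Q) * T l \<alpha> n1 Q)"

definition Kc :: "complex \<Rightarrow> vec3 \<Rightarrow> complex" where
  "Kc l Q = T l \<alpha> n1 Q - (4 * \<alpha>') * ((A Q * LL Q) * T l (\<alpha> - 1) n1 Q)
     - of_nat n1 * (LL Q * T l \<alpha> (Suc n1) Q) - (4 * l) * ((A Q * LL Q) * T l \<alpha> n1 Q)"

definition Kbb :: "complex \<Rightarrow> vec3 \<Rightarrow> complex" where
  "Kbb l Q =
     (2 * \<alpha>' * X) * (B Q * T l (\<alpha> - 1) n1 Q) - (X * of_nat n1 * z) * T l \<alpha> (Suc n1) Q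
       + (2 * l * X) * (B Q * T l \<alpha> n1 Q)
     + (2 * \<alpha>') * ((LL Q + X * B Q) * T l (\<alpha> - 1) n1 Q)
       + (2 * \<alpha>') * ((B Q * LL Q) * (2 * of_real (\<alpha> - 1) * (B Q * T l (\<alpha> - 1 - 1) n1 Q)))
       - (2 * \<alpha>') * ((B Q * LL Q) * (of_nat n1 * z * T l (\<alpha> - 1) (Suc n1) Q))
       + (2 * \<alpha>') * ((B Q * LL Q) * (2 * l * (B Q * T l (\<alpha> - 1) n1 Q)))
     - (of_nat n1 * z * X) * T l \<alpha> (Suc n1) Q
       - (of_nat n1 * z) * (LL Q * (2 * \<alpha>' * (B Q * T l (\<alpha> - 1) (Suc n1) Q)))
       + (of_nat n1 * z) * (LL Q * (of_nat (Suc n1) * z * T l \<alpha> (Suc (Suc n1)) Q))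
       - (of_nat n1 * z) * (LL Q * (2 * l * (B Q * T l \<alpha> (Suc n1) Q)))
     + (2 * l) * ((LL Q + X * B Q) * T l \<alpha> n1 Q)
       + (2 * l) * ((B Q * LL Q) * (2 * \<alpha>' * (B Q * T l (\<alpha> - 1) n1 Q)))
       - (2 * l) * ((B Q * LL Q) * (of_nat n1 * z * T l \<alpha> (Suc n1) Q))
       + (2 * l) * ((B Q * LL Q) * (2 * l * (B Q * T l \<alpha> n1 Q)))"

definition Kca :: "complex \<Rightarrow> vec3 \<Rightarrow> complex" where
  "Kca l Q =
     (- 4 * \<alpha>') * (C Q * T l (\<alpha> - 1) n1 Q) - (of_nat n1 * z\<^sup>2) * T l \<alpha> (Suc n1) Q
       - (4 * l) * (C Q * T l \<alpha> n1 Q)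
     - (4 * \<alpha>') * ((LL Q + R * A Q) * T l (\<alpha> - 1) n1 Q)
       + (4 * \<alpha>') * ((A Q * LL Q) * (4 * of_real (\<alpha> - 1) * (C Q * T l (\<alpha> - 1 - 1) n1 Q)))
       + (4 * \<alpha>') * ((A Q * LL Q) * (of_nat n1 * z\<^sup>2 * T l (\<alpha> - 1) (Suc n1) Q))
       + (4 * \<alpha>') * ((A Q * LL Q) * (4 * l * (C Q * T l (\<alpha> - 1) n1 Q)))
     - (of_nat n1 * R) * T l \<alpha> (Suc n1) Q
       + of_nat n1 * (LL Q * (4 * \<alpha>' * (C Q * T l (\<alpha> - 1) (Suc n1) Q)))
       + of_nat n1 * (LL Q * (of_nat (Suc n1) * z\<^sup>2 * T l \<alpha> (Suc (Suc n1)) Q))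
       + of_nat n1 * (LL Q * (4 * l * (C Q * T l \<alpha> (Suc n1) Q)))
     - (4 * l) * ((LL Q + R * A Q) * T l \<alpha> n1 Q)
       + (4 * l) * ((A Q * LL Q) * (4 * \<alpha>' * (C Q * T l (\<alpha> - 1) n1 Q)))
       + (4 * l) * ((A Q * LL Q) * (of_nat n1 * z\<^sup>2 * T l \<alpha> (Suc n1) Q))
       + (4 * l) * ((A Q * LL Q) * (4 * l * (C Q * T l \<alpha> n1 Q)))"

text \<open>Two differentiations meet the cut-off power with exponents \<alpha> and \<alpha> - 1,
  and \<open>pos_powr_has_derivative\<close> needs each of them above 1.\<close>

lemma alpha_gt: "\<alpha> - 1 > 1" "\<alpha> > 1"
  using k_ge by (auto simp: \<alpha>_def)

lemma L_deriv:
  "((\<lambda>t. LL (t, b, c)) has_vector_derivative R) (at a)"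
  "((\<lambda>t. LL (a, t, c)) has_vector_derivative X) (at b)"
  "((\<lambda>t. LL (a, b, t)) has_vector_derivative 1) (at c)"
  unfolding L_def by (auto intro!: derivative_eq_intros)

lemma has_vector_derivative_const_prod:
  fixes p T :: "real \<Rightarrow> complex"
  assumes "(p has_vector_derivative p') (at t)" "(T has_vector_derivative T') (at t)"
  shows "((\<lambda>t. c * (p t * T t)) has_vector_derivative c * (p t * T' + p' * T t)) (at t)"
  by (intro has_vector_derivative_mult_right has_vector_derivative_mult assms)

lemma has_vector_derivative_of_real_id: "((\<lambda>t. complex_of_real t) has_vector_derivative 1) (at t)"
  by (auto intro!: derivative_eq_intros)

lemma BL_deriv: "((\<lambda>t. complex_of_real t * LL (a, t, c)) has_vector_derivative (of_real b * X + 1 * LL (a, b, c))) (at b)"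
  by (intro has_vector_derivative_mult has_vector_derivative_of_real_id L_deriv)

lemma AL_deriv: "((\<lambda>t. complex_of_real t * LL (t, b, c)) has_vector_derivative (of_real a * R + 1 * LL (a, b, c))) (at a)"
  by (intro has_vector_derivative_mult has_vector_derivative_of_real_id L_deriv)

lemma K_deriv_b:
  assumes "a \<noteq> 0"
  shows "((\<lambda>t. K l (a, t, c)) has_vector_derivative Kb l (a, b, c)) (at b)"
proof -
  have "a \<noteq> 0 \<or> b \<noteq> 0" using assms by simp
  note T = T_deriv(2)[OF _ this]
  show ?thesis unfolding K_def Kb_def
    by (rule has_vector_derivative_eq_rhs[OF has_vector_derivative_mult[OF L_deriv(2) T[OF alpha_gt(2)]]])
       (simp add: algebra_simps)
qed

lemma K_deriv_c:
  assumes "a \<noteq> 0"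
  shows "((\<lambda>t. K l (a, b, t)) has_vector_derivative Kc l (a, b, c)) (at c)"
proof -
  have "a \<noteq> 0 \<or> b \<noteq> 0" using assms by simp
  note T = T_deriv(3)[OF _ this]
  show ?thesis unfolding K_def Kc_def
    by (rule has_vector_derivative_eq_rhs[OF has_vector_derivative_mult[OF L_deriv(3) T[OF alpha_gt(2)]]])
       (simp add: algebra_simps)
qed

lemma Kb_deriv_b:
  assumes "a \<noteq> 0"
  shows "((\<lambda>t. Kb l (a, t, c)) has_vector_derivative Kbb l (a, b, c)) (at b)"
proof -
  have ab: "a \<noteq> 0 \<or> b \<noteq> 0" using assms by simp
  note T = T_deriv(2)[OF _ ab]
  show ?thesis unfolding Kb_def fst_conv snd_conv
    by (rule has_vector_derivative_eq_rhs[OF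
          has_vector_derivative_add[OF has_vector_derivative_diff[OF has_vector_derivative_add[OF
            has_vector_derivative_mult_right[OF T[OF alpha_gt(2)]]
            has_vector_derivative_const_prod[OF BL_deriv T[OF alpha_gt(1)]]]
            has_vector_derivative_const_prod[OF L_deriv(2) T[OF alpha_gt(2)]]]
            has_vector_derivative_const_prod[OF BL_deriv T[OF alpha_gt(2)]]]])
       (simp only: Kbb_def fst_conv snd_conv of_real_mult of_real_numeral of_real_minus,
        simp add: algebra_simps del: of_nat_Suc)
qed

lemma Kc_deriv_a:
  assumes "b \<noteq> 0"
  shows "((\<lambda>t. Kc l (t, b, c)) has_vector_derivative Kca l (a, b, c)) (at a)"
proof -
  have ab: "a \<noteq> 0 \<or> b \<noteq> 0" using assms by simp
  note T = T_deriv(1)[OF _ ab]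
  show ?thesis unfolding Kc_def fst_conv snd_conv
    by (rule has_vector_derivative_eq_rhs[OF
          has_vector_derivative_diff[OF has_vector_derivative_diff[OF has_vector_derivative_diff[OF
            T[OF alpha_gt(2)]
            has_vector_derivative_const_prod[OF AL_deriv T[OF alpha_gt(1)]]]
            has_vector_derivative_const_prod[OF L_deriv(1) T[OF alpha_gt(2)]]]
            has_vector_derivative_const_prod[OF AL_deriv T[OF alpha_gt(2)]]]])
       (simp only: Kca_def fst_conv snd_conv of_real_mult of_real_numeral of_real_minus,
        simp add: algebra_simps del: of_nat_Suc)
qed

text \<open>Let D be the discriminant and P = L / M^(k+1). Then box P = 0 and box D = 6; the symbol
  of box at the gradient of D is 4 D, and by Euler's relation the polarised symbol at D and P is -4
  k P. The D^(\<alpha>-1) terms add up to 4 \<alpha> (\<alpha> + 1/2 - k) = 0, the terms linear in l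
  to 6 + 8 \<alpha> - 4 k = 4 (k + 1/2), and the quadratic one is 4 l^2 D.\<close>

lemma box_K: "Kbb l Q - Kca l Q = (4 * l * of_real (real k + 1 / 2) + 4 * l\<^sup>2 * of_real (disc Q)) * K l Q"
proof -
  define a b c where "a = A Q" "b = B Q" "c = C Q"
  define m d L' where "m = M Q" "d = complex_of_real (disc Q)" "L' = LL Q"
  define n where "n = complex_of_nat n1"
  define x r where "x = X" "r = R"
  have al: "\<alpha>' = n - 3 / 2" by (simp add: \<alpha>_def n_def algebra_simps)
  have m: "m = a * z\<^sup>2 + b * z + c" by (simp add: m_d_L'_def M_def a_b_c_def case_prod_unfold)
  have d: "d = b\<^sup>2 - 4 * a * c" by (simp add: m_d_L'_def disc_def a_b_c_def case_prod_unfold)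
  have L': "L' = a * r + b * x + c" by (simp add: m_d_L'_def L_def a_b_c_def case_prod_unfold x_r_def)
  \<comment> \<open>This relation z^2 + |z|^2 = 2 z Re z is what makes box P vanish.\<close>
  have zr: "z\<^sup>2 + r - 2 * z * x = 0"
    unfolding x_r_def cmod_power2 by (simp add: complex_eq_iff power2_eq_square algebra_simps)
  \<comment> \<open>With the lowest exponent and the highest inverse power, this \<open>T\<close>
    divides all others by \<open>T_rec\<close>, and the claim becomes a polynomial identity.\<close>
  define t where "t = T l (\<alpha> - 1 - 1) (Suc (Suc n1)) Q"
  have T1: "T l (\<alpha> - 1 - 1) (Suc n1) Q = m * t" "T l (\<alpha> - 1 - 1) n1 Q = m * (m * t)"
    unfolding t_def m_d_L'_def by (simp_all only: T_rec)
  have T2: "T l (\<alpha> - 1) (Suc (Suc n1)) Q = d * t" "T l (\<alpha> - 1) (Suc n1) Q = d * (m * t)" "T l (\<alpha> - 1) n1 Q = d * (m * (m * t))"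
    unfolding T1[symmetric] unfolding t_def m_d_L'_def by (simp_all only: T_rec)
  have T3: "T l \<alpha> (Suc (Suc n1)) Q = d * (d * t)" "T l \<alpha> (Suc n1) Q = d * (d * (m * t))" "T l \<alpha> n1 Q = d * (d * (m * (m * t)))"
    unfolding T2[symmetric] unfolding m_d_L'_def by (simp_all only: T_rec)
  have n1: "of_nat (Suc n1) = n + 1" by (simp add: n_def)
  have al1: "complex_of_real (\<alpha> - 1) = n - 5 / 2" using al by simp
  have ka: "complex_of_real (real k + 1 / 2) = n - 1 / 2" by (simp add: n_def)
  note defs = a_b_c_def[symmetric] m_d_L'_def[symmetric] n_def[symmetric] x_r_def[symmetric]
  have "Kbb l Q - Kca l Q - (4 * l * of_real (real k + 1 / 2) + 4 * l\<^sup>2 * of_real (disc Q)) * K l Q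
    = (n - 3/2) * d * m * m * t * (4 * b * x + 2 * L' + 4 * c + 4 * L' + 4 * a * r)
      + 4 * (n - 3/2) * (n - 5/2) * (b\<^sup>2 - 4 * a * c) * L' * m * m * t
      - 4 * (n - 3/2) * n * L' * (a * z\<^sup>2 + b * z + c) * d * m * t
      + n * (z\<^sup>2 + r - 2 * z * x) * d * d * m * t
      + l * (d * d * m * m * t * (4 * b * x + 2 * L' + 4 * c + 4 * L' + 4 * a * r)
        + 8 * (n - 3/2) * (b\<^sup>2 - 4 * a * c) * L' * d * m * m * t
        - 4 * n * L' * (a * z\<^sup>2 + b * z + c) * d * d * m * t
        - 4 * (n - 1 / 2) * L' * d * d * m * m * t)
      + 4 * l\<^sup>2 * L' * (b\<^sup>2 - 4 * a * c - d) * d * d * m * m * t"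
    unfolding Kbb_def Kca_def K_def T1 T2 T3 n1 al1 ka defs al
    by (simp add: algebra_simps power2_eq_square)
  also have "\<dots> = (n - 3/2) * d * m * m * t * (10 * L')
      + 4 * (n - 3/2) * (n - 5/2) * d * L' * m * m * t - 4 * (n - 3/2) * n * L' * m * d * m * t
      + l * (d * d * m * m * t * (10 * L') + 8 * (n - 3/2) * d * L' * d * m * m * t
        - 4 * n * L' * m * d * d * m * t - 4 * (n - 1 / 2) * L' * d * d * m * m * t)"
  proof -
    have e: "4 * b * x + 2 * L' + 4 * c + 4 * L' + 4 * a * r = 10 * L'" unfolding L' by (simp add: algebra_simps)
    show ?thesis unfolding e d[symmetric] m[symmetric] zr by simp
  qed
  also have "\<dots> = 0" by (simp add: algebra_simps)
  finally show ?thesis by simp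
qed

end

section \<open>Testing the kernel against Gaussians\<close>

definition nice :: "(vec3 \<Rightarrow> complex) \<Rightarrow> bool" where
  "nice F \<longleftrightarrow> F \<in> borel_measurable borel \<and> (\<exists>C. \<forall>Q. norm (F Q) \<le> C * wt3 Q)"

lemma niceI: "F \<in> borel_measurable borel \<Longrightarrow> (\<And>Q. norm (F Q) \<le> C * wt3 Q) \<Longrightarrow> nice F"
  unfolding nice_def by blast

lemma nice_measurable: "nice F \<Longrightarrow> F \<in> borel_measurable borel"
  unfolding nice_def by (rule conjunct1)

lemma nice_integrable:
  assumes "nice F"
  shows "integrable lborel F"
proof -
  obtain C where C: "\<And>Q. norm (F Q) \<le> C * wt3 Q" using assms unfolding nice_def by blast
  show ?thesis
  proof (rule Bochner_Integration.integrable_bound[OF integrable_mult_right[OF integrable_wt3, of C]])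
    show "F \<in> borel_measurable lborel" using nice_measurable[OF assms] by simp
    show "AE x in lborel. norm (F x) \<le> norm (C * wt3 x)"
      using C by (intro AE_I2, metis real_norm_def abs_ge_self order_trans)
  qed
qed

lemma nice_add:
  assumes "nice F" "nice G"
  shows "nice (\<lambda>Q. F Q + G Q)"
proof -
  obtain C D where *: "\<And>Q. norm (F Q) \<le> C * wt3 Q" "\<And>Q. norm (G Q) \<le> D * wt3 Q"
    using assms unfolding nice_def by blast
  show ?thesis
  proof (rule niceI[where C = "C + D"])
    show "norm (F Q + G Q) \<le> (C + D) * wt3 Q" for Q
      using norm_triangle_ineq[of "F Q" "G Q"] *[of Q] by (simp add: distrib_right)
  qed (intro borel_measurable_add nice_measurable assms)
qed

lemma nice_common_bound:
  assumes "nice F" "nice G"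
  obtains C where "\<And>Q. norm (F Q) \<le> C * wt3 Q" "\<And>Q. norm (G Q) \<le> C * wt3 Q"
proof -
  obtain C D where *: "\<And>Q. norm (F Q) \<le> C * wt3 Q" "\<And>Q. norm (G Q) \<le> D * wt3 Q"
    using assms unfolding nice_def by blast
  have "C * wt3 Q \<le> max C D * wt3 Q" "D * wt3 Q \<le> max C D * wt3 Q" for Q
    using wt3_pos[of Q] by (auto intro!: mult_right_mono)
  then show ?thesis using * by (intro that[of "max C D"]) (blast intro: order_trans)+
qed

lemma nice_integral_deriv_eq_0:
  assumes "nice H" "nice H'"
  shows "(\<And>a b c. b \<noteq> 0 \<Longrightarrow> ((\<lambda>t. H (t, b, c)) has_vector_derivative H' (a, b, c)) (at a))
      \<Longrightarrow> (\<integral>Q. H' Q \<partial>lborel) = 0"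
    and "(\<And>a b c. a \<noteq> 0 \<Longrightarrow> ((\<lambda>t. H (a, t, c)) has_vector_derivative H' (a, b, c)) (at b))
      \<Longrightarrow> (\<integral>Q. H' Q \<partial>lborel) = 0"
    and "(\<And>a b c. a \<noteq> 0 \<Longrightarrow> ((\<lambda>t. H (a, b, t)) has_vector_derivative H' (a, b, c)) (at c))
      \<Longrightarrow> (\<integral>Q. H' Q \<partial>lborel) = 0"
proof -
  obtain C where C: "\<And>Q. norm (H Q) \<le> C * wt3 Q" "\<And>Q. norm (H' Q) \<le> C * wt3 Q"
    using assms by (rule nice_common_bound) blast
  note m = nice_measurable[OF assms(2)]
  show "(\<And>a b c. b \<noteq> 0 \<Longrightarrow> ((\<lambda>t. H (t, b, c)) has_vector_derivative H' (a, b, c)) (at a))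
      \<Longrightarrow> (\<integral>Q. H' Q \<partial>lborel) = 0" by (rule integral_fst_deriv_eq_0[OF m C])
  show "(\<And>a b c. a \<noteq> 0 \<Longrightarrow> ((\<lambda>t. H (a, t, c)) has_vector_derivative H' (a, b, c)) (at b))
      \<Longrightarrow> (\<integral>Q. H' Q \<partial>lborel) = 0" by (rule integral_snd_fst_deriv_eq_0[OF m C])
  show "(\<And>a b c. a \<noteq> 0 \<Longrightarrow> ((\<lambda>t. H (a, b, t)) has_vector_derivative H' (a, b, c)) (at c))
      \<Longrightarrow> (\<integral>Q. H' Q \<partial>lborel) = 0" by (rule integral_snd_snd_deriv_eq_0[OF m C])
qed

definition tensor :: "(real \<Rightarrow> complex) \<Rightarrow> (real \<Rightarrow> complex) \<Rightarrow> (real \<Rightarrow> complex) \<Rightarrow> vec3 \<Rightarrow> complex" where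
  "tensor f g h = (\<lambda>(a, b, c). f a * g b * h c)"

lemma tensor_measurable:
  assumes "continuous_on UNIV f" "continuous_on UNIV g" "continuous_on UNIV h"
  shows "tensor f g h \<in> borel_measurable borel"
  unfolding tensor_def case_prod_unfold
  by (intro borel_measurable_continuous_onI continuous_intros continuous_on_compose2[OF assms(1)]
      continuous_on_compose2[OF assms(2)] continuous_on_compose2[OF assms(3)]) auto

context form_kernel
begin

lemma K_zero: "disc Q \<le> 0 \<Longrightarrow> K l Q = 0" "disc Q \<le> 0 \<Longrightarrow> Kb l Q = 0" "disc Q \<le> 0 \<Longrightarrow> Kc l Q = 0"
    "disc Q \<le> 0 \<Longrightarrow> Kbb l Q = 0" "disc Q \<le> 0 \<Longrightarrow> Kca l Q = 0"
  by (simp_all add: K_def Kb_def Kc_def Kbb_def Kca_def)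

lemma coeff_measurable:
  "A \<in> borel_measurable borel" "B \<in> borel_measurable borel" "C \<in> borel_measurable borel" "LL \<in> borel_measurable borel"
  by (intro borel_measurable_continuous_onI continuous_intros L_continuous)+

lemma K_measurable:
  "K l \<in> borel_measurable borel" "Kb l \<in> borel_measurable borel" "Kc l \<in> borel_measurable borel"
  "Kbb l \<in> borel_measurable borel" "Kca l \<in> borel_measurable borel"
  unfolding K_def[abs_def] Kb_def[abs_def] Kc_def[abs_def] Kbb_def[abs_def] Kca_def[abs_def]
  by (intro borel_measurable_add borel_measurable_diff borel_measurable_times borel_measurable_const
      coeff_measurable T_measurable)+

text \<open>\<open>K\<close> has order 1 + 2 \<alpha> - (k + 1) = k - 1 at the origin. Each
  derivative loses at most one order, so the second derivatives have order at least k - 3 and stay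
  bounded there.\<close>

lemma graded_K:
  assumes "Re l \<le> 0"
  shows "graded 0 (K l)" "graded 0 (Kb l)" "graded 0 (Kc l)" "graded 0 (Kbb l)" "graded 0 (Kca l)"
proof -
  have T: "graded (2 * \<alpha> - real n) (T l \<alpha> n)" "graded (2 * (\<alpha> - 1) - real n) (T l (\<alpha> - 1) n)"
    "graded (2 * (\<alpha> - 1 - 1) - real n) (T l (\<alpha> - 1 - 1) n)" for n
    using k_ge by (intro graded_T assms; simp add: \<alpha>_def)+
  have S: "graded 1 (\<lambda>Q. LL Q + X * B Q)" "graded 1 (\<lambda>Q. LL Q + R * A Q)"
    using graded_add[OF graded_coeffs(4) graded_mult[OF graded_const graded_coeffs(2), of X, simplified]]
      graded_add[OF graded_coeffs(4) graded_mult[OF graded_const graded_coeffs(1), of R, simplified]] by auto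
  note rules = S graded_coeffs T graded_const graded_mult
  show "graded 0 (K l)" unfolding K_def[abs_def]
    by (rule graded_weaken, (rule rules)+) (use k_ge in \<open>simp add: \<alpha>_def\<close>)
  show "graded 0 (Kb l)" unfolding Kb_def[abs_def]
    by (intro graded_add graded_diff; rule graded_weaken, (rule rules)+) (use k_ge in \<open>simp_all add: \<alpha>_def\<close>)
  show "graded 0 (Kc l)" unfolding Kc_def[abs_def]
    by (intro graded_add graded_diff; rule graded_weaken, (rule rules)+) (use k_ge in \<open>simp_all add: \<alpha>_def\<close>)
  show "graded 0 (Kbb l)" unfolding Kbb_def[abs_def]
    by (intro graded_add graded_diff; rule graded_weaken, (rule rules)+) (use k_ge in \<open>simp_all add: \<alpha>_def\<close>)
  show "graded 0 (Kca l)" unfolding Kca_def[abs_def]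
    by (intro graded_add graded_diff; rule graded_weaken, (rule rules)+) (use k_ge in \<open>simp_all add: \<alpha>_def\<close>)
qed

lemma nice_tensor:
  assumes "graded 0 F" "\<And>Q. disc Q \<le> 0 \<Longrightarrow> F Q = 0" "F \<in> borel_measurable borel"
    and "rapid f" "rapid g" "rapid h"
    and "continuous_on UNIV f" "continuous_on UNIV g" "continuous_on UNIV h"
  shows "nice (\<lambda>Q. F Q * tensor f g h Q)"
proof -
  obtain C N where F: "\<And>a b c. norm (F (a, b, c)) \<le> C * ((1 + \<bar>a\<bar>) * (1 + \<bar>b\<bar>) * (1 + \<bar>c\<bar>)) ^ N"
    using graded_poly_bound[OF assms(1) order_refl assms(2)] by blast
  obtain C' where "\<And>a b c. norm (F (a, b, c) * (f a * g b * h c)) \<le> C' * wt3 (a, b, c)"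
    using poly_rapid_bound[OF F assms(4-6)] by blast
  then show ?thesis
    by (intro niceI[where C = C'] borel_measurable_times assms(3) tensor_measurable[OF assms(7-9)])
       (auto simp: tensor_def)
qed

text \<open>Two integrations by parts in b, and one each in a and c, move the wave operator onto the
  test function; the boundary integrals with \<open>Kb\<close> and \<open>Kc\<close> cancel. On the
  right only \<open>K\<close> is left, for which bounds much better than polynomial growth are
  available.\<close>

lemma weak_box:
  fixes f f' g g' g'' h h' :: "real \<Rightarrow> complex"
  assumes l: "Re l \<le> 0"
    and r: "rapid f" "rapid f'" "rapid g" "rapid g'" "rapid g''" "rapid h" "rapid h'"
    and ct: "continuous_on UNIV f'" "continuous_on UNIV g''" "continuous_on UNIV h'"
    and d: "\<And>t. (f has_vector_derivative f' t) (at t)" "\<And>t. (g has_vector_derivative g' t) (at t)"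
      "\<And>t. (g' has_vector_derivative g'' t) (at t)" "\<And>t. (h has_vector_derivative h' t) (at t)"
  shows "nice (\<lambda>Q. K l Q * tensor f g'' h Q)" "nice (\<lambda>Q. K l Q * tensor f' g h' Q)"
    "(\<integral>Q. (Kbb l Q - Kca l Q) * tensor f g h Q \<partial>lborel) =
     (\<integral>Q. K l Q * tensor f g'' h Q \<partial>lborel) - (\<integral>Q. K l Q * tensor f' g h' Q \<partial>lborel)"
proof -
  have cc: "continuous_on UNIV f" "continuous_on UNIV g" "continuous_on UNIV g'" "continuous_on UNIV h"
    by (intro continuous_at_imp_continuous_on ballI has_vector_derivative_continuous[OF d(1)]
        has_vector_derivative_continuous[OF d(2)] has_vector_derivative_continuous[OF d(3)]
        has_vector_derivative_continuous[OF d(4)])+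
  note G = graded_K[OF l]
  have nK: "nice (\<lambda>Q. K l Q * tensor u v w Q)" if "rapid u" "rapid v" "rapid w"
      "continuous_on UNIV u" "continuous_on UNIV v" "continuous_on UNIV w" for u v w
    by (rule nice_tensor[OF G(1) K_zero(1) K_measurable(1) that])
  have nKb: "nice (\<lambda>Q. Kb l Q * tensor u v w Q)" if "rapid u" "rapid v" "rapid w"
      "continuous_on UNIV u" "continuous_on UNIV v" "continuous_on UNIV w" for u v w
    by (rule nice_tensor[OF G(2) K_zero(2) K_measurable(2) that])
  have nKc: "nice (\<lambda>Q. Kc l Q * tensor u v w Q)" if "rapid u" "rapid v" "rapid w"
      "continuous_on UNIV u" "continuous_on UNIV v" "continuous_on UNIV w" for u v w
    by (rule nice_tensor[OF G(3) K_zero(3) K_measurable(3) that])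
  have nKbb: "nice (\<lambda>Q. Kbb l Q * tensor u v w Q)" if "rapid u" "rapid v" "rapid w"
      "continuous_on UNIV u" "continuous_on UNIV v" "continuous_on UNIV w" for u v w
    by (rule nice_tensor[OF G(4) K_zero(4) K_measurable(4) that])
  have nKca: "nice (\<lambda>Q. Kca l Q * tensor u v w Q)" if "rapid u" "rapid v" "rapid w"
      "continuous_on UNIV u" "continuous_on UNIV v" "continuous_on UNIV w" for u v w
    by (rule nice_tensor[OF G(5) K_zero(5) K_measurable(5) that])
  show n: "nice (\<lambda>Q. K l Q * tensor f g'' h Q)" "nice (\<lambda>Q. K l Q * tensor f' g h' Q)"
    by (rule nK[OF r(1,5,6) cc(1) ct(2) cc(4)], rule nK[OF r(2,3,7) ct(1) cc(2) ct(3)])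
  have 1: "(\<integral>Q. Kbb l Q * tensor f g h Q + Kb l Q * tensor f g' h Q \<partial>lborel) = 0"
  proof (rule nice_integral_deriv_eq_0(2)[OF nKb[OF r(1,3,6) cc(1,2,4)] nice_add[OF nKbb[OF r(1,3,6) cc(1,2,4)] nKb[OF r(1,4,6) cc(1,3,4)]]])
    fix a b c :: real assume "a \<noteq> 0"
    then show "((\<lambda>t. Kb l (a, t, c) * tensor f g h (a, t, c)) has_vector_derivative Kbb l (a, b, c) * tensor f g h (a, b, c) + Kb l (a, b, c) * tensor f g' h (a, b, c)) (at b)"
      unfolding tensor_def prod.case
      by (intro has_vector_derivative_eq_rhs[OF has_vector_derivative_mult[OF Kb_deriv_b has_vector_derivative_mult_left[OF has_vector_derivative_mult_right[OF d(2)]]]]) simp_all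
  qed
  have 2: "(\<integral>Q. Kb l Q * tensor f g' h Q + K l Q * tensor f g'' h Q \<partial>lborel) = 0"
  proof (rule nice_integral_deriv_eq_0(2)[OF nK[OF r(1,4,6) cc(1,3,4)] nice_add[OF nKb[OF r(1,4,6) cc(1,3,4)] n(1)]])
    fix a b c :: real assume "a \<noteq> 0"
    then show "((\<lambda>t. K l (a, t, c) * tensor f g' h (a, t, c)) has_vector_derivative Kb l (a, b, c) * tensor f g' h (a, b, c) + K l (a, b, c) * tensor f g'' h (a, b, c)) (at b)"
      unfolding tensor_def prod.case
      by (intro has_vector_derivative_eq_rhs[OF has_vector_derivative_mult[OF K_deriv_b has_vector_derivative_mult_left[OF has_vector_derivative_mult_right[OF d(3)]]]]) simp_all
  qed
  have 3: "(\<integral>Q. Kca l Q * tensor f g h Q + Kc l Q * tensor f' g h Q \<partial>lborel) = 0"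
  proof (rule nice_integral_deriv_eq_0(1)[OF nKc[OF r(1,3,6) cc(1,2,4)] nice_add[OF nKca[OF r(1,3,6) cc(1,2,4)] nKc[OF r(2,3,6) ct(1) cc(2,4)]]])
    fix a b c :: real assume "b \<noteq> 0"
    then show "((\<lambda>t. Kc l (t, b, c) * tensor f g h (t, b, c)) has_vector_derivative Kca l (a, b, c) * tensor f g h (a, b, c) + Kc l (a, b, c) * tensor f' g h (a, b, c)) (at a)"
      unfolding tensor_def prod.case
      by (intro has_vector_derivative_eq_rhs[OF has_vector_derivative_mult[OF Kc_deriv_a has_vector_derivative_mult_left[OF has_vector_derivative_mult_left[OF d(1)]]]]) simp_all
  qed
  have 4: "(\<integral>Q. Kc l Q * tensor f' g h Q + K l Q * tensor f' g h' Q \<partial>lborel) = 0"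
  proof (rule nice_integral_deriv_eq_0(3)[OF nK[OF r(2,3,6) ct(1) cc(2,4)] nice_add[OF nKc[OF r(2,3,6) ct(1) cc(2,4)] n(2)]])
    fix a b c :: real assume "a \<noteq> 0"
    then show "((\<lambda>t. K l (a, b, t) * tensor f' g h (a, b, t)) has_vector_derivative Kc l (a, b, c) * tensor f' g h (a, b, c) + K l (a, b, c) * tensor f' g h' (a, b, c)) (at c)"
      unfolding tensor_def prod.case
      by (intro has_vector_derivative_eq_rhs[OF has_vector_derivative_mult[OF K_deriv_c has_vector_derivative_mult_right[OF d(4)]]]) simp_all
  qed
  have i: "integrable lborel (\<lambda>Q. Kbb l Q * tensor f g h Q)" "integrable lborel (\<lambda>Q. Kca l Q * tensor f g h Q)"
    "integrable lborel (\<lambda>Q. Kb l Q * tensor f g' h Q)" "integrable lborel (\<lambda>Q. Kc l Q * tensor f' g h Q)"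
    "integrable lborel (\<lambda>Q. K l Q * tensor f g'' h Q)" "integrable lborel (\<lambda>Q. K l Q * tensor f' g h' Q)"
    using nKbb[OF r(1,3,6) cc(1,2,4)] nKca[OF r(1,3,6) cc(1,2,4)] nKb[OF r(1,4,6) cc(1,3,4)]
      nKc[OF r(2,3,6) ct(1) cc(2,4)] n by (simp_all add: nice_integrable)
  show "(\<integral>Q. (Kbb l Q - Kca l Q) * tensor f g h Q \<partial>lborel) =
     (\<integral>Q. K l Q * tensor f g'' h Q \<partial>lborel) - (\<integral>Q. K l Q * tensor f' g h' Q \<partial>lborel)"
    using 1 2 3 4 i by (simp add: left_diff_distrib add_eq_0_iff)
qed

end

section \<open>Decay and continuity of the kernel\<close>

lemma powr_mult_exp_bound:
  assumes "\<delta> > 0" "D > 0" "0 \<le> \<beta>" "\<beta> \<le> real N"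
  shows "D powr \<beta> * exp (- \<delta> * D) \<le> 1 + fact N / \<delta> ^ N"
proof -
  have "D powr \<beta> \<le> 1 + D ^ N"
  proof (cases "D \<le> 1")
    case True
    then have "D powr \<beta> \<le> 1 powr \<beta>" using assms by (intro powr_mono2) auto
    moreover have "0 \<le> D ^ N" using assms(2) by simp
    ultimately show ?thesis by simp
  next
    case False
    then have "D powr \<beta> \<le> D powr real N" using assms by (intro powr_mono) auto
    then show ?thesis using False by (simp add: powr_realpow)
  qed
  then have "D powr \<beta> * exp (- \<delta> * D) \<le> (1 + D ^ N) * exp (- \<delta> * D)" by (intro mult_right_mono) auto
  also have "\<dots> = exp (- \<delta> * D) + D ^ N * exp (- \<delta> * D)" by (simp add: distrib_right)
  also have "\<dots> \<le> 1 + fact N / \<delta> ^ N"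
  proof (intro add_mono)
    show "exp (- \<delta> * D) \<le> 1" using assms by simp
    have "D ^ N = fact N / \<delta> ^ N * ((\<delta> * D) ^ N / fact N)" using assms by (simp add: power_mult_distrib)
    also have "\<dots> \<le> fact N / \<delta> ^ N * exp (\<delta> * D)" using assms by (intro mult_left_mono exp_ge_power) auto
    finally show "D ^ N * exp (- \<delta> * D) \<le> fact N / \<delta> ^ N" by (simp add: exp_minus field_simps)
  qed
  finally show ?thesis .
qed

context form_kernel
begin

lemma norm_K:
  assumes "disc Q > 0"
  shows "norm (K l Q) \<le> disc Q powr \<alpha> * exp (Re l * disc Q) / cmod (M Q) ^ k"
proof -
  have M: "cmod (M Q) > 0" using M_pos[OF assms] .
  have "norm (K l Q) = \<bar>L Q\<bar> * (disc Q powr \<alpha> * inverse (cmod (M Q) ^ Suc k) * exp (Re l * disc Q))"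
    using assms by (simp add: K_def T_def norm_mult norm_inverse norm_power pos_powr_def norm_exp_eq_Re)
  also have "\<dots> \<le> cmod (M Q) * (disc Q powr \<alpha> * inverse (cmod (M Q) ^ Suc k) * exp (Re l * disc Q))"
    using assms L_le_M[of Q] by (intro mult_right_mono) auto
  also have "\<dots> = disc Q powr \<alpha> * exp (Re l * disc Q) / cmod (M Q) ^ k"
    using M by (simp add: field_simps)
  finally show ?thesis .
qed

text \<open>For small |M| the bound of \<open>norm_K\<close> degenerates; estimating the
  discriminant by |M|^2 / (Im z)^2 shows vanishing of order k - 1 instead.\<close>

lemma norm_K_small:
  assumes "Re l \<le> 0"
  shows "norm (K l Q) \<le> cmod (M Q) ^ (k - 1) / Im z ^ (2 * k - 1)"
proof (cases "disc Q > 0")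
  case True
  have M: "cmod (M Q) > 0" using M_pos[OF True] .
  have "disc Q powr \<alpha> \<le> ((cmod (M Q) / Im z) ^ 2) powr \<alpha>"
    using True disc_le_M[of Q] k_ge by (intro powr_mono2) (auto simp: \<alpha>_def power_divide)
  also have "\<dots> = (cmod (M Q) / Im z) powr (real (2 * k - 1))"
    using M Im_z k_ge by (simp add: powr_powr powr_numeral[symmetric] \<alpha>_def algebra_simps of_nat_diff del: powr_numeral)
  also have "\<dots> = cmod (M Q) ^ (2 * k - 1) / Im z ^ (2 * k - 1)"
    using M Im_z by (subst powr_realpow) (auto simp: power_divide)
  finally have 1: "disc Q powr \<alpha> \<le> cmod (M Q) ^ (2 * k - 1) / Im z ^ (2 * k - 1)" .
  have "norm (K l Q) \<le> disc Q powr \<alpha> * exp (Re l * disc Q) / cmod (M Q) ^ k" by (rule norm_K[OF True])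
  also have "\<dots> \<le> (cmod (M Q) ^ (2 * k - 1) / Im z ^ (2 * k - 1)) * 1 / cmod (M Q) ^ k"
    using True assms M Im_z by (intro divide_right_mono mult_mono 1) (auto simp: mult_nonpos_nonneg)
  also have "\<dots> = cmod (M Q) ^ (k - 1) / Im z ^ (2 * k - 1)"
  proof -
    have "2 * k - 1 = (k - 1) + k" using k_ge by simp
    then have "cmod (M Q) ^ (2 * k - 1) = cmod (M Q) ^ (k - 1) * cmod (M Q) ^ k" by (metis power_add)
    then show ?thesis using M by simp
  qed
  finally show ?thesis .
next
  case False
  then show ?thesis using K_zero(1)[of Q l] Im_z by simp
qed

lemma inverse_M_bound:
  assumes "disc Q > 0"
  shows "1 / (1 + cmod (M Q)) ^ 4 \<le> (1 + 3 * Cz) ^ 4 * wt3 Q"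
proof -
  obtain a b c where Q: "Q = (a, b, c)" by (metis prod_cases3)
  define S where "S = 1 + \<bar>a\<bar> + \<bar>b\<bar> + \<bar>c\<bar>"
  have S: "S > 0" by (simp add: S_def add_pos_nonneg)
  have "S \<le> 1 + 3 * Cz * cmod (M Q)"
    using coeff_bounds[of a b c] assms unfolding S_def Q by simp
  also have "\<dots> \<le> (1 + 3 * Cz) * (1 + cmod (M Q))" using Cz_pos by (simp add: algebra_simps)
  finally have "S ^ 4 \<le> ((1 + 3 * Cz) * (1 + cmod (M Q))) ^ 4" using S by (intro power_mono) auto
  then have "1 / (1 + cmod (M Q)) ^ 4 \<le> (1 + 3 * Cz) ^ 4 * (1 / S ^ 4)"
  proof -
    define u v w where "u = (1 + cmod (M Q)) ^ 4" and "v = (1 + 3 * Cz) ^ 4" and "w = S ^ 4"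
    have "w \<le> v * u" using \<open>S ^ 4 \<le> _\<close> by (simp only: u_def v_def w_def power_mult_distrib)
    moreover have "0 < 1 + cmod (M Q)" by (simp add: add_pos_nonneg)
    then have "u > 0" "w > 0" using S unfolding u_def w_def by (simp_all only: zero_less_power)
    ultimately have "1 / u \<le> v * (1 / w)" by (simp add: field_simps)
    then show ?thesis by (simp only: u_def v_def w_def)
  qed
  also have "\<dots> \<le> (1 + 3 * Cz) ^ 4 * wt3 Q"
    using power4_le_wt3[of a b c] Cz_pos unfolding S_def Q by (intro mult_left_mono) auto
  finally show ?thesis .
qed

text \<open>Uniformity in \<open>l\<close> is needed along the whole deformation, and the bound with
  the factor \<open>disc\<close> serves the derivative in the parameter. For |M| >= 1 the
  exponential absorbs the powers of the discriminant and |M|^(-k) gives the decay; for |M| < 1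
  \<open>norm_K_small\<close> suffices.\<close>

lemma K_bound:
  assumes "\<delta> > 0"
  obtains B where "B \<ge> 0" "\<And>l Q. Re l \<le> - \<delta> \<Longrightarrow> norm (K l Q) \<le> B * wt3 Q"
    "\<And>l Q. Re l \<le> - \<delta> \<Longrightarrow> \<bar>disc Q\<bar> * norm (K l Q) \<le> B * wt3 Q"
proof -
  \<comment> \<open>The order \<open>k + 1\<close> is large enough for both exponents \<alpha> and
    \<alpha> + 1 = k + 1/2.\<close>
  define E where "E = 1 + fact (k + 1) / \<delta> ^ (k + 1)"
  define E' where "E' = 1 / Im z ^ (2 * k - 1) * (1 + 1 / (Im z)\<^sup>2)"
  define B where "B = 16 * (E + E') * (1 + 3 * Cz) ^ 4"
  have E: "E \<ge> 0" "E' \<ge> 0" using assms Im_z by (auto simp: E_def E'_def)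
  have main: "norm (K l Q) \<le> (16 * (E + E')) / (1 + cmod (M Q)) ^ 4 \<and>
      disc Q * norm (K l Q) \<le> (16 * (E + E')) / (1 + cmod (M Q)) ^ 4"
    if l: "Re l \<le> - \<delta>" and D: "disc Q > 0" for l Q
  proof -
    define N where "N = cmod (M Q)"
    have N: "N > 0" unfolding N_def using M_pos[OF D] .
    show ?thesis
    proof (cases "N \<ge> 1")
      case True
      have e: "exp (Re l * disc Q) \<le> exp (- \<delta> * disc Q)" using mult_right_mono[OF l, of "disc Q"] D by simp
      have e1: "disc Q powr \<alpha> * exp (- \<delta> * disc Q) \<le> E"
        and e2: "disc Q powr (\<alpha> + 1) * exp (- \<delta> * disc Q) \<le> E"
        unfolding E_def by (rule powr_mult_exp_bound[OF assms D]; use k_ge in \<open>simp add: \<alpha>_def\<close>)+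
      \<comment> \<open>Here \<open>k \<ge> 4\<close> turns the decay of the kernel into the inverse
        fourth power.\<close>
      have p: "1 / N ^ k \<le> 16 / (1 + N) ^ 4"
      proof -
        have "(1 + N) ^ 4 \<le> (2 * N) ^ 4" using True by (intro power_mono) auto
        also have "\<dots> \<le> 16 * N ^ k" using True k_ge by (simp add: power_mult_distrib power_increasing)
        finally show ?thesis using N by (simp add: field_simps add_pos_pos)
      qed
      have "norm (K l Q) \<le> disc Q powr \<alpha> * exp (Re l * disc Q) / N ^ k" unfolding N_def by (rule norm_K[OF D])
      also have "\<dots> \<le> (disc Q powr \<alpha> * exp (- \<delta> * disc Q)) / N ^ k"
        using N by (intro divide_right_mono mult_left_mono e) auto
      finally have 0: "norm (K l Q) \<le> (disc Q powr \<alpha> * exp (- \<delta> * disc Q)) * (1 / N ^ k)" by simp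
      have "\<dots> \<le> E * (16 / (1 + N) ^ 4)"
        using e1 p E(1) N by (intro mult_mono) auto
      with 0 have 1: "norm (K l Q) \<le> E * (16 / (1 + N) ^ 4)" by linarith
      have "disc Q * norm (K l Q) \<le> disc Q * ((disc Q powr \<alpha> * exp (- \<delta> * disc Q)) * (1 / N ^ k))"
        using D 0 by (intro mult_left_mono) auto
      also have "\<dots> = (disc Q powr (\<alpha> + 1) * exp (- \<delta> * disc Q)) * (1 / N ^ k)"
        using D by (simp add: powr_add)
      also have "\<dots> \<le> E * (16 / (1 + N) ^ 4)"
        using e2 p E(1) N by (intro mult_mono) auto
      finally have 2: "disc Q * norm (K l Q) \<le> E * (16 / (1 + N) ^ 4)" .
      have "E * (16 / (1 + N) ^ 4) \<le> (E + E') * (16 / (1 + N) ^ 4)" using E N by (intro mult_right_mono) auto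
      then show ?thesis using 1 2 by (simp add: N_def mult.commute)
    next
      case False
      have "(1 + N) ^ 4 \<le> 2 ^ 4" using False N by (intro power_mono) auto
      then have p: "1 \<le> 16 / (1 + N) ^ 4" using N by (simp add: field_simps add_pos_pos)
      have "norm (K l Q) \<le> N ^ (k - 1) / Im z ^ (2 * k - 1)" unfolding N_def using l assms by (intro norm_K_small) auto
      also have "\<dots> \<le> 1 / Im z ^ (2 * k - 1)" using False N Im_z by (intro divide_right_mono power_le_one) auto
      finally have 1: "norm (K l Q) \<le> 1 / Im z ^ (2 * k - 1)" .
      have "disc Q \<le> N\<^sup>2 / (Im z)\<^sup>2" unfolding N_def by (rule disc_le_M)
      also have "\<dots> \<le> 1 / (Im z)\<^sup>2" using False N Im_z by (intro divide_right_mono power_le_one) auto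
      finally have "disc Q * norm (K l Q) \<le> 1 / (Im z)\<^sup>2 * (1 / Im z ^ (2 * k - 1))"
        using D 1 by (intro mult_mono) auto
      also have "\<dots> = 1 / Im z ^ (2 * k - 1) * (1 / (Im z)\<^sup>2)" by (rule mult.commute)
      also have "\<dots> \<le> E'" unfolding E'_def using Im_z by (intro mult_left_mono) auto
      finally have 2: "disc Q * norm (K l Q) \<le> E'" .
      have "1 / Im z ^ (2 * k - 1) * 1 \<le> E'" unfolding E'_def using Im_z by (intro mult_left_mono) auto
      then have 1: "norm (K l Q) \<le> E'" using 1 by simp
      have "E' * 1 \<le> (E + E') * (16 / (1 + N) ^ 4)" using E by (intro mult_mono p) auto
      then show ?thesis using 1 2 by (simp add: N_def mult.commute)
    qed
  qed
  have fin: "(16 * (E + E')) / (1 + cmod (M Q)) ^ 4 \<le> B * wt3 Q" if "disc Q > 0" for Q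
    using mult_left_mono[OF inverse_M_bound[OF that], of "16 * (E + E')"] E by (simp add: B_def mult.assoc)
  have B: "B \<ge> 0" using E Cz_pos by (auto simp: B_def)
  show ?thesis
  proof (rule that[OF B])
    fix l Q assume l: "Re l \<le> - \<delta>"
    show "norm (K l Q) \<le> B * wt3 Q"
    proof (cases "disc Q > 0")
      case True
      then show ?thesis using main[OF l True] fin[OF True] by linarith
    next
      case False
      then show ?thesis using K_zero(1)[of Q l] B wt3_pos[of Q] by (simp add: less_imp_le)
    qed
    show "\<bar>disc Q\<bar> * norm (K l Q) \<le> B * wt3 Q"
    proof (cases "disc Q > 0")
      case True
      then show ?thesis using main[OF l True] fin[OF True] by linarith
    next
      case False
      then show ?thesis using K_zero(1)[of Q l] B wt3_pos[of Q] by (simp add: less_imp_le)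
    qed
  qed
qed

text \<open>\<open>M\<close> vanishes only at the origin or at forms of negative discriminant. Near
  the latter \<open>K\<close> is zero, and at the origin \<open>norm_K_small\<close> squeezes it to
  0.\<close>

lemma K_continuous:
  assumes "Re l \<le> 0"
  shows "continuous_on UNIV (K l)"
proof (rule continuous_at_imp_continuous_on, intro ballI)
  fix Q :: vec3
  have dc: "isCont disc Q" "isCont M Q" "isCont L Q"
    using disc_continuous M_continuous L_continuous unfolding continuous_on_eq_continuous_at[OF open_UNIV] by blast+
  consider "disc Q < 0" | "Q = 0" | "M Q \<noteq> 0" using M_nonzero[of Q] by linarith
  then show "isCont (K l) Q"
  proof cases
    case 1
    then have "\<forall>\<^sub>F P in nhds Q. disc P < 0"
      using dc(1) order_tendstoD(2) by (auto simp: isCont_def tendsto_at_iff_tendsto_nhds)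
    then have "\<forall>\<^sub>F P in nhds Q. K l P = 0" by eventually_elim (simp add: K_zero)
    then show ?thesis using isCont_cong[of "K l" "\<lambda>_. 0" Q] by simp
  next
    case 2
    have M0: "M Q = 0" "K l Q = 0" using 2 K_zero(1)[of Q l] by (auto simp: M_def disc_def zero_prod_def)
    have "((\<lambda>P. cmod (M P) ^ (k - 1) / Im z ^ (2 * k - 1)) \<longlongrightarrow> cmod (M Q) ^ (k - 1) / Im z ^ (2 * k - 1)) (at Q)"
      using dc(2) Im_z unfolding isCont_def by (intro tendsto_intros) auto
    moreover have "cmod (M Q) ^ (k - 1) / Im z ^ (2 * k - 1) = 0" using M0 k_ge by (simp add: power_0_left)
    ultimately have "((\<lambda>P. cmod (M P) ^ (k - 1) / Im z ^ (2 * k - 1)) \<longlongrightarrow> 0) (at Q)" by metis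
    then have "(K l \<longlongrightarrow> 0) (at Q)"
      by (rule Lim_null_comparison[rotated]) (use norm_K_small[OF assms] in simp)
    then show ?thesis using M0 by (simp add: isCont_def)
  next
    case 3
    have "isCont (pos_powr \<alpha>) (disc Q)"
      using continuous_on_pos_powr[of \<alpha>] alpha_gt by (simp add: continuous_on_eq_continuous_at)
    then have "isCont (\<lambda>Q. pos_powr \<alpha> (disc Q)) Q" using dc(1) isCont_o2 by blast
    then show ?thesis unfolding K_def[abs_def] T_def using 3 dc by (intro continuous_intros) auto
  qed
qed

end

section \<open>Deformation along a parabolic subgroup\<close>

context form_kernel
begin

definition \<kappa> :: real where "\<kappa> = real k + 1 / 2"

lemma K_param_deriv:
  assumes "(l has_vector_derivative l') (at s within S)"
  shows "((\<lambda>s. K (l s) Q) has_vector_derivative (l' * of_real (disc Q)) * K (l s) Q) (at s within S)"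
proof -
  define c where "c = of_real (L Q) * (complex_of_real (pos_powr \<alpha> (disc Q)) * inverse (M Q ^ Suc k))"
  have K: "K l Q = c * exp (l * of_real (disc Q))" for l
    by (simp add: K_def T_def c_def)
  have "((\<lambda>s. l s * of_real (disc Q)) has_vector_derivative l' * of_real (disc Q)) (at s within S)"
    by (intro has_vector_derivative_mult_left assms)
  from has_vector_derivative_mult_right[OF field_vector_diff_chain_within[OF this has_field_derivative_at_within[OF DERIV_exp]], of c]
  show ?thesis unfolding K by (simp add: o_def mult_ac)
qed

context
  fixes \<tau> :: complex
  assumes \<tau>: "Im \<tau> > 0"
begin

definition J :: "real \<Rightarrow> complex" where "J s = 4 * of_real s * \<tau> + 1"
definition \<tau>s :: "real \<Rightarrow> complex" where "\<tau>s s = \<tau> / J s"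
definition ls :: "real \<Rightarrow> complex" where "ls s = 2 * of_real pi * \<i> * \<tau>s s"
definition w :: "real \<Rightarrow> complex" where "w s = inverse (csqrt (J s) ^ (2 * k + 1))"

text \<open>\<open>J 0 = 1\<close> and Im (J s) > 0 for s > 0, so the path avoids the branch cut and
  \<open>w\<close> is differentiable along it.\<close>

lemma J_nonpos: "s \<ge> 0 \<Longrightarrow> J s \<notin> \<real>\<^sub>\<le>\<^sub>0"
  using \<tau> by (cases "s = 0") (auto simp: J_def complex_nonpos_Reals_iff)

lemma J_nz: "s \<ge> 0 \<Longrightarrow> J s \<noteq> 0"
  using J_nonpos by fastforce

lemma J_deriv: "(J has_vector_derivative 4 * \<tau>) (at s within S)"
  unfolding J_def by (auto intro!: derivative_eq_intros)

lemma ls_deriv: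
  assumes "s \<ge> 0"
  shows "(ls has_vector_derivative - 8 * of_real pi * \<i> * (\<tau>s s)\<^sup>2) (at s within S)"
proof -
  have "((\<lambda>v. 2 * of_real pi * \<i> * (\<tau> / v)) has_field_derivative - (2 * of_real pi * \<i> * \<tau> / (J s)\<^sup>2)) (at (J s) within J ` S)"
    using J_nz[OF assms] by (auto intro!: derivative_eq_intros simp: power2_eq_square field_simps)
  from field_vector_diff_chain_within[OF J_deriv this] show ?thesis
    unfolding ls_def[abs_def] \<tau>s_def o_def
    by (rule has_vector_derivative_eq_rhs) (simp add: power2_eq_square)
qed

lemma w_deriv:
  assumes "s \<ge> 0"
  shows "(w has_vector_derivative - 4 * of_real \<kappa> * \<tau>s s * w s) (at s within S)"
proof -
  define m where "m = 2 * k + 1"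
  have nz: "csqrt (J s) \<noteq> 0" using J_nz[OF assms] by simp
  have sq: "csqrt (J s) * csqrt (J s) = J s" by (metis power2_csqrt power2_eq_square)
  have 1: "(csqrt has_field_derivative inverse (2 * csqrt (J s))) (at (J s) within J ` S)"
    by (rule has_field_derivative_at_within[OF has_field_derivative_csqrt[OF J_nonpos[OF assms]]])
  have "((\<lambda>v. inverse (csqrt v ^ m)) has_field_derivative
      - (inverse (csqrt (J s) ^ m) * (of_nat m * (inverse (2 * csqrt (J s)) * csqrt (J s) ^ (m - Suc 0))) * inverse (csqrt (J s) ^ m))) (at (J s) within J ` S)"
    using nz by (intro DERIV_inverse' DERIV_power 1) simp
  moreover have "- (inverse (csqrt (J s) ^ m) * (of_nat m * (inverse (2 * csqrt (J s)) * csqrt (J s) ^ (m - Suc 0))) * inverse (csqrt (J s) ^ m))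
    = - (of_real \<kappa> * inverse (csqrt (J s) ^ m) / J s)"
  proof -
    have "csqrt (J s) ^ m = csqrt (J s) * csqrt (J s) ^ (m - 1)" by (simp add: m_def)
    then have a: "inverse (2 * csqrt (J s)) * csqrt (J s) ^ (m - Suc 0) * inverse (csqrt (J s) ^ m) = 1 / (2 * (csqrt (J s) * csqrt (J s)))"
      using nz by (simp add: field_simps)
    have "- (inverse (csqrt (J s) ^ m) * (of_nat m * (inverse (2 * csqrt (J s)) * csqrt (J s) ^ (m - Suc 0))) * inverse (csqrt (J s) ^ m))
      = - (inverse (csqrt (J s) ^ m) * of_nat m * (inverse (2 * csqrt (J s)) * csqrt (J s) ^ (m - Suc 0) * inverse (csqrt (J s) ^ m)))"
      by (simp only: mult.assoc)
    also have "\<dots> = - (inverse (csqrt (J s) ^ m) * of_nat m * (1 / (2 * J s)))" unfolding a sq ..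
    also have "\<dots> = - (of_real \<kappa> * inverse (csqrt (J s) ^ m) / J s)"
      by (simp add: m_def \<kappa>_def field_simps del: csqrt.simps)
    finally show ?thesis .
  qed
  ultimately have "((\<lambda>v. inverse (csqrt v ^ m)) has_field_derivative - (of_real \<kappa> * inverse (csqrt (J s) ^ m) / J s)) (at (J s) within J ` S)"
    by (simp only:)
  from field_vector_diff_chain_within[OF J_deriv this] have
    "(((\<lambda>v. inverse (csqrt v ^ m)) \<circ> J) has_vector_derivative 4 * \<tau> * - (of_real \<kappa> * inverse (csqrt (J s) ^ m) / J s)) (at s within S)" .
  moreover have "w = (\<lambda>v. inverse (csqrt v ^ m)) \<circ> J" by (auto simp: w_def m_def)
  moreover have "4 * \<tau> * - (of_real \<kappa> * inverse (csqrt (J s) ^ m) / J s) = - 4 * of_real \<kappa> * \<tau>s s * w s"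
    by (simp add: \<tau>s_def w_def m_def del: csqrt.simps)
  ultimately show ?thesis by metis
qed

lemma J_le: "s \<in> {0..1} \<Longrightarrow> cmod (J s) \<le> 4 * cmod \<tau> + 1"
proof -
  assume s: "s \<in> {0..1}"
  have "cmod (J s) \<le> cmod (4 * of_real s * \<tau>) + 1" unfolding J_def by (rule order_trans[OF norm_triangle_ineq]) simp
  also have "cmod (4 * of_real s * \<tau>) \<le> 4 * 1 * cmod \<tau>" unfolding norm_mult using s by (intro mult_mono) auto
  finally show ?thesis by simp
qed

text \<open>A lower bound for 2 pi Im (W^s \<tau>) = 2 pi Im \<tau> / |J s|^2 on [0, 1], from |J s|
  <= 4 |\<tau>| + 1.\<close>

definition \<delta> :: real where "\<delta> = 2 * pi * Im \<tau> / (4 * cmod \<tau> + 1)\<^sup>2"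

lemma \<delta>_pos: "\<delta> > 0"
  unfolding \<delta>_def using \<tau> by (intro divide_pos_pos mult_pos_pos zero_less_power add_nonneg_pos) auto

lemma Re_ls: "s \<in> {0..1} \<Longrightarrow> Re (ls s) \<le> - \<delta>"
proof -
  assume s: "s \<in> {0..1}"
  have J: "cmod (J s) > 0" using J_nz[of s] s by simp
  have "Im (\<tau>s s) = Im \<tau> / (cmod (J s))\<^sup>2"
    unfolding \<tau>s_def by (simp add: Im_divide cmod_power2 J_def algebra_simps)
  moreover have "0 < 4 * cmod \<tau> + 1" by (simp add: add_nonneg_pos)
  have "Im \<tau> / (4 * cmod \<tau> + 1)\<^sup>2 \<le> Im \<tau> / (cmod (J s))\<^sup>2"
    by (intro divide_left_mono power_mono mult_pos_pos zero_less_power J J_le[OF s] norm_ge_zero less_imp_le[OF \<tau>]) fact+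
  ultimately have "2 * pi * (Im \<tau> / (4 * cmod \<tau> + 1)\<^sup>2) \<le> 2 * pi * Im (\<tau>s s)" by (intro mult_left_mono) auto
  then show ?thesis by (simp add: ls_def \<delta>_def)
qed

lemma w_bounded: obtains W where "W \<ge> 0" "\<And>s. s \<in> {0..1} \<Longrightarrow> cmod (w s) \<le> W" "\<And>s. s \<in> {0..1} \<Longrightarrow> cmod (\<tau>s s) \<le> W"
proof -
  have "continuous_on {0..1} w"
    using w_deriv by (intro continuous_on_vector_derivative) auto
  then have "bounded (w ` {0..1})" by (intro compact_imp_bounded compact_continuous_image) auto
  then obtain W1 where W1: "\<And>s. s \<in> {0..1} \<Longrightarrow> cmod (w s) \<le> W1" unfolding bounded_iff by blast
  have "continuous_on {0..1} \<tau>s"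
    unfolding \<tau>s_def[abs_def] J_def using J_nz by (intro continuous_intros) (auto simp: J_def)
  then have "bounded (\<tau>s ` {0..1})" by (intro compact_imp_bounded compact_continuous_image) auto
  then obtain W2 where W2: "\<And>s. s \<in> {0..1} \<Longrightarrow> cmod (\<tau>s s) \<le> W2" unfolding bounded_iff by blast
  show ?thesis
    by (rule that[of "max (max W1 W2) 0"]) (use W1 W2 in \<open>auto simp: le_max_iff_disj\<close>)
qed

definition rate :: "int \<Rightarrow> real \<Rightarrow> vec3 \<Rightarrow> complex" where
  "rate n s Q = - 4 * of_real \<kappa> * \<tau>s s - 8 * of_real pi * \<i> * (\<tau>s s)\<^sup>2 * of_real (disc Q) + 2 * of_real pi * \<i> * of_int n"

text \<open>The twist by exp (2 pi i n s) with n = q^2 - p r undoes the rotation of the Fourier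
  coefficient at frequency (p, q, r), so that this coefficient becomes constant in s. It is trivial
  at s = 0 and s = 1.\<close>

definition \<Phi> :: "int \<Rightarrow> real \<Rightarrow> vec3 \<Rightarrow> complex" where
  "\<Phi> n s Q = w s * exp (2 * of_real pi * \<i> * of_int n * of_real s) * K (ls s) Q"

lemma \<Phi>_deriv:
  assumes "s \<ge> 0"
  shows "((\<lambda>s. \<Phi> n s Q) has_vector_derivative
     rate n s Q * \<Phi> n s Q)
     (at s within S)"
proof -
  have "((\<lambda>x. 2 * of_real pi * \<i> * of_int n * of_real x) has_vector_derivative 2 * of_real pi * \<i> * of_int n) (at s within S)"
    by (auto intro!: derivative_eq_intros)
  from field_vector_diff_chain_within[OF this has_field_derivative_at_within[OF DERIV_exp]]
  have E: "((\<lambda>s. exp (2 * of_real pi * \<i> * of_int n * of_real s)) has_vector_derivative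
     2 * of_real pi * \<i> * of_int n * exp (2 * of_real pi * \<i> * of_int n * of_real s)) (at s within S)"
    by (simp add: o_def)
  show ?thesis unfolding \<Phi>_def rate_def
    by (rule has_vector_derivative_eq_rhs[OF has_vector_derivative_mult[OF has_vector_derivative_mult[OF w_deriv[OF assms] E] K_param_deriv[OF ls_deriv[OF assms]]]])
       (simp add: algebra_simps)
qed

text \<open>At l = 2 pi i W^s \<tau>, i / (2 pi) times the two coefficients of \<open>box_K\<close>
  gives the logarithmic derivative of \<open>w\<close> and the contribution of l' to the
  exponential; this is why \<open>w\<close> carries the weight \<kappa>.\<close>

lemma \<Phi>_deriv_box:
  "rate n s Q * \<Phi> n s Q
   = \<i> / (2 * of_real pi) * (w s * exp (2 * of_real pi * \<i> * of_int n * of_real s)) *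
     ((Kbb (ls s) Q - Kca (ls s) Q) + 4 * (of_real pi)\<^sup>2 * of_int n * K (ls s) Q)"
  unfolding rate_def box_K \<Phi>_def \<kappa>_def[symmetric] ls_def by (simp add: field_simps power2_eq_square)

lemma norm_exp_2pi_i [simp]: "norm (exp (2 * of_real pi * \<i> * of_int n * of_real s)) = 1"
  by (simp add: norm_exp_eq_Re)

lemma \<Phi>_bounds:
  obtains D where "D \<ge> 0" "\<And>s Q. s \<in> {0..1} \<Longrightarrow> norm (\<Phi> n s Q) \<le> D * wt3 Q"
    "\<And>s Q. s \<in> {0..1} \<Longrightarrow> norm (rate n s Q * \<Phi> n s Q) \<le> D * wt3 Q"
    "\<And>s Q. s \<in> {0..1} \<Longrightarrow> norm (w s) * norm (K (ls s) Q) \<le> D * wt3 Q"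
proof -
  obtain b where b: "b \<ge> 0" "\<And>l Q. Re l \<le> - \<delta> \<Longrightarrow> norm (K l Q) \<le> b * wt3 Q"
    "\<And>l Q. Re l \<le> - \<delta> \<Longrightarrow> \<bar>disc Q\<bar> * norm (K l Q) \<le> b * wt3 Q"
    using K_bound[OF \<delta>_pos] by metis
  obtain W where W: "W \<ge> 0" "\<And>s. s \<in> {0..1} \<Longrightarrow> cmod (w s) \<le> W" "\<And>s. s \<in> {0..1} \<Longrightarrow> cmod (\<tau>s s) \<le> W"
    using w_bounded by metis
  have \<kappa>: "\<kappa> \<ge> 0" by (simp add: \<kappa>_def)
  define D0 where "D0 = W * b"
  define D1 where "D1 = 4 * \<kappa> * W + 8 * pi * W\<^sup>2 + 2 * pi * \<bar>of_int n\<bar>"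
  have pos: "0 \<le> D0" "0 \<le> D1" using W b \<kappa> by (auto simp: D0_def D1_def)
  have n\<Phi>: "norm (\<Phi> n s Q) = norm (w s) * norm (K (ls s) Q)" for s Q by (simp add: \<Phi>_def norm_mult)
  have 0: "norm (w s) * norm (K (ls s) Q) \<le> D0 * wt3 Q" if s: "s \<in> {0..1}" for s Q
    using mult_mono[OF W(2)[OF s] b(2)[OF Re_ls[OF s], of Q] W(1)] by (simp add: D0_def mult.assoc)
  have 1: "\<bar>disc Q\<bar> * norm (\<Phi> n s Q) \<le> D0 * wt3 Q" if s: "s \<in> {0..1}" for s Q
    using mult_mono[OF W(2)[OF s] b(3)[OF Re_ls[OF s], of Q] W(1)] unfolding n\<Phi> by (simp add: D0_def mult_ac)
  have 2: "norm (rate n s Q * \<Phi> n s Q)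
      \<le> D1 * D0 * wt3 Q" if s: "s \<in> {0..1}" for s Q
  proof -
    define t where "t = cmod (\<tau>s s)"
    have t: "0 \<le> t" "t \<le> W" using W(3)[OF s] by (auto simp: t_def)
    have "norm (rate n s Q)
      \<le> norm (- 4 * of_real \<kappa> * \<tau>s s) + norm (8 * of_real pi * \<i> * (\<tau>s s)\<^sup>2 * of_real (disc Q)) + norm (2 * of_real pi * \<i> * of_int n :: complex)"
      unfolding rate_def by (intro order_trans[OF norm_triangle_ineq] add_right_mono norm_triangle_ineq4)
    also have "\<dots> = 4 * \<kappa> * t + 8 * pi * t\<^sup>2 * \<bar>disc Q\<bar> + 2 * pi * \<bar>of_int n\<bar>"
      using \<kappa> by (simp add: norm_mult norm_power t_def)
    finally have "norm (rate n s Q * \<Phi> n s Q)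
       \<le> (4 * \<kappa> * t + 8 * pi * t\<^sup>2 * \<bar>disc Q\<bar> + 2 * pi * \<bar>of_int n\<bar>) * norm (\<Phi> n s Q)"
      unfolding norm_mult by (intro mult_right_mono) (simp_all add: norm_mult)
    also have "\<dots> = 4 * \<kappa> * t * norm (\<Phi> n s Q) + 8 * pi * t\<^sup>2 * (\<bar>disc Q\<bar> * norm (\<Phi> n s Q)) + 2 * pi * \<bar>of_int n\<bar> * norm (\<Phi> n s Q)"
      by (simp add: algebra_simps)
    also have "\<dots> \<le> 4 * \<kappa> * W * (D0 * wt3 Q) + 8 * pi * W\<^sup>2 * (D0 * wt3 Q) + 2 * pi * \<bar>of_int n\<bar> * (D0 * wt3 Q)"
    proof -
      define P P2 d where "P = norm (\<Phi> n s Q)" and "P2 = \<bar>disc Q\<bar> * norm (\<Phi> n s Q)" and "d = D0 * wt3 Q"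
      have P: "0 \<le> P" "0 \<le> P2" "P \<le> d" "P2 \<le> d"
        using 0[OF s, of Q] 1[OF s, of Q] by (simp_all add: P_def P2_def d_def n\<Phi>)
      have "4 * \<kappa> * t * P \<le> 4 * \<kappa> * W * d"
        using t \<kappa> W(1) P by (intro mult_mono) auto
      moreover have "8 * pi * t\<^sup>2 * P2 \<le> 8 * pi * W\<^sup>2 * d"
        using t W(1) P by (intro mult_mono power_mono) auto
      moreover have "2 * pi * \<bar>of_int n\<bar> * P \<le> 2 * pi * \<bar>of_int n\<bar> * d"
        using P by (intro mult_left_mono) auto
      ultimately show ?thesis
        unfolding P2_def[symmetric] d_def[symmetric] unfolding P_def[symmetric] by (intro add_mono)
    qed
    also have "\<dots> = D1 * D0 * wt3 Q" by (simp add: D1_def algebra_simps)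
    finally show ?thesis .
  qed
  have le: "D0 * wt3 Q \<le> (1 + D1) * D0 * wt3 Q" "D1 * D0 * wt3 Q \<le> (1 + D1) * D0 * wt3 Q" for Q
    using pos less_imp_le[OF wt3_pos[of Q]] by (auto intro!: mult_right_mono simp: distrib_right mult_nonneg_nonneg)
  show ?thesis
  proof (rule that[of "(1 + D1) * D0"])
    show "0 \<le> (1 + D1) * D0" using pos by simp
    fix s :: real and Q assume s: "s \<in> {0..1}"
    show "norm (\<Phi> n s Q) \<le> (1 + D1) * D0 * wt3 Q" unfolding n\<Phi> by (rule order_trans[OF 0[OF s] le(1)])
    show "norm (w s) * norm (K (ls s) Q) \<le> (1 + D1) * D0 * wt3 Q" by (rule order_trans[OF 0[OF s] le(1)])
    show "norm (rate n s Q * \<Phi> n s Q)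
      \<le> (1 + D1) * D0 * wt3 Q"
      by (rule order_trans[OF 2[OF s] le(2)])
  qed
qed

lemma \<Phi>_measurable: "\<Phi> n s \<in> borel_measurable borel"
  unfolding \<Phi>_def[abs_def] by (intro borel_measurable_times borel_measurable_const K_measurable)

definition \<psi> :: "real \<Rightarrow> int \<Rightarrow> int \<Rightarrow> int \<Rightarrow> vec3 \<Rightarrow> complex" where
  "\<psi> \<epsilon> p q r = tensor (gauss \<epsilon> p) (gauss \<epsilon> q) (gauss \<epsilon> r)"

lemma \<psi>_measurable: "\<psi> \<epsilon> p q r \<in> borel_measurable borel"
  unfolding \<psi>_def by (intro tensor_measurable gauss_continuous)

lemma norm_\<psi>: "\<epsilon> \<ge> 0 \<Longrightarrow> norm (\<psi> \<epsilon> p q r Q) \<le> 1"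
  by (cases Q) (auto simp: \<psi>_def tensor_def norm_mult norm_gauss intro!: mult_le_one)

lemma integrable_\<Phi>_mult:
  assumes "s \<in> {0..1}" "g \<in> borel_measurable borel" "\<And>Q. norm (g Q) \<le> 1"
  shows "integrable lborel (\<lambda>Q. \<Phi> n s Q * g Q)"
proof -
  obtain D where "\<And>s Q. s \<in> {0..1} \<Longrightarrow> norm (\<Phi> n s Q) \<le> D * wt3 Q" using \<Phi>_bounds by metis
  then have "nice (\<Phi> n s)" using assms(1) by (intro niceI \<Phi>_measurable) blast
  then show ?thesis using assms(2,3) by (intro integrable_mult_bounded nice_integrable)
qed

text \<open>The pairing with the damped character has derivative in s equal to the integral of
  \<open>K\<close> against box \<psi> + 4 pi^2 n \<psi>, up to a bounded factor. By the choice of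
  \<open>n\<close> this function is O(sqrt \<epsilon>), and the constant \<open>E\<close> does not
  depend on \<epsilon>.\<close>

lemma \<Phi>_\<psi>_bound:
  assumes n: "n = q\<^sup>2 - p * r"
  shows "\<exists>E. \<forall>\<epsilon>. 0 < \<epsilon> \<longrightarrow> \<epsilon> \<le> 1 \<longrightarrow>
    norm ((\<integral>Q. \<Phi> n 1 Q * \<psi> \<epsilon> p q r Q \<partial>lborel) - (\<integral>Q. \<Phi> n 0 Q * \<psi> \<epsilon> p q r Q \<partial>lborel)) \<le> E * sqrt \<epsilon>"
proof -
  obtain D where D: "D \<ge> 0" "\<And>s Q. s \<in> {0..1} \<Longrightarrow> norm (\<Phi> n s Q) \<le> D * wt3 Q"
    "\<And>s Q. s \<in> {0..1} \<Longrightarrow> norm (rate n s Q * \<Phi> n s Q) \<le> D * wt3 Q"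
    "\<And>s Q. s \<in> {0..1} \<Longrightarrow> norm (w s) * norm (K (ls s) Q) \<le> D * wt3 Q"
    using \<Phi>_bounds[of n] by metis
  define c0 where "c0 = 8 * pi * \<bar>of_int q\<bar> + 4 * pi * \<bar>of_int p\<bar> + 4 * pi * \<bar>of_int r\<bar> + 10"
  define E where "E = (\<integral>Q. D * wt3 Q * c0 \<partial>lborel)"
  have c0: "c0 \<ge> 0" by (simp add: c0_def)
  define F' where "F' s Q = rate n s Q * \<Phi> n s Q" for s Q
  have F'_meas: "F' s \<in> borel_measurable borel" for s
    unfolding F'_def[abs_def] rate_def
    by (intro borel_measurable_times borel_measurable_add borel_measurable_diff borel_measurable_const \<Phi>_measurable
        borel_measurable_continuous_onI[OF continuous_on_of_real[OF disc_continuous]])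
  have "norm ((\<integral>Q. \<Phi> n 1 Q * \<psi> \<epsilon> p q r Q \<partial>lborel) - (\<integral>Q. \<Phi> n 0 Q * \<psi> \<epsilon> p q r Q \<partial>lborel)) \<le> (E * sqrt \<epsilon>) * norm (1 - 0 :: real)"
    if \<epsilon>: "0 < \<epsilon>" "\<epsilon> \<le> 1" for \<epsilon>
  proof (rule vector_derivative_bound[where S = "{0..1}" and f = "\<lambda>s. \<integral>Q. \<Phi> n s Q * \<psi> \<epsilon> p q r Q \<partial>lborel"
        and f' = "\<lambda>s. \<integral>Q. F' s Q * \<psi> \<epsilon> p q r Q \<partial>lborel"])
    fix s :: real assume s: "s \<in> {0..1}"
    show "((\<lambda>s. \<integral>Q. \<Phi> n s Q * \<psi> \<epsilon> p q r Q \<partial>lborel) has_vector_derivative (\<integral>Q. F' s Q * \<psi> \<epsilon> p q r Q \<partial>lborel)) (at s within {0..1})"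
    proof (rule has_vector_derivative_lebesgue_integral[where w = "\<lambda>Q. D * wt3 Q" and S = "{0..1}" and F = "\<lambda>s Q. \<Phi> n s Q * \<psi> \<epsilon> p q r Q" and F' = "\<lambda>s Q. F' s Q * \<psi> \<epsilon> p q r Q"])
      show "integrable lborel (\<lambda>Q. \<Phi> n s Q * \<psi> \<epsilon> p q r Q)" if "s \<in> {0..1}" for s
        using that \<epsilon> by (intro integrable_\<Phi>_mult \<psi>_measurable norm_\<psi>) auto
      show "((\<lambda>s. \<Phi> n s Q * \<psi> \<epsilon> p q r Q) has_vector_derivative F' s Q * \<psi> \<epsilon> p q r Q) (at s within {0..1})" if "s \<in> {0..1}" for s Q
        unfolding F'_def using that by (intro has_vector_derivative_mult_left \<Phi>_deriv) auto
      show "norm (F' s Q * \<psi> \<epsilon> p q r Q) \<le> D * wt3 Q" if "s \<in> {0..1}" for s Q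
      proof -
        have "norm (F' s Q * \<psi> \<epsilon> p q r Q) \<le> norm (F' s Q)"
          unfolding norm_mult using norm_\<psi>[of \<epsilon> p q r Q] \<epsilon> by (intro mult_left_le) auto
        also have "\<dots> \<le> D * wt3 Q" unfolding F'_def by (rule D(3)[OF that])
        finally show ?thesis .
      qed
      show "integrable lborel (\<lambda>Q. D * wt3 Q)" by (intro integrable_mult_right integrable_wt3)
      show "(\<lambda>Q. F' s Q * \<psi> \<epsilon> p q r Q) \<in> borel_measurable lborel"
        unfolding measurable_lborel2 by (intro borel_measurable_times F'_meas \<psi>_measurable)
    qed (use s in auto)
    define g where "g m t = gauss_log_deriv \<epsilon> m t * gauss \<epsilon> m t" for m t
    define g2 where "g2 m t = ((gauss_log_deriv \<epsilon> m t)\<^sup>2 - 2 * of_real \<epsilon>) * gauss \<epsilon> m t" for m t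
    have l: "Re (ls s) \<le> 0" using Re_ls[OF s] \<delta>_pos by linarith
    have cg: "continuous_on UNIV (g m)" "continuous_on UNIV (g2 m)" for m
      unfolding g_def[abs_def] g2_def[abs_def] by (intro continuous_intros gauss_continuous)+
    have rg: "rapid (gauss \<epsilon> m)" "rapid (g m)" "rapid (g2 m)" for m
      unfolding g_def[abs_def] g2_def[abs_def] by (intro rapid_gauss \<epsilon>)+
    have dg: "(gauss \<epsilon> m has_vector_derivative g m t) (at t)" "(g m has_vector_derivative g2 m t) (at t)" for m t
      unfolding g_def[abs_def] g2_def[abs_def] by (intro gauss_deriv gauss_deriv2)+
    note wb = weak_box[OF l rg(1)[of p] rg(2)[of p] rg(1)[of q] rg(2)[of q] rg(3)[of q] rg(1)[of r] rg(2)[of r]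
        cg(1)[of p] cg(2)[of q] cg(1)[of r] dg(1)[of p] dg(1)[of q] dg(2)[of q] dg(1)[of r]]
    define u where "u = \<i> / (2 * of_real pi) * (w s * exp (2 * of_real pi * \<i> * of_int n * of_real s))"
    \<comment> \<open>\<open>G\<close> is box \<psi> + 4 pi^2 n \<psi>, written in the form that
      \<open>gauss_box_bound\<close> estimates.\<close>
    define G where "G = (\<lambda>(a, b, c). (((gauss_log_deriv \<epsilon> q b)\<^sup>2 - 2 * of_real \<epsilon>) - gauss_log_deriv \<epsilon> p a * gauss_log_deriv \<epsilon> r c + 4 * of_real pi ^ 2 * of_int (q\<^sup>2 - p * r))
      * (gauss \<epsilon> p a * gauss \<epsilon> q b * gauss \<epsilon> r c))"
    have iK: "integrable lborel (\<lambda>Q. K (ls s) Q * \<psi> \<epsilon> p q r Q)"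
    proof (intro nice_integrable)
      obtain b where b: "\<And>l Q. Re l \<le> - \<delta> \<Longrightarrow> norm (K l Q) \<le> b * wt3 Q" using K_bound[OF \<delta>_pos] by metis
      show "nice (\<lambda>Q. K (ls s) Q * \<psi> \<epsilon> p q r Q)"
      proof (rule niceI[where C = b])
        show "norm (K (ls s) Q * \<psi> \<epsilon> p q r Q) \<le> b * wt3 Q" for Q
          unfolding norm_mult using norm_\<psi>[of \<epsilon> p q r Q] \<epsilon> b[OF Re_ls[OF s], of Q]
          by (intro order_trans[OF mult_left_le]) auto
      qed (intro borel_measurable_times K_measurable \<psi>_measurable)
    qed
    have iKK: "integrable lborel (\<lambda>Q. (Kbb (ls s) Q - Kca (ls s) Q) * \<psi> \<epsilon> p q r Q)"
    proof -
      have "nice (\<lambda>Q. Kbb (ls s) Q * \<psi> \<epsilon> p q r Q)" "nice (\<lambda>Q. Kca (ls s) Q * \<psi> \<epsilon> p q r Q)"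
        unfolding \<psi>_def
        by (rule nice_tensor[OF graded_K(4)[OF l] K_zero(4) K_measurable(4) rg(1) rg(1) rg(1) gauss_continuous(1) gauss_continuous(1) gauss_continuous(1)]
            nice_tensor[OF graded_K(5)[OF l] K_zero(5) K_measurable(5) rg(1) rg(1) rg(1) gauss_continuous(1) gauss_continuous(1) gauss_continuous(1)], assumption)+
      then show ?thesis unfolding left_diff_distrib by (intro Bochner_Integration.integrable_diff nice_integrable)
    qed
    have "(\<integral>Q. F' s Q * \<psi> \<epsilon> p q r Q \<partial>lborel)
      = (\<integral>Q. u * ((Kbb (ls s) Q - Kca (ls s) Q) * \<psi> \<epsilon> p q r Q + 4 * (of_real pi)\<^sup>2 * of_int n * (K (ls s) Q * \<psi> \<epsilon> p q r Q)) \<partial>lborel)"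
      unfolding F'_def \<Phi>_deriv_box u_def by (intro Bochner_Integration.integral_cong refl) (simp add: algebra_simps)
    also have "\<dots> = u * ((\<integral>Q. (Kbb (ls s) Q - Kca (ls s) Q) * \<psi> \<epsilon> p q r Q \<partial>lborel)
        + 4 * (of_real pi)\<^sup>2 * of_int n * (\<integral>Q. K (ls s) Q * \<psi> \<epsilon> p q r Q \<partial>lborel))"
      using iK iKK by simp
    also have "(\<integral>Q. (Kbb (ls s) Q - Kca (ls s) Q) * \<psi> \<epsilon> p q r Q \<partial>lborel)
       = (\<integral>Q. K (ls s) Q * tensor (gauss \<epsilon> p) (g2 q) (gauss \<epsilon> r) Q \<partial>lborel) - (\<integral>Q. K (ls s) Q * tensor (g p) (gauss \<epsilon> q) (g r) Q \<partial>lborel)"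
      unfolding \<psi>_def by (rule wb(3))
    also have "u * (\<dots> + 4 * (of_real pi)\<^sup>2 * of_int n * (\<integral>Q. K (ls s) Q * \<psi> \<epsilon> p q r Q \<partial>lborel))
       = u * (\<integral>Q. (K (ls s) Q * tensor (gauss \<epsilon> p) (g2 q) (gauss \<epsilon> r) Q - K (ls s) Q * tensor (g p) (gauss \<epsilon> q) (g r) Q)
          + 4 * (of_real pi)\<^sup>2 * of_int n * (K (ls s) Q * \<psi> \<epsilon> p q r Q) \<partial>lborel)"
      using wb(1,2)[THEN nice_integrable] iK by simp
    also have "\<dots> = u * (\<integral>Q. K (ls s) Q * G Q \<partial>lborel)"
      by (intro arg_cong2[where f = "(*)"] refl Bochner_Integration.integral_cong)
         (simp add: G_def \<psi>_def tensor_def g_def g2_def n case_prod_unfold algebra_simps)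
    also have "\<dots> = (\<integral>Q. u * (K (ls s) Q * G Q) \<partial>lborel)" by simp
    finally have eq: "(\<integral>Q. F' s Q * \<psi> \<epsilon> p q r Q \<partial>lborel) = (\<integral>Q. u * (K (ls s) Q * G Q) \<partial>lborel)" .
    have nu: "norm u \<le> norm (w s)"
    proof -
      have "norm u = norm (w s) / (2 * pi)" by (simp add: u_def norm_mult norm_divide)
      also have "\<dots> \<le> norm (w s)" using pi_gt3 mult_left_mono[of 1 "2 * pi" "norm (w s)"] by (simp add: divide_le_eq)
      finally show ?thesis .
    qed
    have "norm (\<integral>Q. u * (K (ls s) Q * G Q) \<partial>lborel) \<le> (\<integral>Q. D * wt3 Q * c0 * sqrt \<epsilon> \<partial>lborel)"
    proof (rule Bochner_Integration.integral_norm_bound_integral)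
      have GM: "G \<in> borel_measurable borel"
        unfolding G_def case_prod_unfold
        by (intro borel_measurable_continuous_onI continuous_intros
            continuous_on_compose2[OF gauss_continuous(1)] continuous_on_compose2[OF gauss_continuous(2)]) auto
      have bd: "norm (u * (K (ls s) Q * G Q)) \<le> D * wt3 Q * c0 * sqrt \<epsilon>" for Q
      proof -
        have "norm (G Q) \<le> c0 * sqrt \<epsilon>"
          unfolding G_def c0_def using gauss_box_bound[OF \<epsilon>] by (simp add: case_prod_unfold)
        moreover have "norm u * norm (K (ls s) Q) \<le> D * wt3 Q"
          using D(4)[OF s, of Q] mult_right_mono[OF nu, of "norm (K (ls s) Q)"] by simp
        ultimately have "(norm u * norm (K (ls s) Q)) * norm (G Q) \<le> (D * wt3 Q) * (c0 * sqrt \<epsilon>)"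
          using D(1) less_imp_le[OF wt3_pos[of Q]] by - (rule mult_mono, auto)
        then show ?thesis by (simp add: norm_mult mult.assoc)
      qed
      then show "norm (u * (K (ls s) Q * G Q)) \<le> D * wt3 Q * c0 * sqrt \<epsilon>" for Q .
      show iw: "integrable lborel (\<lambda>Q. D * wt3 Q * c0 * sqrt \<epsilon>)" by (intro integrable_mult_left integrable_mult_right integrable_wt3)
      show "integrable lborel (\<lambda>Q. u * (K (ls s) Q * G Q))"
      proof (intro nice_integrable niceI[where C = "D * c0 * sqrt \<epsilon>"])
        show "(\<lambda>Q. u * (K (ls s) Q * G Q)) \<in> borel_measurable borel"
          by (intro borel_measurable_times borel_measurable_const K_measurable GM)
        show "norm (u * (K (ls s) Q * G Q)) \<le> D * c0 * sqrt \<epsilon> * wt3 Q" for Q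
          using bd[of Q] by (simp only: mult_ac)
      qed
    qed
    also have "\<dots> = E * sqrt \<epsilon>" by (simp add: E_def)
    finally show "norm (\<integral>Q. F' s Q * \<psi> \<epsilon> p q r Q \<partial>lborel) \<le> E * sqrt \<epsilon>" unfolding eq .
  qed auto
  then show ?thesis by (intro exI[of _ E]) simp
qed

text \<open>Remove the damping along \<epsilon> = 1 / (m + 1): the integrals converge by domination,
  while \<open>\<Phi>_\<psi>_bound\<close> sends them to 0.\<close>

lemma \<Phi>_integral_char3:
  assumes n: "n = q\<^sup>2 - p * r"
  shows "(\<integral>Q. (\<Phi> n 1 Q - \<Phi> n 0 Q) * char3 (p, q, r) Q \<partial>lborel) = 0"
proof -
  obtain E where E: "\<And>\<epsilon>. 0 < \<epsilon> \<Longrightarrow> \<epsilon> \<le> 1 \<Longrightarrow>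
    norm ((\<integral>Q. \<Phi> n 1 Q * \<psi> \<epsilon> p q r Q \<partial>lborel) - (\<integral>Q. \<Phi> n 0 Q * \<psi> \<epsilon> p q r Q \<partial>lborel)) \<le> E * sqrt \<epsilon>"
    using \<Phi>_\<psi>_bound[OF n] by blast
  define e where "e m = inverse (real (Suc m))" for m
  have e: "0 < e m" "e m \<le> 1" for m by (auto simp: e_def inverse_le_1_iff)
  have e0: "e \<longlonglongrightarrow> 0" unfolding e_def[abs_def] by (rule LIMSEQ_inverse_real_of_nat)
  have int: "integrable lborel (\<lambda>Q. \<Phi> n s Q * \<psi> (e m) p q r Q)" if "s \<in> {0..1}" for s m
    using that e by (intro integrable_\<Phi>_mult \<psi>_measurable norm_\<psi>) (auto intro: less_imp_le)
  have int0: "integrable lborel (\<lambda>Q. \<Phi> n s Q)" if "s \<in> {0..1}" for s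
    using integrable_\<Phi>_mult[OF that, of "\<lambda>_. 1" n] by simp
  have lim: "\<psi> (e m) p q r Q = char3 (p, q, r) Q * of_real (exp (- e m * ((fst Q)\<^sup>2 + (fst (snd Q))\<^sup>2 + (snd (snd Q))\<^sup>2)))" for m Q
    by (cases Q) (simp add: \<psi>_def tensor_def gauss_def char3_def cis_mult[symmetric] distrib_left exp_add[symmetric] exp_diff exp_minus field_simps flip: of_real_mult)
  have 1: "(\<lambda>m. \<integral>Q. (\<Phi> n 1 Q - \<Phi> n 0 Q) * \<psi> (e m) p q r Q \<partial>lborel) \<longlonglongrightarrow> (\<integral>Q. (\<Phi> n 1 Q - \<Phi> n 0 Q) * char3 (p, q, r) Q \<partial>lborel)"
  proof (rule integral_dominated_convergence[where w = "\<lambda>Q. norm (\<Phi> n 1 Q - \<Phi> n 0 Q)"])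
    show "AE Q in lborel. (\<lambda>m. (\<Phi> n 1 Q - \<Phi> n 0 Q) * \<psi> (e m) p q r Q) \<longlonglongrightarrow> (\<Phi> n 1 Q - \<Phi> n 0 Q) * char3 (p, q, r) Q"
    proof (intro AE_I2)
      fix Q :: vec3
      define t where "t = (fst Q)\<^sup>2 + (fst (snd Q))\<^sup>2 + (snd (snd Q))\<^sup>2"
      have "(\<lambda>m. char3 (p, q, r) Q * of_real (exp (- e m * t))) \<longlonglongrightarrow> char3 (p, q, r) Q * of_real (exp (- 0 * t))"
        by (intro tendsto_intros e0)
      then show "(\<lambda>m. (\<Phi> n 1 Q - \<Phi> n 0 Q) * \<psi> (e m) p q r Q) \<longlonglongrightarrow> (\<Phi> n 1 Q - \<Phi> n 0 Q) * char3 (p, q, r) Q"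
        unfolding lim t_def[symmetric] by (intro tendsto_mult tendsto_const) simp
    qed
    show "AE Q in lborel. norm ((\<Phi> n 1 Q - \<Phi> n 0 Q) * \<psi> (e m) p q r Q) \<le> norm (\<Phi> n 1 Q - \<Phi> n 0 Q)" for m
      using norm_\<psi>[of "e m" p q r] e[of m] by (intro AE_I2) (simp add: norm_mult mult_left_le)
    show "integrable lborel (\<lambda>Q. norm (\<Phi> n 1 Q - \<Phi> n 0 Q))"
      by (intro integrable_norm Bochner_Integration.integrable_diff int0) auto
    show "(\<lambda>Q. (\<Phi> n 1 Q - \<Phi> n 0 Q) * \<psi> (e m) p q r Q) \<in> borel_measurable lborel" for m
      unfolding measurable_lborel2 by (intro borel_measurable_times borel_measurable_diff \<Phi>_measurable \<psi>_measurable)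
    show "(\<lambda>Q. (\<Phi> n 1 Q - \<Phi> n 0 Q) * char3 (p, q, r) Q) \<in> borel_measurable lborel"
      unfolding measurable_lborel2 by (intro borel_measurable_times borel_measurable_diff \<Phi>_measurable char3_measurable)
  qed
  have 2: "(\<lambda>m. \<integral>Q. (\<Phi> n 1 Q - \<Phi> n 0 Q) * \<psi> (e m) p q r Q \<partial>lborel) \<longlonglongrightarrow> 0"
  proof (rule Lim_null_comparison)
    have "(\<lambda>m. E * sqrt (e m)) \<longlonglongrightarrow> E * sqrt 0" by (intro tendsto_intros e0)
    then show "(\<lambda>m. E * sqrt (e m)) \<longlonglongrightarrow> 0" by simp
    have "(\<integral>Q. (\<Phi> n 1 Q - \<Phi> n 0 Q) * \<psi> (e m) p q r Q \<partial>lborel)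
       = (\<integral>Q. \<Phi> n 1 Q * \<psi> (e m) p q r Q \<partial>lborel) - (\<integral>Q. \<Phi> n 0 Q * \<psi> (e m) p q r Q \<partial>lborel)" for m
      unfolding left_diff_distrib by (intro Bochner_Integration.integral_diff int) auto
    then show "\<forall>\<^sub>F m in sequentially. norm (\<integral>Q. (\<Phi> n 1 Q - \<Phi> n 0 Q) * \<psi> (e m) p q r Q \<partial>lborel) \<le> E * sqrt (e m)"
      using E[OF e] by (intro always_eventually) simp
  qed
  show ?thesis by (rule LIMSEQ_unique[OF 1 2])
qed

lemma \<Phi>_01:
  "\<Phi> n 0 Q = K (2 * of_real pi * \<i> * \<tau>) Q"
  "\<Phi> n 1 Q = inverse (csqrt (4 * \<tau> + 1) ^ (2 * k + 1)) * K (2 * of_real pi * \<i> * (\<tau> / (4 * \<tau> + 1))) Q"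
proof -
  have "exp (2 * of_real pi * \<i> * of_int n) = 1" using exp_integer_2pi[of "of_int n"] by (simp add: mult_ac)
  then show "\<Phi> n 0 Q = K (2 * of_real pi * \<i> * \<tau>) Q"
    "\<Phi> n 1 Q = inverse (csqrt (4 * \<tau> + 1) ^ (2 * k + 1)) * K (2 * of_real pi * \<i> * (\<tau> / (4 * \<tau> + 1))) Q"
    by (simp_all add: \<Phi>_def w_def ls_def \<tau>s_def J_def del: csqrt.simps)
qed

lemma K_lat_summable: "(\<lambda>n. norm (K (2 * of_real pi * \<i> * \<tau>) (lat n))) summable_on UNIV"
proof -
  obtain D where D: "\<And>s Q. s \<in> {0..1} \<Longrightarrow> norm (\<Phi> 0 s Q) \<le> D * wt3 Q" using \<Phi>_bounds by metis
  show ?thesis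
  proof (rule summable_on_comparison_test)
    show "(\<lambda>n. D * wt3 (lat n)) summable_on UNIV" by (intro summable_on_cmult_right wt3_summable)
    show "norm (K (2 * of_real pi * \<i> * \<tau>) (lat n)) \<le> D * wt3 (lat n)" for n
      using D[of 0 "lat n"] by (simp add: \<Phi>_01)
  qed auto
qed

lemma K_lat_shear:
  "((\<lambda>n. inverse (csqrt (4 * \<tau> + 1) ^ (2 * k + 1)) * K (2 * of_real pi * \<i> * (\<tau> / (4 * \<tau> + 1))) (lat n)
      - K (2 * of_real pi * \<i> * \<tau>) (lat n)) has_sum 0) UNIV"
proof -
  obtain D where D: "\<And>s Q. s \<in> {0..1} \<Longrightarrow> norm (\<Phi> 0 s Q) \<le> D * wt3 Q" using \<Phi>_bounds by metis
  define F where "F Q = \<Phi> 0 1 Q - \<Phi> 0 0 Q" for Q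
  \<comment> \<open>The twists agree at both end points for all \<open>n\<close>, so a single
    \<open>F\<close> can be tested at each frequency with the twist adapted to it.\<close>
  have F: "F Q = \<Phi> n 1 Q - \<Phi> n 0 Q" for n Q by (simp only: F_def \<Phi>_01)
  have "((\<lambda>n. F (lat n)) has_sum 0) UNIV"
  proof (rule lattice_sum_zero[where C = "D + D"])
    have "continuous_on UNIV (\<Phi> 0 s)" if "s \<in> {0..1}" for s
      unfolding \<Phi>_def[abs_def] using Re_ls[OF that] \<delta>_pos by (intro continuous_intros K_continuous) auto
    then show "continuous_on UNIV F" unfolding F_def[abs_def] by (intro continuous_intros) auto
    show "norm (F Q) \<le> (D + D) * wt3 Q" for Q
      unfolding F_def using norm_triangle_ineq4[of "\<Phi> 0 1 Q" "\<Phi> 0 0 Q"] D[of 1 Q] D[of 0 Q] by (simp add: distrib_right)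
    show "(\<integral>Q. F Q * char3 m Q \<partial>lborel) = 0" for m
    proof -
      obtain p q r where m: "m = (p, q, r)" by (metis prod_cases3)
      show ?thesis unfolding m F[of _ "q\<^sup>2 - p * r"] by (rule \<Phi>_integral_char3) simp
    qed
  qed
  then show ?thesis by (simp only: F_def \<Phi>_01)
qed

end

end

section \<open>The generating function\<close>

lemma quad_forms_nonempty_mod_4:
  assumes "quad_forms D \<noteq> {}"
  shows "D mod 4 \<in> {0, 1}"
proof -
  obtain a b c where D: "D = b\<^sup>2 - 4 * a * c" using assms by (auto simp: quad_forms_def)
  have "D mod 4 = b\<^sup>2 mod 4"
  proof -
    have "D = b\<^sup>2 + (- (a * c)) * 4" by (simp add: D)
    then show ?thesis by (simp only: mod_mult_self1)
  qed
  also have "b\<^sup>2 mod 4 \<in> {0, 1}"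
    by (cases "even b") (auto elim!: evenE oddE simp: power2_eq_square algebra_simps mod_add_eq[symmetric])
  finally show ?thesis .
qed

context form_kernel
begin

text \<open>Only the sign of \<open>D\<close> is imposed. In the other residue classes modulo 4
  there are no forms, so \<open>omega\<close> is an empty sum.\<close>

definition coeff :: "int \<Rightarrow> complex" where
  "coeff D = (if D > 0 then of_real (of_int D powr (real k - 1 / 2)) * omega (k + 1) D z else 0)"

lemma coeff_nonzero: "coeff D \<noteq> 0 \<Longrightarrow> D > 0 \<and> D mod 4 \<in> {0, 1}"
  using quad_forms_nonempty_mod_4[of D] by (cases "quad_forms D = {}") (auto simp: coeff_def omega_def split: if_splits)

lemma K_lat:
  assumes "Q \<in> quad_forms D"
  shows "K (2 * of_real pi * \<i> * \<tau>) (lat Q) =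
    (if D > 0 then of_real (Im z) * of_real (of_int D powr (real k - 1 / 2)) * exp (2 * of_real pi * \<i> * of_int D * \<tau>) *
       (of_real (qf_sub Q z) / qf_eval Q z ^ (k + 1)) else 0)"
proof -
  obtain a b c where Q: "Q = (a, b, c)" by (metis prod_cases3)
  have "D = b\<^sup>2 - 4 * a * c" using assms by (simp add: Q quad_forms_def)
  then have d: "disc (lat Q) = of_int D" by (simp add: disc_def lat_def Q)
  have m: "M (lat Q) = qf_eval Q z" by (simp add: M_def lat_def Q qf_eval_def)
  have l: "L (lat Q) = Im z * qf_sub Q z" using Im_z by (simp add: L_def lat_def Q qf_sub_def)
  show ?thesis
    unfolding K_def T_def d m l
    by (simp add: pos_powr_def \<alpha>_def field_simps)
qed

text \<open>Absolute summability over all forms permits grouping them by discriminant; forms of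
  nonpositive discriminant contribute 0 by the cut-off. The same rearrangement yields the
  q-expansion and the lattice sum.\<close>

lemma has_sum_K_lat:
  assumes "Im \<tau> > 0"
  shows "((\<lambda>D. coeff D * exp (2 * of_real pi * \<i> * of_int D * \<tau>)) has_sum Lambda k \<tau> z) UNIV"
    "((\<lambda>n. K (2 * of_real pi * \<i> * \<tau>) (lat n)) has_sum of_real (Im z) * Lambda k \<tau> z) UNIV"
proof -
  define g where "g n = K (2 * of_real pi * \<i> * \<tau>) (lat n)" for n
  define d where "d = (\<lambda>(a, b, c). b\<^sup>2 - 4 * a * c :: int)"
  have mem: "n \<in> quad_forms (d n)" for n by (cases n) (simp add: quad_forms_def d_def)
  have mem': "n \<in> quad_forms D \<longleftrightarrow> d n = D" for n D by (cases n) (simp add: quad_forms_def d_def)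
  have sg: "g summable_on UNIV"
    unfolding g_def by (rule abs_summable_summable[OF K_lat_summable[OF assms]])
  then have "(g has_sum infsum g UNIV) UNIV" by (rule has_sum_infsum)
  then have "((\<lambda>p. g (snd p)) has_sum infsum g UNIV) (Sigma UNIV quad_forms)"
    by (subst has_sum_reindex_bij_witness[of _ "\<lambda>n. (d n, n)" snd UNIV g]) (auto simp: mem mem')
  moreover have inner: "((\<lambda>n. g (snd (D, n))) has_sum infsum g (quad_forms D)) (quad_forms D)" for D
    using summable_on_subset_banach[OF sg, of "quad_forms D"] by (simp add: has_sum_infsum)
  ultimately have outer: "((\<lambda>D. infsum g (quad_forms D)) has_sum infsum g UNIV) UNIV"
    by (rule has_sum_Sigma')
  have G: "infsum g (quad_forms D) = of_real (Im z) * (coeff D * exp (2 * of_real pi * \<i> * of_int D * \<tau>))" for D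
  proof (cases "D > 0")
    case True
    have "infsum g (quad_forms D) = infsum (\<lambda>Q. (of_real (Im z) * of_real (of_int D powr (real k - 1 / 2)) * exp (2 * of_real pi * \<i> * of_int D * \<tau>)) *
       (of_real (qf_sub Q z) / qf_eval Q z ^ (k + 1))) (quad_forms D)"
      by (rule infsum_cong) (simp only: g_def K_lat True if_True)
    then show ?thesis using True unfolding infsum_cmult_right' by (simp add: coeff_def omega_def mult_ac)
  next
    case False
    have "infsum g (quad_forms D) = infsum (\<lambda>_. 0) (quad_forms D)"
      by (rule infsum_cong) (use False in \<open>simp only: g_def K_lat if_False\<close>)
    then show ?thesis using False by (simp add: coeff_def)
  qed
  have y: "complex_of_real (Im z) \<noteq> 0" using Im_z by simp
  define S where "S = infsum g UNIV / of_real (Im z)"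
  have "((\<lambda>D. inverse (of_real (Im z)) * (of_real (Im z) * (coeff D * exp (2 * of_real pi * \<i> * of_int D * \<tau>))))
      has_sum inverse (of_real (Im z)) * infsum g UNIV) UNIV"
    using outer unfolding G by (rule has_sum_cmult_right)
  then have S: "((\<lambda>D. coeff D * exp (2 * of_real pi * \<i> * of_int D * \<tau>)) has_sum S) UNIV"
    using y by (simp add: S_def field_simps)
  have "Lambda k \<tau> z = infsum (\<lambda>D. coeff D * exp (2 * of_real pi * \<i> * of_int D * \<tau>)) UNIV"
    unfolding Lambda_def
  proof (rule infsum_cong_neutral)
    fix D :: int assume "D \<in> UNIV - {D. 0 < D \<and> D mod 4 \<in> {0, 1}}"
    then have "coeff D = 0" using coeff_nonzero[of D] by blast
    then show "coeff D * exp (2 * of_real pi * \<i> * of_int D * \<tau>) = 0" by simp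
  qed (auto simp: coeff_def)
  then have L: "Lambda k \<tau> z = S" using infsumI[OF S] by simp
  show "((\<lambda>D. coeff D * exp (2 * of_real pi * \<i> * of_int D * \<tau>)) has_sum Lambda k \<tau> z) UNIV"
    using S L by simp
  show "((\<lambda>n. K (2 * of_real pi * \<i> * \<tau>) (lat n)) has_sum of_real (Im z) * Lambda k \<tau> z) UNIV"
    using has_sum_infsum[OF sg] y unfolding L S_def g_def by simp
qed

lemma Lambda_translate: "Lambda k (\<tau> + 1) z = Lambda k \<tau> z"
proof -
  have "exp (2 * of_real pi * \<i> * of_int D * (\<tau> + 1)) = exp (2 * of_real pi * \<i> * of_int D * \<tau>)" for D
  proof -
    have "exp (2 * of_real pi * \<i> * of_int D) = 1" using exp_integer_2pi[of "of_int D"] by (simp add: mult_ac)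
    then show ?thesis by (simp add: distrib_left exp_add)
  qed
  then show ?thesis by (simp add: Lambda_def)
qed

lemma Lambda_shear:
  assumes "Im \<tau> > 0"
  shows "Lambda k (\<tau> / (4 * \<tau> + 1)) z = csqrt (4 * \<tau> + 1) ^ (2 * k + 1) * Lambda k \<tau> z"
proof -
  define j where "j = csqrt (4 * \<tau> + 1) ^ (2 * k + 1)"
  have "4 * \<tau> + 1 \<noteq> 0" using denom_nonzero[of \<tau> 4 1] assms by simp
  then have j: "j \<noteq> 0" by (simp add: j_def del: csqrt.simps)
  have \<tau>': "Im (\<tau> / (4 * \<tau> + 1)) > 0" using Im_div_4[OF assms, of 4] by simp
  have "((\<lambda>n. inverse j * K (2 * of_real pi * \<i> * (\<tau> / (4 * \<tau> + 1))) (lat n) + (-1) * K (2 * of_real pi * \<i> * \<tau>) (lat n))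
      has_sum inverse j * (of_real (Im z) * Lambda k (\<tau> / (4 * \<tau> + 1)) z) + (-1) * (of_real (Im z) * Lambda k \<tau> z)) UNIV"
    by (intro has_sum_add has_sum_cmult_right has_sum_K_lat(2) assms \<tau>')
  then have "((\<lambda>n. inverse j * K (2 * of_real pi * \<i> * (\<tau> / (4 * \<tau> + 1))) (lat n) - K (2 * of_real pi * \<i> * \<tau>) (lat n))
      has_sum inverse j * (of_real (Im z) * Lambda k (\<tau> / (4 * \<tau> + 1)) z) - of_real (Im z) * Lambda k \<tau> z) UNIV"
    by simp
  then have "inverse j * (of_real (Im z) * Lambda k (\<tau> / (4 * \<tau> + 1)) z) - of_real (Im z) * Lambda k \<tau> z = 0"
    using K_lat_shear[OF assms, folded j_def] has_sum_unique by blast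
  then have "of_real (Im z) * (inverse j * Lambda k (\<tau> / (4 * \<tau> + 1)) z - Lambda k \<tau> z) = 0"
    by (simp add: algebra_simps)
  then have "inverse j * Lambda k (\<tau> / (4 * \<tau> + 1)) z = Lambda k \<tau> z" using Im_z by simp
  then show ?thesis unfolding j_def[symmetric] using j by (simp add: field_simps)
qed

end

theorem theorem1p2:
  fixes k :: nat and z :: complex
  assumes "k > 2" and "even k" and "z \<in> upper_half_plane"
  shows "(\<forall>\<gamma>\<in>Gamma0 4. \<forall>\<tau>\<in>upper_half_plane.
            slash (real k + 1 / 2) \<gamma> (\<lambda>\<tau>. Lambda k \<tau> z) \<tau> = Lambda k \<tau> z) \<and>
         (\<lambda>\<tau>. Lambda k \<tau> z) \<in> kohnen_plus_space (real k + 1 / 2)"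
proof -
  \<comment> \<open>Evenness lifts \<open>k > 2\<close> to the bound \<open>k \<ge> 4\<close> of the
    locale.\<close>
  have "k \<noteq> 3" using assms(2) by auto
  then interpret form_kernel z k
    using assms by unfold_locales (auto simp: upper_half_plane_def)
  have \<kappa>: "real k + 1 / 2 = real (2 * k + 1) / 2" by simp
  have modular: "\<forall>\<gamma>\<in>Gamma0 4. \<forall>\<tau>\<in>upper_half_plane.
      slash (real k + 1 / 2) \<gamma> (\<lambda>\<tau>. Lambda k \<tau> z) \<tau> = Lambda k \<tau> z"
    unfolding \<kappa> upper_half_plane_def
    by (intro ballI slash_invariant_Gamma0_4 Lambda_translate Lambda_shear) auto
  have "fourier_expansion (\<lambda>\<tau>. Lambda k \<tau> z) coeff"
    unfolding fourier_expansion_def upper_half_plane_def using has_sum_K_lat(1) by simp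
  \<comment> \<open>For even \<open>k\<close> the plus-space sign is +1, so the condition is the
    congruence on discriminants itself.\<close>
  moreover have "coeff n \<noteq> 0 \<Longrightarrow> (if even \<lfloor>real k + 1 / 2 - 1 / 2\<rfloor> then n else - n) mod 4 \<in> {0, 1}" for n
    using coeff_nonzero[of n] assms(2) by simp
  ultimately show ?thesis
    using modular unfolding kohnen_plus_space_def modular_Gamma0_4_def by blast
qed

end
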